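(* Let $H:\mathbb{R}\times\mathbb{R}^N\to[0,+\infty)$ be continuous and let $L(x,t,\xi)=H(t,\xi)$ for every $(x,t,\xi)\in\Omega\times\mathbb{R}\times\mathbb{R}^N$. Let $\xi_1,\dots,\xi_m\in\mathbb{R}^N$, and assume that there exist $\lambda_1,\dots,\lambda_m>0$ such that $$\sum_{i=1}^m\lambda_i=1,\qquad\sum_{i=1}^m\lambda_i\xi_i=0.$$ Assume that there exists a Borel function $q:\mathbb{R}\to[0,+\infty)$ such that, for every $t\in\mathbb{R}$, there exist $\zeta_{1,t},\dots,\zeta_{m,t}\in\mathbb{R}^N$ satisfying, for every $i=1,\dots,m$, $$H(t,\xi)\geq H(t,\xi_i)+\langle\zeta_{i,t},\xi-\xi_i\rangle\qquad\text{for every }\xi\in\mathbb{R}^N$$ and $$\sum_{i=1}^m\lambda_i\langle\zeta_{i,t},\xi_i\rangle\leq q(t).$$ Then, for every $u\in\mathcal A$ such that $q\circ u\in L^1(\Omega)$, one has $$H(u,\xi_i)\in L^1(\Omega)\qquad\text{for every }i=1,\dots,m.$$ Consequently, $\mathcal L$ is $L^\infty(\Omega)$-regular at $u$.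
   Context: Let $N\ge 1$, let $\Omega\subset\mathbb{R}^N$ be a bounded open set, $1\leq p\leq N$, and $\varphi\in W^{1,p}(\mathbb{R}^N)\cap L^\infty(\mathbb{R}^N)$. $W^{1,p}_0(\Omega)$ is the closure in $W^{1,p}(\Omega)$ of the $C^1$ functions with compact support in $\Omega$, and $W^{1,p}_\varphi(\Omega)=\varphi+W^{1,p}_0(\Omega)$. Given $L:\Omega\times\mathbb{R}\times\mathbb{R}^N\to\mathbb{R}$, set $\mathcal L(u)=\int_\Omega L(x,u(x),\nabla u(x))\,dx$, and let $\mathcal A=\{u\in W^{1,p}_\varphi(\Omega): L(x,u,\nabla u)\in L^1(\Omega)\}$. The functional $\mathcal L$ is said to be $L^\infty(\Omega)$-regular at $u\in\mathcal A$ if there exists a sequence $(u_k)_{k\ge1}\subset\mathcal A\cap L^\infty(\Omega)$ such that $u_k\to u$ in $W^{1,p}(\Omega)$ and $L(x,u_k,\nabla u_k)\to L(x,u,\nabla u)$ in $L^1(\Omega)$. *)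

theory Defs
  imports "HOL-Analysis.Analysis"
begin

text \<open>
  Elements of function spaces over \<open>\<Omega>\<close> are represented by total functions on the ambient
  space; their values outside \<open>\<Omega>\<close> are irrelevant, and functions that agree almost everywhere
  on \<open>\<Omega>\<close> represent the same element.
\<close>

definition Lp_space :: "'a::euclidean_space set \<Rightarrow> real \<Rightarrow> ('a \<Rightarrow> 'b::euclidean_space) set" where
  "Lp_space \<Omega> p = {f \<in> borel_measurable (lebesgue_on \<Omega>).
      integrable (lebesgue_on \<Omega>) (\<lambda>x. norm (f x) powr p)}"

definition Lp_norm :: "'a::euclidean_space set \<Rightarrow> real \<Rightarrow> ('a \<Rightarrow> 'b::euclidean_space) \<Rightarrow> real" where
  "Lp_norm \<Omega> p f = (LINT x|lebesgue_on \<Omega>. norm (f x) powr p) powr (1 / p)"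

definition Linf_space :: "'a::euclidean_space set \<Rightarrow> ('a \<Rightarrow> real) set" where
  "Linf_space \<Omega> = {f \<in> borel_measurable (lebesgue_on \<Omega>).
      \<exists>C. AE x in lebesgue_on \<Omega>. \<bar>f x\<bar> \<le> C}"

text \<open>\<open>C\<^sup>1\<close> functions with compact support in \<open>\<Omega>\<close>, extended by zero to the whole space.\<close>

definition C1_gradient :: "('a::euclidean_space \<Rightarrow> real) \<Rightarrow> ('a \<Rightarrow> 'a) \<Rightarrow> bool" where
  "C1_gradient f g \<longleftrightarrow> continuous_on UNIV g \<and> (\<forall>x. GDERIV f x :> g x)"

definition C1_compact_support :: "'a::euclidean_space set \<Rightarrow> ('a \<Rightarrow> real) set" where
  "C1_compact_support \<Omega> = {f. (\<exists>g. C1_gradient f g) \<and>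
      compact (closure {x. f x \<noteq> 0}) \<and> closure {x. f x \<noteq> 0} \<subseteq> \<Omega>}"

definition locally_integrable :: "'a::euclidean_space set \<Rightarrow> ('a \<Rightarrow> 'b::euclidean_space) \<Rightarrow> bool" where
  "locally_integrable \<Omega> f \<longleftrightarrow> (\<forall>K. compact K \<and> K \<subseteq> \<Omega> \<longrightarrow> f absolutely_integrable_on K)"

text \<open>
  For first-order weak derivatives the test functions may be taken to be \<open>C\<^sup>1\<close> with compact
  support (as in Gilbarg and Trudinger, for instance). The integration-by-parts identities for
  all the partial derivatives are collected in a single vector-valued equation.
\<close>

definition is_weak_gradient ::
    "'a::euclidean_space set \<Rightarrow> ('a \<Rightarrow> real) \<Rightarrow> ('a \<Rightarrow> 'a) \<Rightarrow> bool" where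
  "is_weak_gradient \<Omega> u g \<longleftrightarrow> locally_integrable \<Omega> u \<and> locally_integrable \<Omega> g \<and>
      (\<forall>\<psi> d\<psi>. \<psi> \<in> C1_compact_support \<Omega> \<and> C1_gradient \<psi> d\<psi> \<longrightarrow>
        (LINT x|lebesgue_on \<Omega>. u x *\<^sub>R d\<psi> x) = - (LINT x|lebesgue_on \<Omega>. \<psi> x *\<^sub>R g x))"

text \<open>On open \<open>\<Omega>\<close> the weak gradient is unique up to null sets; \<open>SOME\<close> picks a representative.\<close>

definition weak_gradient :: "'a::euclidean_space set \<Rightarrow> ('a \<Rightarrow> real) \<Rightarrow> ('a \<Rightarrow> 'a)" where
  "weak_gradient \<Omega> u = (SOME g. is_weak_gradient \<Omega> u g)"

definition sobolev :: "'a::euclidean_space set \<Rightarrow> real \<Rightarrow> ('a \<Rightarrow> real) set" where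
  "sobolev \<Omega> p = {u \<in> Lp_space \<Omega> p. \<exists>g \<in> Lp_space \<Omega> p. is_weak_gradient \<Omega> u g}"

definition sobolev_norm :: "'a::euclidean_space set \<Rightarrow> real \<Rightarrow> ('a \<Rightarrow> real) \<Rightarrow> real" where
  "sobolev_norm \<Omega> p u = Lp_norm \<Omega> p u + Lp_norm \<Omega> p (weak_gradient \<Omega> u)"

definition sobolev0 :: "'a::euclidean_space set \<Rightarrow> real \<Rightarrow> ('a \<Rightarrow> real) set" where
  "sobolev0 \<Omega> p = {u \<in> sobolev \<Omega> p. \<forall>\<epsilon>>0. \<exists>\<psi> \<in> C1_compact_support \<Omega>.
      sobolev_norm \<Omega> p (\<lambda>x. \<psi> x - u x) < \<epsilon>}"

definition sobolev_affine ::
    "'a::euclidean_space set \<Rightarrow> real \<Rightarrow> ('a \<Rightarrow> real) \<Rightarrow> ('a \<Rightarrow> real) set" where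
  "sobolev_affine \<Omega> p \<phi> = (\<lambda>v x. \<phi> x + v x) ` sobolev0 \<Omega> p"

definition admissible ::
    "'a::euclidean_space set \<Rightarrow> real \<Rightarrow> ('a \<Rightarrow> real) \<Rightarrow> ('a \<Rightarrow> real \<Rightarrow> 'a \<Rightarrow> real) \<Rightarrow> ('a \<Rightarrow> real) set" where
  "admissible \<Omega> p \<phi> L = {u \<in> sobolev_affine \<Omega> p \<phi>.
      integrable (lebesgue_on \<Omega>) (\<lambda>x. L x (u x) (weak_gradient \<Omega> u x))}"

text \<open>
  Regularity at \<open>u\<close> of the functional \<open>v \<mapsto> \<integral>\<^sub>\<Omega> L(x, v, \<nabla>v) dx\<close>; the notion depends only on the
  integrand \<open>L\<close>, which is therefore the parameter.
\<close>

definition Linf_regular ::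
    "'a::euclidean_space set \<Rightarrow> real \<Rightarrow> ('a \<Rightarrow> real) \<Rightarrow> ('a \<Rightarrow> real \<Rightarrow> 'a \<Rightarrow> real) \<Rightarrow> ('a \<Rightarrow> real) \<Rightarrow> bool" where
  "Linf_regular \<Omega> p \<phi> L u \<longleftrightarrow> u \<in> admissible \<Omega> p \<phi> L \<and>
     (\<exists>w :: nat \<Rightarrow> 'a \<Rightarrow> real.
        (\<forall>k. w k \<in> admissible \<Omega> p \<phi> L \<inter> Linf_space \<Omega>) \<and>
        (\<lambda>k. sobolev_norm \<Omega> p (\<lambda>x. w k x - u x)) \<longlonglongrightarrow> 0 \<and>
        (\<lambda>k. LINT x|lebesgue_on \<Omega>. \<bar>L x (w k x) (weak_gradient \<Omega> (w k) x)
                                    - L x (u x) (weak_gradient \<Omega> u x)\<bar>) \<longlonglongrightarrow> 0)"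

end

theory Submission
  imports Defs
begin

text \<open>
  Averaging the affine minorants with the weights \<open>\<lambda>\<^sub>i\<close> gives \<open>b(t)\<close> with
  \<open>\<Sum>\<^sub>i \<lambda>\<^sub>i H(t, \<xi>\<^sub>i) \<le> H(t, \<eta>) + q(t) - \<langle>b(t), \<eta>\<rangle>\<close> for all \<open>\<eta>\<close>. Put \<open>t = u(x)\<close>, \<open>\<eta> = \<nabla>u(x)\<close>:
  where \<open>|u| > \<parallel>\<phi>\<parallel>\<^sub>\<infinity>\<close> the term \<open>\<langle>b(u), \<nabla>u\<rangle>\<close> is the divergence of a function of \<open>u\<close> that vanishes on
  the boundary, so it integrates to zero and \<open>H(u, \<xi>\<^sub>i)\<close> is integrable.

  For the regularity, integrability of \<open>f(u)\<close>, \<open>f = \<Sum>\<^sub>i H(\<cdot>, \<xi>\<^sub>i)\<close>, provides arbitrarily high levels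
  \<open>t\<close> at which \<open>f(t) |{u \<ge> t}|\<close> is as small as desired. Truncate \<open>u\<close> from above by a sawtooth
  function \<open>w\<close> with values in \<open>[t, t + \<delta>]\<close> and gradients in \<open>{\<xi>\<^sub>1, \<dots>, \<xi>\<^sub>m}\<close>, which exists because
  \<open>0\<close> is a convex combination of the \<open>\<xi>\<^sub>i\<close>; where \<open>u > w\<close> the energy of \<open>w\<close> is controlled by \<open>f(t) |{u \<ge> t}|\<close>.
  Truncation from below is symmetric.

  All Sobolev calculus is done with \<open>C\<^sup>1\<close> approximations, obtained for \<open>\<phi>\<close> by mollification and for
  \<open>u - \<phi>\<close> from the definition of \<open>W\<^sub>0\<^sup>1\<^sup>,\<^sup>p\<close>.
\<close>

subsection \<open>Convergence in mean of order \<open>p\<close>\<close>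

text \<open>Truncation by a constant level would fail: \<open>H\<close> is not assumed convex in the
  gradient, so in general \<open>H (t, 0)\<close> is not controlled by the values
  \<open>H (t, \<xi> i)\<close>. Whatever replaces \<open>u\<close> must have its gradient among the
  \<xi> i at every point, and for this reason the gradients of the sawtooth functions are tracked
  pointwise and not merely almost everywhere.

  The boundary condition is carried by pairs of C1 functions: \<open>F n\<close> tends to
  \<open>u\<close>, \<open>V n\<close> has compact support, and \<open>F n\<close> is bounded by
  \<open>M\<close> wherever \<open>V n\<close> is 0. A C1 function of \<open>F n\<close> that
  vanishes on arguments in [-M, M] then has compact support, and its gradient has integral zero.

  The slope b(t) is chosen level by level, with neither measurability nor a bound. The flux identity
  is therefore needed on Borel sets of levels, and the contributions of countably many level sets
  are added up as nonnegative integrals.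

  \<open>weak_gradient\<close> is an arbitrary choice, so uniqueness up to null sets has to come
  before any use of it. Mollification thus serves twice, for this uniqueness and for the
  approximation of \<phi>.\<close>

definition Lp :: "'c measure \<Rightarrow> real \<Rightarrow> ('c \<Rightarrow> 'b::euclidean_space) \<Rightarrow> bool" where
  "Lp M p f \<longleftrightarrow> f \<in> borel_measurable M \<and> integrable M (\<lambda>x. norm (f x) powr p)"

text \<open>Convergence is expressed by integrals of p-th powers, which avoids Minkowski's
  inequality and p-th roots. Membership of all terms is built in: the integral of a non-integrable
  function is 0 by convention, so the limit alone would say nothing about it.\<close>

definition Lp_tendsto :: "'c measure \<Rightarrow> real \<Rightarrow> (nat \<Rightarrow> 'c \<Rightarrow> 'b::euclidean_space) \<Rightarrow> ('c \<Rightarrow> 'b) \<Rightarrow> bool"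
    where
  "Lp_tendsto M p F f \<longleftrightarrow> (\<forall>n. Lp M p (F n)) \<and> Lp M p f \<and>
     (\<lambda>n. LINT x|M. norm (F n x - f x) powr p) \<longlonglongrightarrow> 0"

lemma LpD:
  assumes "Lp M p f"
  shows "f \<in> borel_measurable M" "integrable M (\<lambda>x. norm (f x) powr p)"
  using assms by (auto simp: Lp_def)

lemma Lp_space_iff: "f \<in> Lp_space \<Omega> p \<longleftrightarrow> Lp (lebesgue_on \<Omega>) p f"
  by (simp add: Lp_space_def Lp_def)

text \<open>Stands in for Minkowski's inequality: a sum is at most twice its larger term. The factor
  \<open>2 powr p\<close> is harmless, since only integrability and convergence to 0 are at
  stake.\<close>

lemma norm_add_powr_le:
  fixes a b :: "'b::real_normed_vector"
  assumes "0 \<le> p"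
  shows "norm (a + b) powr p \<le> 2 powr p * (norm a powr p + norm b powr p)"
proof -
  have "norm (a + b) powr p \<le> (2 * max (norm a) (norm b)) powr p"
    by (rule powr_mono2) (use assms norm_triangle_ineq[of a b] in auto)
  also have "\<dots> = 2 powr p * (max (norm a) (norm b) powr p)"
    by (simp add: powr_mult max_def)
  also have "\<dots> \<le> 2 powr p * (norm a powr p + norm b powr p)"
    by (intro mult_left_mono) (auto simp: max_def)
  finally show ?thesis .
qed

lemma Lp_mono:
  assumes "0 \<le> p" "Lp M p g" "f \<in> borel_measurable M" "AE x in M. norm (f x) \<le> C * norm (g x)"
  shows "Lp M p f"
proof -
  have "integrable M (\<lambda>x. norm (f x) powr p)"
  proof (rule Bochner_Integration.integrable_bound)
    show "integrable M (\<lambda>x. \<bar>C\<bar> powr p * norm (g x) powr p)"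
      using assms by (auto dest: LpD)
    show "AE x in M. norm (norm (f x) powr p) \<le> norm (\<bar>C\<bar> powr p * norm (g x) powr p)"
      using assms(4)
    proof eventually_elim
      case (elim x)
      have "norm (f x) \<le> \<bar>C\<bar> * norm (g x)"
        using elim by (meson abs_ge_self mult_right_mono norm_ge_zero order_trans)
      then have "norm (f x) powr p \<le> (\<bar>C\<bar> * norm (g x)) powr p"
        using assms by (intro powr_mono2) auto
      then show ?case by (simp add: powr_mult)
    qed
  qed (use assms in auto)
  then show ?thesis using assms by (auto simp: Lp_def)
qed

lemma Lp_scaleR_bounded:
  assumes "0 \<le> p" "Lp M p g" "\<beta> \<in> borel_measurable M" "\<And>x. x \<in> space M \<Longrightarrow> \<bar>\<beta> x\<bar> \<le> C"
  shows "Lp M p (\<lambda>x. \<beta> x *\<^sub>R g x)"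
  by (rule Lp_mono[OF assms(1,2), where C = C])
     (use assms in \<open>auto dest: LpD intro!: mult_right_mono\<close>)

lemma Lp_uminus: "Lp M p f \<Longrightarrow> Lp M p (\<lambda>x. - f x)"
  by (auto simp: Lp_def)

lemma Lp_add:
  assumes "0 \<le> p" "Lp M p f" "Lp M p g"
  shows "Lp M p (\<lambda>x. f x + g x)"
proof -
  have "integrable M (\<lambda>x. norm (f x + g x) powr p)"
  proof (rule Bochner_Integration.integrable_bound)
    show "integrable M (\<lambda>x. 2 powr p * (norm (f x) powr p + norm (g x) powr p))"
      using assms by (auto dest: LpD)
    show "AE x in M. norm (norm (f x + g x) powr p) \<le> norm (2 powr p * (norm (f x) powr p
        + norm (g x) powr p))"
      using norm_add_powr_le[OF assms(1)] by auto
  qed (use LpD(1)[OF assms(2)] LpD(1)[OF assms(3)] in auto)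
  then show ?thesis using assms by (auto simp: Lp_def)
qed

lemma Lp_diff:
  assumes "0 \<le> p" "Lp M p f" "Lp M p g"
  shows "Lp M p (\<lambda>x. f x - g x)"
  using Lp_add[OF assms(1,2) Lp_uminus[OF assms(3)]] by simp

lemma (in finite_measure) Lp_bounded:
  assumes "0 \<le> p" "f \<in> borel_measurable M" "AE x in M. norm (f x) \<le> C"
  shows "Lp M p f"
proof (rule Lp_mono[OF assms(1) _ assms(2), where C = C and g = "\<lambda>_. 1::real"])
  show "Lp M p (\<lambda>_. 1::real)" by (auto simp: Lp_def)
qed (use assms in auto)

lemma (in finite_measure) Lp_integrable:
  assumes "1 \<le> p" "Lp M p f"
  shows "integrable M f"
proof (rule Bochner_Integration.integrable_bound)
  show "integrable M (\<lambda>x. 1 + norm (f x) powr p)"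
    using assms by (auto dest: LpD)
  have "norm a \<le> 1 + norm a powr p" for a :: 'b
  proof (cases "norm a \<le> 1")
    case False
    then have "norm a powr 1 \<le> norm a powr p" using assms(1) by (intro powr_mono) auto
    then show ?thesis by simp
  qed (simp add: add_increasing2)
  then show "AE x in M. norm (f x) \<le> norm (1 + norm (f x) powr p)"
    by (auto simp: abs_of_nonneg intro: order_trans)
qed (use assms in \<open>auto dest: LpD\<close>)

lemma Lp_tendstoD:
  assumes "Lp_tendsto M p F f"
  shows "Lp M p (F n)" "Lp M p f" "(\<lambda>n. LINT x|M. norm (F n x - f x) powr p) \<longlonglongrightarrow> 0"
  using assms by (auto simp: Lp_tendsto_def)

lemma Lp_tendsto_subseq:
  assumes "Lp_tendsto M p F f" "strict_mono r"
  shows "Lp_tendsto M p (\<lambda>n. F (r n)) f"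
  using assms LIMSEQ_subseq_LIMSEQ[of "\<lambda>n. LINT x|M. norm (F n x - f x) powr p" 0 r]
  by (auto simp: Lp_tendsto_def o_def)

lemma Lp_tendsto_const: "Lp M p f \<Longrightarrow> Lp_tendsto M p (\<lambda>_. f) f"
  by (auto simp: Lp_tendsto_def)

lemma Lp_tendsto_uminus: "Lp_tendsto M p F f \<Longrightarrow> Lp_tendsto M p (\<lambda>n x. - F n x) (\<lambda>x. - f x)"
  by (auto simp: Lp_tendsto_def Lp_uminus norm_minus_commute)

lemma Lp_tendsto_add:
  assumes p: "0 \<le> p" and F: "Lp_tendsto M p F f" and G: "Lp_tendsto M p G g"
  shows "Lp_tendsto M p (\<lambda>n x. F n x + G n x) (\<lambda>x. f x + g x)"
proof -
  note FD = Lp_tendstoD[OF F] and GD = Lp_tendstoD[OF G]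
  have "(\<lambda>n. LINT x|M. norm (F n x + G n x - (f x + g x)) powr p) \<longlonglongrightarrow> 0"
  proof (rule tendsto_sandwich[OF _ _ tendsto_const])
    show "(\<lambda>n. 2 powr p * ((LINT x|M. norm (F n x - f x) powr p) +
        (LINT x|M. norm (G n x - g x) powr p))) \<longlonglongrightarrow> 0"
      using tendsto_mult_right_zero[OF tendsto_add_zero[OF FD(3) GD(3)]] by blast
    show "\<forall>\<^sub>F n in sequentially. (LINT x|M. norm (F n x + G n x - (f x + g x)) powr p)
        \<le> 2 powr p * ((LINT x|M. norm (F n x - f x) powr p) +
            (LINT x|M. norm (G n x - g x) powr p))"
    proof (intro always_eventually allI)
      fix n
      note i1 = LpD(2)[OF Lp_diff[OF p FD(1)[of n] FD(2)]] and i2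
          = LpD(2)[OF Lp_diff[OF p GD(1)[of n] GD(2)]]
      note i3 = LpD(2)[OF Lp_diff[OF p Lp_add[OF p FD(1)[of n] GD(1)[of n]] Lp_add[OF p FD(2)
          GD(2)]]]
      have "(LINT x|M. norm (F n x + G n x - (f x + g x)) powr p)
        \<le> (LINT x|M. 2 powr p * (norm (F n x - f x) powr p + norm (G n x - g x) powr p))"
      proof (rule integral_mono[OF i3])
        fix x
        show "norm (F n x + G n x - (f x + g x)) powr p \<le> 2 powr p * (norm (F n x - f x) powr p
            + norm (G n x - g x) powr p)"
          using norm_add_powr_le[OF p, of "F n x - f x" "G n x - g x"] by (simp add: algebra_simps)
      qed (use i1 i2 in auto)
      also have "\<dots> = 2 powr p * ((LINT x|M. norm (F n x - f x) powr p) +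
          (LINT x|M. norm (G n x - g x) powr p))"
        using i1 i2 by simp
      finally show "(LINT x|M. norm (F n x + G n x - (f x + g x)) powr p) \<le> \<dots>" .
    qed
  qed auto
  then show ?thesis using FD GD p by (auto simp: Lp_tendsto_def intro: Lp_add)
qed

lemma Lp_tendsto_trans_diff:
  assumes p: "0 \<le> p" and F: "Lp_tendsto M p F f"
    and D: "(\<lambda>n. LINT x|M. norm (G n x - F n x) powr p) \<longlonglongrightarrow> 0" and G: "\<And>n. Lp M p (G n)"
  shows "Lp_tendsto M p G f"
proof -
  have "Lp_tendsto M p (\<lambda>n x. G n x - F n x) (\<lambda>x. 0)"
    using D G Lp_tendstoD[OF F] p by (auto simp: Lp_tendsto_def Lp_diff) (auto simp: Lp_def)
  from Lp_tendsto_add[OF p F this] show ?thesis by simp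
qed

lemma Lp_tendsto_AE_subseq:
  assumes p: "0 < p" and F: "Lp_tendsto M p F f"
  obtains r where "strict_mono r" "AE x in M. (\<lambda>n. F (r n) x) \<longlonglongrightarrow> f x"
proof -
  note FD = Lp_tendstoD[OF F]
  obtain r where r: "strict_mono r" and ae: "AE x in M. (\<lambda>n. norm (F (r n) x - f x) powr p) \<longlonglongrightarrow> 0"
    using tendsto_L1_AE_subseq[of M "\<lambda>n x. norm (F n x - f x) powr p"] FD(3) p
      LpD(2)[OF Lp_diff[OF _ FD(1) FD(2)]] by auto
  have "AE x in M. (\<lambda>n. F (r n) x) \<longlonglongrightarrow> f x"
    using ae
  proof eventually_elim
    case (elim x)
    have "(\<lambda>n. (norm (F (r n) x - f x) powr p) powr (1/p)) \<longlonglongrightarrow> 0 powr (1/p)"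
      using p by (intro tendsto_powr' elim tendsto_const) auto
    then have "(\<lambda>n. norm (F (r n) x - f x)) \<longlonglongrightarrow> 0"
      using p by (simp add: powr_powr)
    then show ?case by (simp add: LIM_zero_iff tendsto_norm_zero_iff)
  qed
  with r that show thesis by blast
qed

lemma Lp_tendsto_dominated:
  assumes p: "0 < p" and w: "Lp M p w" and F: "\<And>n. F n \<in> borel_measurable M"
    and f: "f \<in> borel_measurable M"
    and bd: "\<And>n. AE x in M. norm (F n x) \<le> norm (w x)"
    and lim: "AE x in M. (\<lambda>n. F n x) \<longlonglongrightarrow> f x"
  shows "Lp_tendsto M p F f"
proof -
  have Fn: "Lp M p (F n)" for n
    by (rule Lp_mono[where C = 1 and g = w]) (use p w F bd in auto)
  have bd': "AE x in M. \<forall>n. norm (F n x) \<le> norm (w x)"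
    using bd by (simp add: AE_all_countable)
  have fb: "AE x in M. norm (f x) \<le> norm (w x)"
    using bd' lim
  proof eventually_elim
    case (elim x)
    show ?case using elim by (intro LIMSEQ_le_const2[OF tendsto_norm[OF elim(2)]]) auto
  qed
  have fL: "Lp M p f"
    by (rule Lp_mono[where C = 1 and g = w]) (use p w f fb in auto)
  have "(\<lambda>n. LINT x|M. norm (F n x - f x) powr p) \<longlonglongrightarrow> (LINT x|M. 0)"
  proof (rule integral_dominated_convergence[where w = "\<lambda>x. 2 powr p * (norm (w x) powr p
      + norm (w x) powr p)"])
    show "integrable M (\<lambda>x. 2 powr p * (norm (w x) powr p + norm (w x) powr p))"
      using w by (auto dest: LpD)
    show "AE x in M. (\<lambda>n. norm (F n x - f x) powr p) \<longlonglongrightarrow> 0"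
      using lim
    proof eventually_elim
      case (elim x)
      have "(\<lambda>n. norm (F n x - f x)) \<longlonglongrightarrow> 0" using elim by (simp add: LIM_zero tendsto_norm_zero)
      then have "(\<lambda>n. norm (F n x - f x) powr p) \<longlonglongrightarrow> 0 powr p"
        using p by (intro tendsto_powr') auto
      then show ?case by simp
    qed
    fix n
    show "AE x in M. norm (norm (F n x - f x) powr p) \<le> 2 powr p * (norm (w x) powr p
        + norm (w x) powr p)"
      using bd[of n] fb
    proof eventually_elim
      case (elim x)
      have "norm (F n x - f x) powr p \<le> 2 powr p * (norm (F n x) powr p + norm (- f x) powr p)"
        using norm_add_powr_le[of p "F n x" "- f x"] p by simp
      also have "\<dots> \<le> 2 powr p * (norm (w x) powr p + norm (w x) powr p)"
        using elim p by (intro mult_left_mono add_mono powr_mono2) auto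
      finally show ?case by simp
    qed
  qed (use F f in auto)
  then show ?thesis using Fn fL by (simp add: Lp_tendsto_def)
qed

text \<open>Splits the error into \<open>b n x *\<^sub>R (G n x - g x)\<close>, controlled by the
  bound on the coefficients, and \<open>(b n x - c x) *\<^sub>R g x\<close>, controlled by dominated
  convergence. Bounded coefficients thus have to converge only almost everywhere.\<close>

lemma Lp_tendsto_scaleR:
  assumes p: "0 < p" and G: "Lp_tendsto M p G g"
    and b: "\<And>n. b n \<in> borel_measurable M" "\<And>n x. x \<in> space M \<Longrightarrow> \<bar>b n x\<bar> \<le> C" "c \<in> borel_measurable M"
    and lim: "AE x in M. (\<lambda>n. b n x) \<longlonglongrightarrow> (c x :: real)"
  shows "Lp_tendsto M p (\<lambda>n x. b n x *\<^sub>R G n x) (\<lambda>x. c x *\<^sub>R g x)"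
proof (rule Lp_tendsto_trans_diff[where F = "\<lambda>n x. b n x *\<^sub>R g x"])
  note GD = Lp_tendstoD[OF G]
  show "Lp_tendsto M p (\<lambda>n x. b n x *\<^sub>R g x) (\<lambda>x. c x *\<^sub>R g x)"
  proof (rule Lp_tendsto_dominated[OF p, where w = "\<lambda>x. C *\<^sub>R g x"])
    show "Lp M p (\<lambda>x. C *\<^sub>R g x)" by (rule Lp_scaleR_bounded[where C="\<bar>C\<bar>"]) (use p GD in auto)
    show "AE x in M. (\<lambda>n. b n x *\<^sub>R g x) \<longlonglongrightarrow> c x *\<^sub>R g x"
      using lim by eventually_elim (intro tendsto_intros)
    fix n
    have "norm (b n x *\<^sub>R g x) \<le> norm (C *\<^sub>R g x)" if "x \<in> space M" for x
      using b(2)[OF that, of n] by (auto intro!: mult_right_mono)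
    then show "AE x in M. norm (b n x *\<^sub>R g x) \<le> norm (C *\<^sub>R g x)" by auto
  qed (use b GD in \<open>auto dest: LpD\<close>)
  show "Lp M p (\<lambda>x. b n x *\<^sub>R G n x)" for n
    by (rule Lp_scaleR_bounded[where C=C]) (use p b GD in auto)
  show "(\<lambda>n. LINT x|M. norm (b n x *\<^sub>R G n x - b n x *\<^sub>R g x) powr p) \<longlonglongrightarrow> 0"
  proof (rule tendsto_sandwich[OF _ _ tendsto_const])
    show "(\<lambda>n. \<bar>C\<bar> powr p * (LINT x|M. norm (G n x - g x) powr p)) \<longlonglongrightarrow> 0"
      using tendsto_mult_right_zero[OF GD(3)] by blast
    show "\<forall>\<^sub>F n in sequentially. (LINT x|M. norm (b n x *\<^sub>R G n x - b n x *\<^sub>R g x) powr p)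
       \<le> \<bar>C\<bar> powr p * (LINT x|M. norm (G n x - g x) powr p)"
    proof (intro always_eventually allI)
      fix n
      note i = LpD(2)[OF Lp_diff[OF less_imp_le[OF p] GD(1)[of n] GD(2)]]
      have "(LINT x|M. norm (b n x *\<^sub>R G n x - b n x *\<^sub>R g x) powr p)
        \<le> (LINT x|M. \<bar>C\<bar> powr p * norm (G n x - g x) powr p)"
      proof (rule integral_mono')
        fix x assume x: "x \<in> space M"
        have "norm (b n x *\<^sub>R G n x - b n x *\<^sub>R g x) \<le> \<bar>C\<bar> * norm (G n x - g x)"
          using b(2)[OF x, of n] by (auto simp: scaleR_diff_right[symmetric] intro!:
              mult_right_mono)
        then have "norm (b n x *\<^sub>R G n x - b n x *\<^sub>R g x) powr p
            \<le> (\<bar>C\<bar> * norm (G n x - g x)) powr p"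
          using p by (intro powr_mono2) auto
        then show "norm (b n x *\<^sub>R G n x - b n x *\<^sub>R g x) powr p
            \<le> \<bar>C\<bar> powr p * norm (G n x - g x) powr p"
          by (simp add: powr_mult)
      qed (use i in auto)
      then show "(LINT x|M. norm (b n x *\<^sub>R G n x - b n x *\<^sub>R g x) powr p)
        \<le> \<bar>C\<bar> powr p * (LINT x|M. norm (G n x - g x) powr p)" using i by simp
    qed
  qed auto
qed (use p in auto)

text \<open>Convergence of the \<open>p\<close>-th powers controls \<open>L\<^sup>1\<close> convergence through
  \<open>a \<le> s + s\<^bsup>1-p\<^esup> a\<^sup>p\<close> for every \<open>s > 0\<close>.\<close>

lemma (in finite_measure) Lp_tendsto_L1:
  assumes p: "1 \<le> p" and F: "Lp_tendsto M p F f"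
  shows "(\<lambda>n. LINT x|M. norm (F n x - f x)) \<longlonglongrightarrow> 0"
proof (rule LIMSEQ_I)
  note FD = Lp_tendstoD[OF F]
  fix e :: real assume e: "e > 0"
  \<comment> \<open>With this \<open>s\<close> the constant part of the inequality contributes at
    most \<open>e / 2\<close> after integration; the added 1 covers a space of mass 0.\<close>
  define s where "s = e / (2 * (measure M (space M) + 1))"
  have s: "s > 0" using e by (auto simp: s_def intro!: divide_pos_pos mult_pos_pos add_nonneg_pos)
  have sm: "s * measure M (space M) \<le> e / 2"
  proof -
    have "measure M (space M) + 1 > 0" by (auto intro!: add_nonneg_pos)
    moreover have "0 < e * measure M (space M) + e" using e calculation
      by (metis distrib_left mult.right_neutral mult_pos_pos)
    ultimately show ?thesis using e by (simp add: s_def field_simps)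
  qed
  have pw: "a \<le> s + s powr (1 - p) * a powr p" if "a \<ge> 0" for a
  proof (cases "a \<le> s")
    case False
    then have "1 \<le> (a/s) powr (p - 1)" using s p by (intro ge_one_powr_ge_zero) auto
    then have "a * 1 \<le> a * (a/s) powr (p-1)" using that by (intro mult_left_mono) auto
    also have "\<dots> = s powr (1-p) * a powr p"
      using False s by (simp add: powr_divide powr_diff field_simps)
    finally show ?thesis using s by simp
  qed (auto simp: add_increasing2)
  have "(\<lambda>n. s powr (1 - p) * (LINT x|M. norm (F n x - f x) powr p)) \<longlonglongrightarrow> 0"
    using tendsto_mult_right_zero[OF FD(3)] by blast
  then obtain N where N: "\<And>n. n \<ge> N \<Longrightarrow> s powr (1 - p) * (LINT x|M. norm (F n x - f x) powr p) < e /
      2"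
    using e order_tendstoD(2)[of _ 0 sequentially "e/2"] by (auto simp: eventually_sequentially)
  show "\<exists>N. \<forall>n\<ge>N. norm ((LINT x|M. norm (F n x - f x)) - 0) < e"
  proof (intro exI[of _ N] allI impI)
    fix n assume n: "n \<ge> N"
    have L: "Lp M p (\<lambda>x. F n x - f x)" using FD p by (intro Lp_diff) auto
    have "(LINT x|M. norm (F n x - f x)) \<le> (LINT x|M. s + s powr (1-p) * norm (F n x - f x) powr p)"
      by (intro integral_mono integrable_norm Lp_integrable[OF p L] pw) (use LpD[OF L] in auto)
    also have "\<dots> = s * measure M (space M) + s powr (1 - p) * (LINT x|M. norm (F n x - f x) powr p)"
      using LpD[OF L] by simp
    also have "\<dots> < e" using sm N[OF n] by simp
    finally show "norm ((LINT x|M. norm (F n x - f x)) - 0) < e"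
      by (simp add: abs_of_nonneg)
  qed
qed

lemma (in finite_measure) Lp_tendsto_integral:
  assumes p: "1 \<le> p" and F: "Lp_tendsto M p F f"
  shows "(\<lambda>n. LINT x|M. F n x) \<longlonglongrightarrow> (LINT x|M. f x)"
proof (rule tendstoI)
  note FD = Lp_tendstoD[OF F]
  fix e :: real assume "e > 0"
  with Lp_tendsto_L1[OF p F] have "\<forall>\<^sub>F n in sequentially. (LINT x|M. norm (F n x - f x)) < e"
    by (rule order_tendstoD)
  then show "\<forall>\<^sub>F n in sequentially. dist (LINT x|M. F n x) (LINT x|M. f x) < e"
  proof eventually_elim
    case (elim n)
    have eq: "(LINT x|M. F n x) - (LINT x|M. f x) = (LINT x|M. F n x - f x)"
      using Lp_integrable[OF p FD(1)[of n]] Lp_integrable[OF p FD(2)] by simp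
    show ?case unfolding dist_norm eq by (rule le_less_trans[OF integral_norm_bound elim])
  qed
qed

subsection \<open>Continuously differentiable functions\<close>

lemma C1_gradientD:
  assumes "C1_gradient f g"
  shows "continuous_on UNIV g" "GDERIV f x :> g x" "(f has_derivative (\<lambda>h. h \<bullet> g x)) (at x)"
    "continuous_on UNIV f"
proof -
  show "continuous_on UNIV g" "GDERIV f x :> g x" using assms by (auto simp: C1_gradient_def)
  have d: "(f has_derivative (\<lambda>h. h \<bullet> g x)) (at x)" for x
    using assms by (simp add: C1_gradient_def gderiv_def)
  show "(f has_derivative (\<lambda>h. h \<bullet> g x)) (at x)" by (rule d)
  show "continuous_on UNIV f"
    by (intro continuous_at_imp_continuous_on ballI has_derivative_continuous[OF d])
qed

lemma C1_gradient_add: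
  "C1_gradient f g \<Longrightarrow> C1_gradient f' g' \<Longrightarrow> C1_gradient (\<lambda>x. f x + f' x) (\<lambda>x. g x + g' x)"
  by (auto simp: C1_gradient_def intro!: continuous_intros GDERIV_add)

lemma C1_gradient_diff:
  "C1_gradient f g \<Longrightarrow> C1_gradient f' g' \<Longrightarrow> C1_gradient (\<lambda>x. f x - f' x) (\<lambda>x. g x - g' x)"
  by (auto simp: C1_gradient_def intro!: continuous_intros GDERIV_diff)

lemma C1_gradient_uminus:
  "C1_gradient f g \<Longrightarrow> C1_gradient (\<lambda>x. - f x) (\<lambda>x. - g x)"
  by (auto simp: C1_gradient_def intro!: continuous_intros GDERIV_minus)

lemma C1_gradient_mult:
  assumes "C1_gradient f g" "C1_gradient f' g'"
  shows "C1_gradient (\<lambda>x. f x * f' x) (\<lambda>x. f x *\<^sub>R g' x + f' x *\<^sub>R g x)"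
  using assms C1_gradientD(4)[OF assms(1)] C1_gradientD(4)[OF assms(2)]
  by (auto simp: C1_gradient_def intro!: continuous_intros GDERIV_mult)

lemma C1_gradient_compose:
  assumes f: "C1_gradient f g" and F: "\<And>t. (F has_real_derivative F' t) (at t)" "continuous_on UNIV
      F'"
  shows "C1_gradient (\<lambda>x. F (f x)) (\<lambda>x. F' (f x) *\<^sub>R g x)"
  unfolding C1_gradient_def
proof (intro conjI allI)
  show "GDERIV (\<lambda>x. F (f x)) x :> F' (f x) *\<^sub>R g x" for x
    by (rule GDERIV_DERIV_compose) (use f F in \<open>auto simp: C1_gradient_def\<close>)
  show "continuous_on UNIV (\<lambda>x. F' (f x) *\<^sub>R g x)"
    using C1_gradientD[OF f] continuous_on_compose2[OF F(2), of UNIV f]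
        by (auto intro!: continuous_intros)
qed

lemma C1_gradient_affine: "C1_gradient (\<lambda>x. c + a \<bullet> (x - b)) (\<lambda>_. a)"
  unfolding C1_gradient_def gderiv_def
  by (auto intro!: derivative_eq_intros simp: inner_commute)

lemma C1_gradient_outside_support:
  assumes f: "C1_gradient f g" and x: "x \<notin> closure {x. f x \<noteq> 0}"
  shows "f x = 0" "g x = 0"
proof -
  have sub: "f y = 0" if "y \<notin> closure {x. f x \<noteq> 0}" for y
    using that closure_subset[of "{x. f x \<noteq> 0}"] by blast
  show "f x = 0" by (rule sub[OF x])
  have "open (- closure {x. f x \<noteq> 0})" by auto
  then have "\<forall>\<^sub>F y in at x. y \<in> - closure {x. f x \<noteq> 0}"
    by (rule eventually_at_in_open') (simp add: x)
  then have ev: "\<forall>\<^sub>F y in at x. f y = 0"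
    by eventually_elim (rule sub, simp)
  have "(f has_derivative (\<lambda>h. 0)) (at x)"
    by (rule has_derivative_transform_eventually[where f = "\<lambda>_. 0"])
       (use ev \<open>f x = 0\<close> in \<open>auto elim: eventually_mono\<close>)
  then have "(\<lambda>h. h \<bullet> g x) = (\<lambda>h. 0)"
    using C1_gradientD(3)[OF f] has_derivative_unique by blast
  then have "\<And>h. h \<bullet> g x = 0" by meson
  then show "g x = 0" using inner_eq_zero_iff by metis
qed

lemma C1_compact_supportI:
  assumes f: "C1_gradient f g" and K: "compact K" "K \<subseteq> \<Omega>" "\<And>x. x \<notin> K \<Longrightarrow> f x = 0"
  shows "f \<in> C1_compact_support \<Omega>"
proof -
  have "closure {x. f x \<noteq> 0} \<subseteq> K"
    by (rule closure_minimal) (use K in \<open>auto intro: compact_imp_closed\<close>)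
  moreover from this have "compact (closure {x. f x \<noteq> 0})"
    using K(1) compact_Int_closed[of K "closure {x. f x \<noteq> 0}"] by (simp add: Int_absorb1)
  ultimately show ?thesis
    using f K(2) unfolding C1_compact_support_def by blast
qed

lemma C1_compact_supportE:
  assumes f: "f \<in> C1_compact_support \<Omega>" and g: "C1_gradient f g"
  obtains K where "compact K" "K \<subseteq> \<Omega>" "\<forall>x. x \<notin> K \<longrightarrow> f x = 0 \<and> g x = 0"
proof (rule that[of "closure {x. f x \<noteq> 0}"])
  show "compact (closure {x. f x \<noteq> 0})" "closure {x. f x \<noteq> 0} \<subseteq> \<Omega>"
    using f by (auto simp only: C1_compact_support_def mem_Collect_eq)
qed (use C1_gradient_outside_support[OF g] in blast)

lemma continuous_compact_support_bounded:
  fixes f :: "'a::topological_space \<Rightarrow> 'b::real_normed_vector"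
  assumes "continuous_on UNIV f" "compact K" "\<And>x. x \<notin> K \<Longrightarrow> f x = 0"
  obtains C where "C > 0" "\<And>x. norm (f x) \<le> C"
proof -
  have "bounded (f ` K)"
    using assms by (intro compact_imp_bounded compact_continuous_image) (auto intro:
        continuous_on_subset)
  then obtain C where "C > 0" "\<forall>y\<in>f ` K. norm y \<le> C" by (auto simp: bounded_pos)
  moreover from this have "norm (f x) \<le> C" for x
    using assms(3)[of x] by (cases "x \<in> K") auto
  ultimately show thesis using that by blast
qed

lemma integrable_indicator_cball: "integrable lborel (indicat_real (cball (a::'a::euclidean_space)
    r))"
  by (rule integrable_real_indicator) (use emeasure_lborel_cball_finite in auto)

lemma integrable_lborel_compact_support:
  fixes f :: "'a::euclidean_space \<Rightarrow> 'b::euclidean_space"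
  assumes f: "f \<in> borel_measurable borel" "bounded K" "\<And>x. x \<notin> K \<Longrightarrow> f x = 0" "\<And>x. norm (f x) \<le> C"
  shows "integrable lborel f"
proof -
  obtain R where "\<forall>x\<in>K. norm x \<le> R" using \<open>bounded K\<close> bounded_iff by blast
  then have R: "K \<subseteq> cball 0 R" by auto
  show ?thesis
  proof (rule Bochner_Integration.integrable_bound)
    show "integrable lborel (\<lambda>x. indicator (cball 0 R) x *\<^sub>R C)"
      by (intro integrable_scaleR_left integrable_indicator_cball)
    have "norm (f x) \<le> norm (indicator (cball 0 R) x *\<^sub>R C)" for x
    proof (cases "x \<in> cball 0 R")
      case True
      then show ?thesis using f(4)[of x] by simp
    next
      case False
      then have "x \<notin> K" using R by blast
      then show ?thesis using f(3)[of x] by simp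
    qed
    then show "AE x in lborel. norm (f x) \<le> norm (indicator (cball 0 R) x *\<^sub>R C)" by auto
  qed (use f in auto)
qed

lemma C1_gradient_Lipschitz:
  assumes f: "C1_gradient f g" and C: "\<And>x. norm (g x) \<le> C"
  shows "\<bar>f x - f y\<bar> \<le> C * norm (x - y)"
proof -
  have "norm (f x - f y) \<le> C * norm (x - y)"
  proof (rule differentiable_bound[of UNIV f "\<lambda>x h. h \<bullet> g x"])
    fix x
    show "onorm (\<lambda>h. h \<bullet> g x) \<le> C"
    proof (rule onorm_bound)
      show "0 \<le> C" by (rule order_trans[OF norm_ge_zero C])
      fix h
      have "norm (h \<bullet> g x) \<le> norm h * norm (g x)" using Cauchy_Schwarz_ineq2[of h "g x"] by simp
      also have "\<dots> \<le> C * norm h" using C[of x] mult_left_mono[OF C, of "norm h" x]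
          by (simp add: mult.commute)
      finally show "norm (h \<bullet> g x) \<le> C * norm h" .
    qed
    show "(f has_derivative (\<lambda>h. h \<bullet> g x)) (at x within UNIV)" using C1_gradientD(3)[OF f] by simp
  qed auto
  then show ?thesis by simp
qed

lemma lborel_integral_translation:
  fixes f :: "'a::euclidean_space \<Rightarrow> 'b::euclidean_space"
  assumes "f \<in> borel_measurable borel"
  shows "(LINT x|lborel. f (x + t)) = (LINT x|lborel. f x)"
    and "integrable lborel (\<lambda>x. f (x + t)) \<longleftrightarrow> integrable lborel f"
proof -
  have "(LINT x|distr lborel borel ((+) t). f x) = (LINT x|lborel. f (t + x))"
    using assms by (intro integral_distr) auto
  then show "(LINT x|lborel. f (x + t)) = (LINT x|lborel. f x)"
    by (simp add: lborel_distr_plus add.commute)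
  have "integrable (distr lborel borel ((+) t)) f \<longleftrightarrow> integrable lborel (\<lambda>x. f (t + x))"
    using assms by (intro integrable_distr_eq) auto
  then show "integrable lborel (\<lambda>x. f (x + t)) \<longleftrightarrow> integrable lborel f"
    by (simp add: lborel_distr_plus add.commute)
qed

text \<open>By translation invariance the difference quotients integrate to zero.\<close>

lemma C1_compact_support_integral_gradient:
  assumes psi: "\<psi> \<in> C1_compact_support \<Omega>" and g: "C1_gradient \<psi> g"
  shows "(LINT x|lborel. g x) = 0" "integrable lborel g"
proof -
  obtain K where K: "compact K" "K \<subseteq> \<Omega>" and K0: "\<forall>x. x \<notin> K \<longrightarrow> \<psi> x = 0 \<and> g x = 0"
    using C1_compact_supportE[OF psi g] by blast
  have K: "compact K" "K \<subseteq> \<Omega>" "\<And>x. x \<notin> K \<Longrightarrow> \<psi> x = 0" "\<And>x. x \<notin> K \<Longrightarrow> g x = 0"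
    using K K0 by blast+
  obtain R where "\<forall>x\<in>K. norm x \<le> R" using compact_imp_bounded[OF K(1)] bounded_iff by blast
  then have R: "K \<subseteq> cball 0 R" by auto
  obtain C where C: "C > 0" "\<And>x. norm (g x) \<le> C"
    using continuous_compact_support_bounded[OF C1_gradientD(1)[OF g] K(1,4)] by blast
  obtain D where D: "D > 0" "\<And>x. norm (\<psi> x) \<le> D"
    using continuous_compact_support_bounded[OF C1_gradientD(4)[OF g] K(1,3)] by blast
  have mg: "g \<in> borel_measurable borel" by (rule borel_measurable_continuous_onI[OF
      C1_gradientD(1)[OF g]])
  have mp: "\<psi> \<in> borel_measurable borel" by (rule borel_measurable_continuous_onI[OF
      C1_gradientD(4)[OF g]])
  show ig: "integrable lborel g"
    using integrable_lborel_compact_support[OF mg compact_imp_bounded[OF K(1)] K(4) C(2)] .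
  have ip: "integrable lborel \<psi>"
    using integrable_lborel_compact_support[OF mp compact_imp_bounded[OF K(1)] K(3) D(2)] .
  show "(LINT x|lborel. g x) = 0"
  proof (rule euclidean_eqI)
    fix e :: 'a assume e: "e \<in> Basis"
    define s where "s n x = (\<psi> (x + (1 / real (Suc n)) *\<^sub>R e) - \<psi> x) * real (Suc n)" for n x
    have zero: "(LINT x|lborel. s n x) = 0" for n
    proof -
      have "(LINT x|lborel. \<psi> (x + (1 / real (Suc n)) *\<^sub>R e) - \<psi> x) = 0"
        using lborel_integral_translation[OF mp] ip by simp
      then show ?thesis by (simp add: s_def)
    qed
    have "(\<lambda>n. LINT x|lborel. s n x) \<longlonglongrightarrow> (LINT x|lborel. g x \<bullet> e)"
    \<comment> \<open>The gradient bound \<open>C\<close> is a Lipschitz constant and so bounds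
      every difference quotient. The increments have length at most 1, hence the quotients vanish
      outside the ball of radius \<open>R + 1\<close>.\<close>
    proof (rule integral_dominated_convergence[where w = "\<lambda>x. C * indicator (cball 0 (R+1)) x"])
      show "integrable lborel (\<lambda>x. C * indicator (cball 0 (R + 1)) x :: real)"
        by (intro integrable_mult_right integrable_indicator_cball)
      show "(\<lambda>x. g x \<bullet> e) \<in> borel_measurable lborel" using mg by simp
      show "s n \<in> borel_measurable lborel" for n unfolding s_def using mp by simp
      show "AE x in lborel. (\<lambda>n. s n x) \<longlonglongrightarrow> g x \<bullet> e"
      proof (intro AE_I2)
        fix x
        have "((\<lambda>t. \<psi> (x + t *\<^sub>R e)) has_derivative (\<lambda>t. (t *\<^sub>R e) \<bullet> g x)) (at 0)"
        proof (rule has_derivative_compose[of "\<lambda>t. x + t *\<^sub>R e" "\<lambda>t. t *\<^sub>R e" 0 UNIV \<psi>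
            "\<lambda>h. h \<bullet> g x"])
          show "((\<lambda>t. x + t *\<^sub>R e) has_derivative (\<lambda>t. t *\<^sub>R e)) (at 0)"
            by (auto intro!: derivative_eq_intros)
          show "(\<psi> has_derivative (\<lambda>h. h \<bullet> g x)) (at (x + 0 *\<^sub>R e))"
            using C1_gradientD(3)[OF g] by simp
        qed
        moreover have "(\<lambda>t. (t *\<^sub>R e) \<bullet> g x) = (*) (g x \<bullet> e)"
            by (auto simp: inner_commute mult.commute)
        ultimately have "((\<lambda>t. \<psi> (x + t *\<^sub>R e)) has_real_derivative g x \<bullet> e) (at 0)"
          by (simp add: has_field_derivative_def)
        then have "((\<lambda>t. (\<psi> (x + t *\<^sub>R e) - \<psi> x) / t) \<longlongrightarrow> g x \<bullet> e) (at 0)"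
          by (simp add: has_field_derivative_iff)
        moreover have "filterlim (\<lambda>n. 1 / real (Suc n)) (at 0) sequentially"
          using LIMSEQ_Suc[OF lim_const_over_n[of "1::real"]] by (auto simp: filterlim_at)
        ultimately have "(\<lambda>n. (\<psi> (x + (1 / real (Suc n)) *\<^sub>R e) - \<psi> x) / (1 / real (Suc n)))
            \<longlonglongrightarrow> g x \<bullet> e"
          by (rule filterlim_compose)
        then show "(\<lambda>n. s n x) \<longlonglongrightarrow> g x \<bullet> e" by (simp add: s_def)
      qed
      fix n
      have "norm (s n x) \<le> C * indicator (cball 0 (R+1)) x" for x
      proof (cases "x \<in> cball 0 (R+1)")
        case True
        have "\<bar>\<psi> (x + (1 / real (Suc n)) *\<^sub>R e) - \<psi> x\<bar> \<le> C * norm (x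
            + (1 / real (Suc n)) *\<^sub>R e - x)"
          by (rule C1_gradient_Lipschitz[OF g C(2)])
        also have "\<dots> = C / real (Suc n)" using e by simp
        finally have "\<bar>\<psi> (x + (1 / real (Suc n)) *\<^sub>R e) - \<psi> x\<bar> * real (Suc n) \<le> C"
          by (subst (asm) pos_le_divide_eq) auto
        then show ?thesis using True unfolding s_def real_norm_def abs_mult by simp
      next
        case False
        then have "norm x > R + 1" by simp
        moreover have "norm ((1 / real (Suc n)) *\<^sub>R e) \<le> 1" using e by simp
        moreover have "norm x \<le> norm (x + (1 / real (Suc n)) *\<^sub>R e)
            + norm ((1 / real (Suc n)) *\<^sub>R e)"
          by (metis add_diff_cancel_right' norm_triangle_ineq4)
        ultimately have "norm (x + (1 / real (Suc n)) *\<^sub>R e) > R" "norm x > R" by linarith+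
        then have "x + (1 / real (Suc n)) *\<^sub>R e \<notin> K" "x \<notin> K" using R by auto
        then have "s n x = 0" unfolding s_def using K(3) by simp
        then show ?thesis using C by simp
      qed
      then show "AE x in lborel. norm (s n x) \<le> C * indicator (cball 0 (R+1)) x" by auto
    qed
    then have "(LINT x|lborel. g x \<bullet> e) = 0" using zero LIMSEQ_unique[of "\<lambda>_. 0::real"] by fastforce
    then show "(LINT x|lborel. g x) \<bullet> e = 0 \<bullet> e" using ig by simp
  qed
qed

subsection \<open>Continuity of translations\<close>

text \<open>Convexity of the power, in the tangent form that Jensen's inequality consumes. The point
  \<open>y = 0\<close> is separate because the convexity argument runs on the open
  half-line.\<close>

lemma powr_ge_tangent:
  assumes p: "1 \<le> (p::real)" and m: "m > 0" and y: "0 \<le> y"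
  shows "m powr p + p * m powr (p - 1) * (y - m) \<le> y powr p"
proof (cases "y = 0")
  case True
  have "m * m powr (p - 1) = m powr p"
    using m powr_mult_base[of m "p - 1"] by simp
  then have "m powr p + p * m powr (p - 1) * (0 - m) = (1 - p) * m powr p"
    by (metis (no_types, opaque_lifting) add_uminus_conv_diff diff_0 left_diff_distrib mult.assoc
        mult.commute mult_1 mult_minus_right)
  also have "\<dots> \<le> 0" using p by (simp add: mult_nonpos_nonneg)
  finally show ?thesis using True p by simp
next
  case False
  have "y powr p - m powr p \<ge> (p * m powr (p - 1)) * (y - m)"
  proof (rule convex_on_imp_above_tangent[OF powr_convex[OF p]])
    show "((\<lambda>x. x powr p) has_real_derivative p * m powr (p - 1)) (at m within {0<..})"
      using m by (intro DERIV_subset[OF has_real_derivative_powr]) auto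
  qed (use m y False in \<open>auto simp: interior_open\<close>)
  then show ?thesis by simp
qed

text \<open>Jensen's inequality for the probability density \<open>k\<close>: the tangent to the
  power at the mean \<open>m\<close>, multiplied by \<open>k\<close> and integrated, loses its
  linear term.\<close>

lemma powr_integral_le:
  fixes F k :: "'c \<Rightarrow> real"
  assumes p: "1 \<le> p" and k: "\<And>x. 0 \<le> k x" "integrable M k" "(LINT x|M. k x) = 1"
    and F: "\<And>x. 0 \<le> F x" "integrable M (\<lambda>x. k x * F x)" "integrable M (\<lambda>x. k x * F x powr p)"
  shows "(LINT x|M. k x * F x) powr p \<le> (LINT x|M. k x * F x powr p)"
proof -
  define m where "m = (LINT x|M. k x * F x)"
  have m0: "m \<ge> 0" unfolding m_def using k F by (intro integral_nonneg_AE) auto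
  show ?thesis
  proof (cases "m = 0")
    case True
    then show ?thesis using k F p unfolding m_def[symmetric] by (auto intro!: integral_nonneg_AE)
  next
    case False
    then have m: "m > 0" using m0 by simp
    have "m powr p = (LINT x|M. k x * m powr p + (p * m powr (p - 1)) * (k x * F x - m * k x))"
      using k F by (simp add: m_def[symmetric])
    also have "\<dots> \<le> (LINT x|M. k x * F x powr p)"
    proof (rule integral_mono)
      fix x
      have "k x * (m powr p + p * m powr (p - 1) * (F x - m)) \<le> k x * F x powr p"
        by (intro mult_left_mono powr_ge_tangent p m F k)
      then show "k x * m powr p + (p * m powr (p - 1)) * (k x * F x - m * k x) \<le> k x * F x powr p"
        by (simp add: algebra_simps)
    qed (use k F in auto)
    finally show ?thesis by (simp add: m_def)
  qed
qed

text \<open>A Lebesgue measurable function is an almost everywhere limit of continuous functions,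
  and \<open>lim\<close> of that sequence is Borel. Translation and Tonelli arguments are carried
  out on \<open>lborel\<close>, whereas Sobolev functions are only Lebesgue measurable.\<close>

lemma lebesgue_measurable_borel_representative:
  fixes f :: "'a::euclidean_space \<Rightarrow> 'b::euclidean_space"
  assumes "f \<in> borel_measurable lebesgue"
  obtains f' where "f' \<in> borel_measurable borel" "AE x in lborel. f x = f' x"
proof -
  have "f measurable_on UNIV" using assms by (intro lebesgue_measurable_imp_measurable_on) auto
  then obtain N g where N: "negligible N" and g: "\<And>n::nat. continuous_on UNIV (g n)"
    and lim: "\<And>x. x \<notin> N \<Longrightarrow> (\<lambda>n. g n x) \<longlonglongrightarrow> f x"
    by (auto simp: measurable_on_def)
  have [measurable]: "g n \<in> borel_measurable borel" for n
    by (rule borel_measurable_continuous_onI[OF g])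
  have "AE x in lebesgue. x \<notin> N"
    using N by (intro AE_not_in) (simp add: negligible_iff_null_sets)
  then have "AE x in lborel. x \<notin> N" by (simp add: AE_completion_iff)
  then have "AE x in lborel. f x = lim (\<lambda>n. g n x)"
    by eventually_elim (metis lim limI)
  then show thesis by (intro that[of "\<lambda>x. lim (\<lambda>n. g n x)"]) auto
qed

lemma Lp_lborel_bounded_support:
  fixes f :: "'a::euclidean_space \<Rightarrow> 'b::euclidean_space"
  assumes "0 < p" "f \<in> borel_measurable borel" "\<And>x. norm x > R \<Longrightarrow> f x = 0" "\<And>x. norm (f x) \<le> C"
  shows "Lp lborel p f"
proof -
  have "integrable lborel (\<lambda>x. norm (f x) powr p)"
  proof (rule integrable_lborel_compact_support[of _ "cball 0 R"])
    fix x
    show "norm (norm (f x) powr p) \<le> C powr p"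
      using assms(1,4) by (auto intro: powr_mono2)
    show "norm (f x) powr p = 0" if "x \<notin> cball 0 R" using assms(3)[of x] that by simp
  qed (use assms in auto)
  then show ?thesis using assms by (auto simp: Lp_def)
qed

text \<open>Measurability supplies continuous functions \<open>g0 n\<close> converging almost
  everywhere. Projecting their values onto the ball of radius \<open>C\<close> and multiplying by a
  cutoff yields a common dominating function without disturbing the limit, because \<open>f\<close>
  takes values in that ball and vanishes beyond radius \<open>R\<close>.\<close>

lemma Lp_approx_continuous_bounded:
  fixes f :: "'a::euclidean_space \<Rightarrow> 'b::euclidean_space"
  assumes p: "0 < p" and f: "f \<in> borel_measurable borel" "\<And>x. norm x > R \<Longrightarrow> f x = 0" "\<And>x. norm (f x)
      \<le> C"
  obtains g where "Lp_tendsto lborel p g f" "\<And>n. continuous_on UNIV (g n)"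
    "\<And>n x. norm x > R + 1 \<Longrightarrow> g n x = 0"
proof -
  have C: "C \<ge> 0" using f(3) norm_ge_zero order_trans by metis
  have "f \<in> borel_measurable lebesgue" using f(1) by (simp add: measurable_completion)
  then have "f measurable_on UNIV" by (intro lebesgue_measurable_imp_measurable_on) auto
  then obtain N g0 where N: "negligible N" and g0: "\<And>n::nat. continuous_on UNIV (g0 n)"
    and lim: "\<And>x. x \<notin> N \<Longrightarrow> (\<lambda>n. g0 n x) \<longlonglongrightarrow> f x"
    by (auto simp: measurable_on_def)
  define P where "P = closest_point (cball (0::'b) C)"
  define cut where "cut x = max 0 (min 1 (R + 1 - norm x))" for x :: 'a
  define g where "g n x = cut x *\<^sub>R P (g0 n x)" for n x
  have P: "continuous_on UNIV P" "\<And>y. norm (P y) \<le> C" "\<And>y. norm y \<le> C \<Longrightarrow> P y = y"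
    unfolding P_def
    using C closest_point_in_set[of "cball (0::'b) C"]
    by (auto intro!: continuous_on_closest_point closest_point_self simp: dist_norm)
  have cut: "continuous_on UNIV cut" "\<And>x. 0 \<le> cut x" "\<And>x. cut x \<le> 1" "\<And>x. norm x \<le> R \<Longrightarrow> cut x = 1"
    "\<And>x. norm x > R + 1 \<Longrightarrow> cut x = 0"
    by (auto simp: cut_def intro!: continuous_intros)
  have gc: "continuous_on UNIV (g n)" for n
    unfolding g_def by (intro continuous_intros cut continuous_on_compose2[OF P(1) g0]) auto
  have "Lp_tendsto lborel p g f"
  proof (rule Lp_tendsto_dominated[OF p, where w = "\<lambda>x. C * indicator (cball 0 (R+1)) x :: real"])
    show "Lp lborel p (\<lambda>x. C * indicator (cball (0::'a) (R+1)) x :: real)"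
      by (rule Lp_lborel_bounded_support[OF p, where R = "R+1" and C = C])
         (use C in \<open>auto simp: indicator_def\<close>)
    have "AE x in lebesgue. x \<notin> N"
      using N by (intro AE_not_in) (simp add: negligible_iff_null_sets)
    then have "AE x in lborel. x \<notin> N" by (simp add: AE_completion_iff)
    then show "AE x in lborel. (\<lambda>n. g n x) \<longlonglongrightarrow> f x"
    proof eventually_elim
      case (elim x)
      have "(\<lambda>n. P (g0 n x)) \<longlonglongrightarrow> P (f x)"
        using P(1) by (intro continuous_on_tendsto_compose[OF P(1) lim[OF elim]]) auto
      then have "(\<lambda>n. g n x) \<longlonglongrightarrow> cut x *\<^sub>R f x"
        unfolding g_def P(3)[OF f(3)] by (intro tendsto_intros)
      moreover have "cut x *\<^sub>R f x = f x"
        using cut(4)[of x] f(2)[of x] by (cases "norm x \<le> R") auto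
      ultimately show ?case by simp
    qed
    fix n
    show "g n \<in> borel_measurable lborel"
      using borel_measurable_continuous_onI[OF gc] by simp
    have "norm (g n x) \<le> norm (C * indicator (cball 0 (R+1)) x :: real)" for x
    proof (cases "norm x \<le> R + 1")
      case True
      have "norm (g n x) \<le> 1 * C"
        unfolding g_def norm_scaleR using cut(2,3)[of x] P(2)[of "g0 n x"] by (intro mult_mono) auto
      then show ?thesis using True C by simp
    next
      case False
      then have "g n x = 0" using cut(5)[of x] by (simp add: g_def)
      then show ?thesis by simp
    qed
    then show "AE x in lborel. norm (g n x) \<le> norm (C * indicator (cball 0 (R+1)) x :: real)"
        by auto
  qed (use f in auto)
  moreover have "g n x = 0" if "norm x > R + 1" for n x using cut(5)[OF that] by (simp add: g_def)
  ultimately show thesis using that gc by blast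
qed

lemma Lp_approx_continuous:
  fixes f :: "'a::euclidean_space \<Rightarrow> 'b::euclidean_space"
  assumes p: "0 < p" and f: "Lp lborel p f" and e: "e > 0"
  obtains g R where "continuous_on UNIV g" "\<And>x. norm x > R \<Longrightarrow> g x = 0" "Lp lborel p g"
    "(LINT x|lborel. norm (g x - f x) powr p) < e"
proof -
  have fm[measurable]: "f \<in> borel_measurable borel" using LpD(1)[OF f] by simp
  define h where "h n x = (if norm (f x) \<le> real n \<and> norm x \<le> real n then f x else 0)" for n :: nat
      and x
  \<comment> \<open>Two approximation errors, each below \<open>e'\<close>, are combined at the cost
    of one factor \<open>2 powr p\<close>.\<close>
  define e' where "e' = e / (2 * 2 powr p)"
  have e': "e' > 0" using e by (simp add: e'_def)
  have hm[measurable]: "h n \<in> borel_measurable borel" for n unfolding h_def by simp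
  have hc: "Lp_tendsto lborel p h f"
  proof (rule Lp_tendsto_dominated[OF p f])
    show "AE x in lborel. (\<lambda>n. h n x) \<longlonglongrightarrow> f x"
    proof (intro AE_I2 tendsto_eventually)
      fix x
      obtain n where "max (norm (f x)) (norm x) \<le> real n" using real_arch_simple by blast
      then show "\<forall>\<^sub>F n in sequentially. h n x = f x"
        unfolding eventually_sequentially h_def by (intro exI[of _ n]) auto
    qed
  qed (auto simp: h_def)
  have "\<forall>\<^sub>F n in sequentially. (LINT x|lborel. norm (h n x - f x) powr p) < e'"
    using Lp_tendstoD(3)[OF hc] e' by (rule order_tendstoD)
  then obtain n where n: "(LINT x|lborel. norm (h n x - f x) powr p) < e'"
    by (auto simp: eventually_sequentially)
  obtain g where g: "Lp_tendsto lborel p g (h n)" "\<And>k. continuous_on UNIV (g k)"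
      "\<And>k x. norm x > real n + 1 \<Longrightarrow> g k x = 0"
    by (rule Lp_approx_continuous_bounded[OF p hm[of n], of "real n" "real n"]) (auto simp: h_def)
  have "\<forall>\<^sub>F k in sequentially. (LINT x|lborel. norm (g k x - h n x) powr p) < e'"
    using Lp_tendstoD(3)[OF g(1)] e' by (rule order_tendstoD)
  then obtain k where k: "(LINT x|lborel. norm (g k x - h n x) powr p) < e'"
    by (auto simp: eventually_sequentially)
  note gL = Lp_tendstoD(1)[OF g(1), of k] and hL = Lp_tendstoD(1)[OF hc, of n]
  have p0: "0 \<le> p" using p by simp
  note i = LpD(2)[OF Lp_diff[OF p0 gL hL]] LpD(2)[OF Lp_diff[OF p0 hL f]] LpD(2)[OF Lp_diff[OF p0 gL
      f]]
  have "(LINT x|lborel. norm (g k x - f x) powr p)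
    \<le> (LINT x|lborel. 2 powr p * (norm (g k x - h n x) powr p + norm (h n x - f x) powr p))"
  proof (rule integral_mono[OF i(3)])
    show "norm (g k x - f x) powr p \<le> 2 powr p * (norm (g k x - h n x) powr p
        + norm (h n x - f x) powr p)" for x
      using norm_add_powr_le[OF p0, of "g k x - h n x" "h n x - f x"] by simp
  qed (use i in auto)
  also have "\<dots> = 2 powr p * ((LINT x|lborel. norm (g k x - h n x) powr p) +
      (LINT x|lborel. norm (h n x - f x) powr p))"
    using i by simp
  also have "\<dots> < 2 powr p * (e' + e')"
    using n k by (intro mult_strict_left_mono add_strict_mono) auto
  also have "\<dots> = e" by (simp add: e'_def)
  finally show thesis using that[of "g k" "real n + 1"] g gL by blast
qed

lemma Lp_translation:
  fixes f :: "'a::euclidean_space \<Rightarrow> 'b::euclidean_space"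
  assumes "Lp lborel p f"
  shows "Lp lborel p (\<lambda>x. f (x + z))"
  using assms lborel_integral_translation(2)[of "\<lambda>x. norm (f x) powr p" z] by (auto simp: Lp_def)

text \<open>Compares \<open>f\<close> with a compactly supported continuous \<open>g\<close>: the
  errors of \<open>g\<close> at \<open>x + z\<close> and at \<open>x\<close> have equal integrals by
  translation invariance, and \<open>g\<close> itself moves little by uniform continuity.\<close>

lemma Lp_translation_continuous:
  fixes f :: "'a::euclidean_space \<Rightarrow> 'b::euclidean_space"
  assumes p: "0 < p" and f: "Lp lborel p f" and e: "e > 0"
  obtains d where "d > 0" "\<And>z. norm z < d \<Longrightarrow> (LINT x|lborel. norm (f (x + z) - f x) powr p) < e"
proof -
  have p0: "0 \<le> p" using p by simp
  \<comment> \<open>Three error terms are combined by two uses of \<open>norm_add_powr_le\<close>,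
    which cost at most \<open>2 powr p * 2 powr p\<close>; the 4 leaves room for all three.\<close>
  define e1 where "e1 = e / (4 * 2 powr p * 2 powr p)"
  have e1: "e1 > 0" using e by (simp add: e1_def)
  obtain g R where g: "continuous_on UNIV g" "\<And>x. norm x > R \<Longrightarrow> g x = 0" "Lp lborel p g"
    and gf: "(LINT x|lborel. norm (g x - f x) powr p) < e1"
    using Lp_approx_continuous[OF p f e1] by blast
  define V where "V = measure lborel (cball (0::'a) (R+1)) + 1"
  have V: "V > 0" unfolding V_def by (auto intro: add_nonneg_pos)
  \<comment> \<open>Chosen so that \<open>s powr p\<close>, integrated over the ball of radius
    \<open>R + 1\<close> with volume below \<open>V\<close>, gives at most
    \<open>e1\<close>.\<close>
  define s where "s = (e1 / V) powr (1/p)"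
  have s: "s > 0" "s powr p = e1 / V" using e1 V p by (auto simp: s_def powr_powr)
  \<comment> \<open>Shifts have length below 1: the difference lives within radius
    \<open>R + 1\<close>, and the shifted points stay within radius \<open>R + 2\<close>.\<close>
  have "uniformly_continuous_on (cball 0 (R+2)) g"
    by (rule compact_uniformly_continuous) (auto intro: continuous_on_subset[OF g(1)])
  then obtain d where d: "d > 0" "\<forall>x\<in>cball 0 (R+2). \<forall>y\<in>cball 0 (R+2). dist y x < d
      \<longrightarrow> dist (g y) (g x) < s"
    unfolding uniformly_continuous_on_def using s(1) by meson
  show thesis
  proof (rule that[of "min d 1"])
    show "min d 1 > 0" using d by simp
    fix z :: 'a assume z: "norm z < min d 1"
    have gd: "norm (g (x + z) - g x) powr p \<le> s powr p * indicator (cball 0 (R+1)) x" for x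
    proof (cases "norm x \<le> R + 1")
      case True
      then have "norm (x + z) \<le> R + 2" using norm_triangle_ineq[of x z] z by simp
      then have "dist (g (x + z)) (g x) < s" using True z
        by (intro d(2)[rule_format]) (simp_all add: mem_cball_0 dist_norm del: mem_cball)
      then show ?thesis using True p by (auto simp: dist_norm intro!: powr_mono2)
    next
      case False
      have "norm x \<le> norm (x + z) + norm z" by (metis add_diff_cancel_right' norm_triangle_ineq4)
      then have "norm (x + z) > R" "norm x > R" using False z by auto
      then show ?thesis using g(2) p by simp
    qed
    note fz = Lp_translation[OF f, of z] and gz = Lp_translation[OF g(3), of z]
    have i1: "integrable lborel (\<lambda>x. norm (g (x + z) - f (x + z)) powr p)"
      using LpD(2)[OF Lp_diff[OF p0 gz fz]] .
    have i2: "integrable lborel (\<lambda>x. norm (g (x + z) - g x) powr p)"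
      using LpD(2)[OF Lp_diff[OF p0 gz g(3)]] .
    have i3: "integrable lborel (\<lambda>x. norm (g x - f x) powr p)"
      using LpD(2)[OF Lp_diff[OF p0 g(3) f]] .
    have i4: "integrable lborel (\<lambda>x. norm (f (x + z) - f x) powr p)"
      using LpD(2)[OF Lp_diff[OF p0 fz f]] .
    have e_1: "(LINT x|lborel. norm (g (x + z) - f (x + z)) powr p) < e1"
      using lborel_integral_translation(1)[of "\<lambda>x. norm (g x - f x) powr p" z] LpD(1)[OF f]
          LpD(1)[OF g(3)] gf by simp
    have e_2: "(LINT x|lborel. norm (g (x + z) - g x) powr p) \<le> e1"
    proof -
      have "(LINT x|lborel. norm (g (x + z) - g x) powr p) \<le>
          (LINT x|lborel. s powr p * indicator (cball (0::'a) (R+1)) x)"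
        by (rule integral_mono[OF i2]) (intro integrable_mult_right integrable_indicator_cball gd)+
      also have "\<dots> = s powr p * measure lborel (cball (0::'a) (R+1))" by simp
      also have "\<dots> \<le> s powr p * V" by (intro mult_left_mono) (auto simp: V_def)
      also have "\<dots> = e1" using s V by simp
      finally show ?thesis .
    qed
    have "(LINT x|lborel. norm (f (x + z) - f x) powr p)
      \<le> (LINT x|lborel. 2 powr p * (norm (g (x + z) - f (x + z)) powr p + 2 powr p * (norm (g (x
          + z) - g x) powr p + norm (g x - f x) powr p)))"
    proof (rule integral_mono[OF i4])
      fix x
      have "norm (f (x + z) - f x) powr p = norm (- (g (x + z) - f (x + z))
          + (g (x+z) - f x)) powr p" by simp
      also have "\<dots> \<le> 2 powr p * (norm (- (g (x + z) - f (x + z))) powr p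
          + norm (g (x+z) - f x) powr p)"
        by (rule norm_add_powr_le[OF p0])
      also have "\<dots> \<le> 2 powr p * (norm (g (x + z) - f (x + z)) powr p + 2 powr p * (norm (g (x
          + z) - g x) powr p + norm (g x - f x) powr p))"
        using norm_add_powr_le[OF p0, of "g (x + z) - g x" "g x - f x"]
        unfolding norm_minus_cancel by (intro mult_left_mono add_left_mono) auto
      finally show "norm (f (x + z) - f x) powr p \<le> \<dots>" .
    qed (use i1 i2 i3 in auto)
    also have "\<dots> = 2 powr p * ((LINT x|lborel. norm (g (x + z) - f (x + z)) powr p)
        + 2 powr p * ((LINT x|lborel. norm (g (x + z) - g x) powr p) +
        (LINT x|lborel. norm (g x - f x) powr p)))"
      using i1 i2 i3 by simp
    also have "\<dots> < 2 powr p * (2 powr p * e1 + 2 powr p * (e1 + e1))"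
    proof -
      have "1 \<le> 2 powr p" using p0 by (rule ge_one_powr_ge_zero[rotated]) simp
      then have "e1 \<le> 2 powr p * e1" using e1 by simp
      then have "(LINT x|lborel. norm (g (x + z) - f (x + z)) powr p) < 2 powr p * e1" using e_1
          by simp
      then show ?thesis using e_2 gf
        by (intro mult_strict_left_mono add_less_le_mono mult_left_mono) auto
    qed
    also have "\<dots> \<le> e" using e by (simp add: e1_def field_simps)
    finally show "(LINT x|lborel. norm (f (x + z) - f x) powr p) < e" .
  qed
qed

subsection \<open>Mollification\<close>

text \<open>The square of a truncated paraboloid is C1 with an explicit gradient, which matches the
  C1 test functions in the definition of weak gradients. Normalisation is deferred to
  \<open>mollify\<close>, so powers of \<epsilon> do not have to be tracked.\<close>

definition bump :: "real \<Rightarrow> 'a::euclidean_space \<Rightarrow> real" where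
  "bump \<epsilon> x = (max 0 (\<epsilon>\<^sup>2 - x \<bullet> x))\<^sup>2"

definition bump_gradient :: "real \<Rightarrow> 'a::euclidean_space \<Rightarrow> 'a" where
  "bump_gradient \<epsilon> x = (- 4 * max 0 (\<epsilon>\<^sup>2 - x \<bullet> x)) *\<^sub>R x"

definition bump_mass :: "'a::euclidean_space itself \<Rightarrow> real \<Rightarrow> real" where
  "bump_mass _ \<epsilon> = (LINT x::'a|lborel. bump \<epsilon> x)"

definition mollify :: "real \<Rightarrow> ('a::euclidean_space \<Rightarrow> 'b::euclidean_space) \<Rightarrow> 'a \<Rightarrow> 'b" where
  "mollify \<epsilon> f x = (LINT y|lborel. (bump \<epsilon> (x - y) / bump_mass TYPE('a) \<epsilon>) *\<^sub>R f y)"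

lemma bump_nonneg: "0 \<le> bump \<epsilon> x"
  by (simp add: bump_def)

lemma bump_le: "bump \<epsilon> x \<le> (\<epsilon>\<^sup>2)\<^sup>2"
  unfolding bump_def by (intro power_mono) auto

lemma inner_ge_power2_iff: "0 \<le> \<epsilon> \<Longrightarrow> \<epsilon>\<^sup>2 \<le> x \<bullet> x \<longleftrightarrow> \<epsilon> \<le> norm x"
  unfolding dot_square_norm by (simp add: power2_le_iff_abs_le abs_le_square_iff[symmetric])

lemma bump_eq_0: "0 \<le> \<epsilon> \<Longrightarrow> \<epsilon> \<le> norm x \<Longrightarrow> bump \<epsilon> x = 0"
  and bump_gradient_eq_0: "0 \<le> \<epsilon> \<Longrightarrow> \<epsilon> \<le> norm x \<Longrightarrow> bump_gradient \<epsilon> x = 0"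
  using inner_ge_power2_iff[of \<epsilon> x] by (simp_all add: bump_def bump_gradient_def)

lemma bump_minus: "bump \<epsilon> (- x) = bump \<epsilon> x"
  by (simp add: bump_def)

lemma bump_gradient_norm_le:
  assumes "0 \<le> \<epsilon>"
  shows "norm (bump_gradient \<epsilon> x) \<le> 4 * \<epsilon>\<^sup>2 * \<epsilon>"
proof (cases "\<epsilon> \<le> norm x")
  case False
  have "max 0 (\<epsilon>\<^sup>2 - x \<bullet> x) \<le> \<epsilon>\<^sup>2" by simp
  then have "(4 * max 0 (\<epsilon>\<^sup>2 - x \<bullet> x)) * norm x \<le> (4 * \<epsilon>\<^sup>2) * \<epsilon>"
    using False assms by (intro mult_mono) auto
  then show ?thesis by (simp add: bump_gradient_def abs_mult)
qed (use assms in \<open>simp add: bump_gradient_eq_0\<close>)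

lemma has_real_derivative_pos_part_squared:
  "((\<lambda>t::real. (max 0 t)\<^sup>2) has_real_derivative 2 * max 0 t) (at t)"
proof (cases "t = 0")
  case True
  have "((\<lambda>t::real. (max 0 t)\<^sup>2) has_derivative (\<lambda>h. h * 0)) (at 0)"
    unfolding has_derivative_at_alt
  proof (intro conjI allI impI)
    fix e :: real assume "e > 0"
    have "norm ((max 0 y)\<^sup>2 - (max 0 0)\<^sup>2 - (y - 0) * 0) \<le> e * norm (y - 0)"
      if y: "norm (y - 0) < e" for y :: real
    proof -
      have "(max 0 y)\<^sup>2 \<le> \<bar>y\<bar> * \<bar>y\<bar>"
        by (cases "y \<ge> 0") (auto simp: power2_eq_square max_def)
      also have "\<dots> \<le> e * \<bar>y\<bar>" using y by (intro mult_right_mono) auto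
      finally show ?thesis by simp
    qed
    then show "\<exists>d>0. \<forall>y::real. norm (y - 0) < d \<longrightarrow>
        norm ((max 0 y)\<^sup>2 - (max 0 0)\<^sup>2 - (y - 0) * 0) \<le> e * norm (y - 0)"
      using \<open>e > 0\<close> by (intro exI[of _ e]) simp
  qed (auto intro!: bounded_linear_intros)
  moreover have "(\<lambda>h::real. h * 0) = (*) 0" by auto
  ultimately show ?thesis using True by (simp only: has_field_derivative_def max.idem
      mult_zero_right)
next
  case False
  then consider "t > 0" | "t < 0" by linarith
  then show ?thesis
  proof cases
    case 1
    have "((\<lambda>t::real. t\<^sup>2) has_real_derivative 2 * max 0 t) (at t)"
      using 1 by (auto intro!: derivative_eq_intros)
    then show ?thesis
      by (rule has_field_derivative_transform_within_open[where S = "{0<..}"]) (use 1 in auto)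
  next
    case 2
    have "((\<lambda>t::real. 0) has_real_derivative 2 * max 0 t) (at t)"
      using 2 by (auto intro!: derivative_eq_intros)
    then show ?thesis
      by (rule has_field_derivative_transform_within_open[where S = "{..<0}"]) (use 2 in auto)
  qed
qed

lemma C1_gradient_bump: "C1_gradient (bump \<epsilon>) (bump_gradient \<epsilon>)"
proof -
  have "C1_gradient (\<lambda>x::'a. \<epsilon>\<^sup>2 - x \<bullet> x) (\<lambda>x. - 2 *\<^sub>R x)"
    unfolding C1_gradient_def gderiv_def
    by (auto intro!: derivative_eq_intros continuous_intros simp: inner_commute)
  moreover have "continuous_on UNIV (\<lambda>t::real. 2 * max 0 t)" by (intro continuous_intros)
  ultimately have "C1_gradient (\<lambda>x::'a. (max 0 (\<epsilon>\<^sup>2 - x \<bullet> x))\<^sup>2) (\<lambda>x. (2 * max 0 (\<epsilon>\<^sup>2 - x \<bullet> x)) *\<^sub>R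
      - 2 *\<^sub>R x)"
    using C1_gradient_compose[OF _ has_real_derivative_pos_part_squared] by blast
  also have "(\<lambda>x::'a. (max 0 (\<epsilon>\<^sup>2 - x \<bullet> x))\<^sup>2) = bump \<epsilon>" by (auto simp: bump_def)
  also have "(\<lambda>x::'a. (2 * max 0 (\<epsilon>\<^sup>2 - x \<bullet> x)) *\<^sub>R - 2 *\<^sub>R x) = bump_gradient \<epsilon>"
    by (auto simp: bump_gradient_def)
  finally show ?thesis .
qed

lemmas continuous_bump = C1_gradientD(4)[OF C1_gradient_bump]
lemmas continuous_bump_gradient = C1_gradientD(1)[OF C1_gradient_bump]

lemma measurable_bump [measurable]: "bump \<epsilon> \<in> borel_measurable borel"
  by (rule borel_measurable_continuous_onI[OF continuous_bump])

lemma measurable_bump_gradient [measurable]: "bump_gradient \<epsilon> \<in> borel_measurable borel"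
  by (rule borel_measurable_continuous_onI[OF continuous_bump_gradient])

text \<open>The derivative \<open>2 * max 0 s\<close> is Lipschitz with constant 2, hence the
  first-order Taylor remainder is quadratic. The four sign cases show this without
  integration.\<close>

lemma pos_part_squared_remainder:
  fixes s t :: real
  shows "\<bar>(max 0 t)\<^sup>2 - (max 0 s)\<^sup>2 - 2 * max 0 s * (t - s)\<bar> \<le> (t - s)\<^sup>2"
proof -
  consider "s \<ge> 0" "t \<ge> 0" | "s \<ge> 0" "t < 0" | "s < 0" "t \<ge> 0" | "s < 0" "t < 0" by linarith
  then show ?thesis
  proof cases
    case 1
    then have "(max 0 t)\<^sup>2 - (max 0 s)\<^sup>2 - 2 * max 0 s * (t - s) = (t - s)\<^sup>2"
      by (simp add: power2_eq_square algebra_simps)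
    then show ?thesis by simp
  next
    case 2
    then have "\<bar>(max 0 t)\<^sup>2 - (max 0 s)\<^sup>2 - 2 * max 0 s * (t - s)\<bar> = \<bar>s * (s - 2 * t)\<bar>"
      by (simp add: max_def power2_eq_square algebra_simps)
    also have "\<dots> = s * (s - 2 * t)" using 2 by (simp add: mult_nonneg_nonneg)
    also have "\<dots> \<le> (t - s)\<^sup>2" by (simp add: power2_eq_square algebra_simps)
    finally show ?thesis .
  next
    case 3
    then have "t * t \<le> (t - s) * (t - s)" by (intro mult_mono) auto
    then show ?thesis using 3 by (simp add: max_def power2_eq_square)
  qed (simp add: max_def)
qed

text \<open>The remainder is uniform in \<open>x\<close>, so it can be integrated against an
  arbitrary integrable function; this is what differentiates a convolution. The constant adds the
  squared Lipschitz bound \<open>2 * (\<epsilon> + 1) + 1\<close> of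
  \<open>\<epsilon>\<^sup>2 - x \<bullet> x\<close> near the support and the contribution of the
  term \<open>h \<bullet> h\<close> in its increment.\<close>

lemma bump_remainder:
  fixes x h :: "'a::euclidean_space"
  assumes e: "0 < \<epsilon>" and h: "norm h \<le> 1"
  shows "\<bar>bump \<epsilon> (x + h) - bump \<epsilon> x - h \<bullet> bump_gradient \<epsilon> x\<bar> \<le> ((2 * (\<epsilon> + 1) + 1)\<^sup>2
      + 2 * \<epsilon>\<^sup>2) * (norm h)\<^sup>2"
proof (cases "norm x \<le> \<epsilon> + 1")
  case True
  define s where "s = \<epsilon>\<^sup>2 - x \<bullet> x"
  define t where "t = \<epsilon>\<^sup>2 - (x + h) \<bullet> (x + h)"
  have ts: "t - s = - 2 * (h \<bullet> x) - h \<bullet> h"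
    by (simp add: t_def s_def inner_add inner_commute algebra_simps)
  have "\<bar>t - s\<bar> \<le> 2 * (norm h * norm x) + norm h * norm h"
  proof -
    have "h \<bullet> h = norm h * norm h" by (simp add: dot_square_norm power2_eq_square)
    moreover have "0 \<le> norm h * norm h" by simp
    ultimately show ?thesis
      using Cauchy_Schwarz_ineq2[of h x] unfolding ts by linarith
  qed
  also have "\<dots> \<le> 2 * (norm h * (\<epsilon> + 1)) + norm h * 1"
    using True h by (intro add_mono mult_left_mono) auto
  finally have ab: "\<bar>t - s\<bar> \<le> (2 * (\<epsilon> + 1) + 1) * norm h" by (simp add: algebra_simps)
  have "bump \<epsilon> (x + h) - bump \<epsilon> x - h \<bullet> bump_gradient \<epsilon> x
     = ((max 0 t)\<^sup>2 - (max 0 s)\<^sup>2 - 2 * max 0 s * (t - s)) - 2 * max 0 s * (h \<bullet> h)"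
    unfolding bump_def bump_gradient_def ts s_def[symmetric] t_def[symmetric]
    by (simp add: algebra_simps)
  also have "\<bar>\<dots>\<bar> \<le> (t - s)\<^sup>2 + 2 * \<epsilon>\<^sup>2 * (norm h)\<^sup>2"
  proof -
    have "0 \<le> max 0 s" "max 0 s \<le> \<epsilon>\<^sup>2" by (auto simp: s_def)
    then have "\<bar>2 * max 0 s * (h \<bullet> h)\<bar> \<le> 2 * \<epsilon>\<^sup>2 * (norm h)\<^sup>2"
      unfolding dot_square_norm by (simp add: abs_mult mult_right_mono)
    then show ?thesis using pos_part_squared_remainder[of t s] by linarith
  qed
  also have "(t - s)\<^sup>2 \<le> ((2 * (\<epsilon> + 1) + 1) * norm h)\<^sup>2"
    using power_mono[OF ab, of 2] by simp
  finally show ?thesis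
    unfolding power_mult_distrib distrib_right[of _ _ "(norm h)\<^sup>2"] by simp
next
  \<comment> \<open>Since \<open>norm h \<le> 1\<close>, both points lie outside the support and
    every term is 0.\<close>
  case False
  have "norm x \<le> norm (x + h) + norm h" by (metis add_diff_cancel_right' norm_triangle_ineq4)
  then have "\<epsilon> \<le> norm (x + h)" "\<epsilon> \<le> norm x" using False h by linarith+
  then have z: "bump \<epsilon> (x + h) = 0" "bump \<epsilon> x = 0" "bump_gradient \<epsilon> x = 0"
    using e by (simp_all add: bump_eq_0 bump_gradient_eq_0)
  show ?thesis unfolding z by simp
qed

lemma integrable_bump: "0 < \<epsilon> \<Longrightarrow> integrable lborel (bump \<epsilon> :: 'a::euclidean_space \<Rightarrow> real)"
proof (rule integrable_lborel_compact_support[of _ "cball 0 \<epsilon>"])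
  show "norm (bump \<epsilon> (x::'a)) \<le> (\<epsilon>\<^sup>2)\<^sup>2" for x
    using bump_le[of \<epsilon> x] bump_nonneg[of \<epsilon> x] by simp
  show "0 < \<epsilon> \<Longrightarrow> x \<notin> cball 0 \<epsilon> \<Longrightarrow> bump \<epsilon> x = 0" for x :: 'a
    by (intro bump_eq_0) auto
qed auto

text \<open>Mass 0 would force the kernel to vanish almost everywhere, although it is positive on a
  ball, which is not negligible.\<close>

lemma bump_mass_pos:
  assumes e: "0 < \<epsilon>"
  shows "bump_mass TYPE('a::euclidean_space) \<epsilon> > 0"
proof -
  have "bump_mass TYPE('a) \<epsilon> \<noteq> 0"
  proof
    assume "bump_mass TYPE('a) \<epsilon> = 0"
    then have "AE x::'a in lborel. bump \<epsilon> x = 0"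
      unfolding bump_mass_def
      using integral_nonneg_eq_0_iff_AE[OF integrable_bump[OF e]] bump_nonneg by auto
    then have "{x \<in> space (lborel::'a measure). \<not> bump \<epsilon> x = 0} \<in> null_sets lborel"
      by (subst (asm) AE_iff_null) auto
    moreover have "ball 0 \<epsilon> \<subseteq> {x \<in> space (lborel::'a measure). \<not> bump \<epsilon> x = 0}"
    proof
      fix x :: 'a assume "x \<in> ball 0 \<epsilon>"
      then have "\<not> \<epsilon>\<^sup>2 \<le> x \<bullet> x" using inner_ge_power2_iff[of \<epsilon> x] e by simp
      then show "x \<in> {x \<in> space lborel. \<not> bump \<epsilon> x = 0}" by (simp add: bump_def)
    qed
    ultimately have "ball (0::'a) \<epsilon> \<in> null_sets lborel" by (auto intro: null_sets_subset)
    then have "negligible (ball (0::'a) \<epsilon>)"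
      by (simp add: negligible_iff_null_sets null_sets_completionI)
    then show False using open_not_negligible[of "ball (0::'a) \<epsilon>"] e by auto
  qed
  moreover have "bump_mass TYPE('a) \<epsilon> \<ge> 0"
    unfolding bump_mass_def by (intro integral_nonneg_AE) (auto simp: bump_nonneg)
  ultimately show ?thesis by simp
qed

lemma integral_bump_shift:
  fixes x :: "'a::euclidean_space"
  assumes "0 < \<epsilon>"
  shows "(LINT y|lborel. bump \<epsilon> (x - y) / bump_mass TYPE('a) \<epsilon>) = 1"
    "integrable lborel (\<lambda>y. bump \<epsilon> (x - y) / bump_mass TYPE('a) \<epsilon>)"
proof -
  have eq: "bump \<epsilon> (x - y) = bump \<epsilon> (y + (- x))" for y
    using bump_minus[of \<epsilon> "x - y"] by simp
  show "(LINT y|lborel. bump \<epsilon> (x - y) / bump_mass TYPE('a) \<epsilon>) = 1"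
    unfolding eq using lborel_integral_translation(1)[of "bump \<epsilon>" "- x"] bump_mass_pos[OF assms,
        where 'a='a]
    by (simp add: bump_mass_def)
  show "integrable lborel (\<lambda>y. bump \<epsilon> (x - y) / bump_mass TYPE('a) \<epsilon>)"
    unfolding eq using lborel_integral_translation(2)[of "bump \<epsilon>" "- x"] integrable_bump[OF assms,
        where 'a='a]
    by simp
qed

lemma norm_integral_le:
  fixes f :: "'c \<Rightarrow> 'b::{banach, second_countable_topology}"
  assumes "integrable M f" "integrable M g" "AE x in M. norm (f x) \<le> g x"
  shows "norm (LINT x|M. f x) \<le> (LINT x|M. g x)"
  by (rule order_trans[OF integral_norm_bound integral_mono_AE]) (use assms in auto)

lemma integrable_bounded_mult:
  fixes f :: "'c \<Rightarrow> 'b::{banach, second_countable_topology}"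
  assumes "integrable M f" "k \<in> borel_measurable M" "\<And>x. \<bar>k x\<bar> \<le> (C::real)"
  shows "integrable M (\<lambda>x. k x *\<^sub>R f x)"
proof (rule Bochner_Integration.integrable_bound)
  show "integrable M (\<lambda>x. C *\<^sub>R f x)" using assms by simp
  have "\<bar>k x\<bar> * norm (f x) \<le> \<bar>C\<bar> * norm (f x)" for x
    using assms(3)[of x] by (intro mult_right_mono) auto
  then show "AE x in M. norm (k x *\<^sub>R f x) \<le> norm (C *\<^sub>R f x)" by auto
qed (use assms in auto)

lemma integrable_mollify:
  fixes f :: "'a::euclidean_space \<Rightarrow> 'b::euclidean_space"
  assumes "integrable lborel f"
  shows "integrable lborel (\<lambda>y. (bump \<epsilon> (x - y) / c) *\<^sub>R f y)"
    "integrable lborel (\<lambda>y. (bump \<epsilon> (x - y) * c) *\<^sub>R f y)"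
proof -
  have "\<bar>bump \<epsilon> (x - y)\<bar> * \<bar>c\<bar> \<le> (\<epsilon>\<^sup>2)\<^sup>2 * \<bar>c\<bar>" for y c
    using bump_le[of \<epsilon> "x - y"] bump_nonneg[of \<epsilon> "x - y"] by (intro mult_right_mono) auto
  then show *: "integrable lborel (\<lambda>y. (bump \<epsilon> (x - y) * c) *\<^sub>R f y)" for c
    by (intro integrable_bounded_mult[OF assms, where C = "(\<epsilon>\<^sup>2)\<^sup>2 * \<bar>c\<bar>"]) (auto simp: abs_mult)
  show "integrable lborel (\<lambda>y. (bump \<epsilon> (x - y) / c) *\<^sub>R f y)"
    using *[of "1/c"] by simp
qed

text \<open>Differentiation under the integral through the uniform estimate
  \<open>bump_remainder\<close>: the error is at most a constant times
  \<open>(norm h)\<^sup>2\<close> times the integral of \<open>\<bar>f y\<bar>\<close>. Dominated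
  convergence gives the continuity of the gradient.\<close>

lemma C1_gradient_mollify:
  fixes f :: "'a::euclidean_space \<Rightarrow> real"
  assumes e: "0 < \<epsilon>" and f: "integrable lborel f"
  shows "C1_gradient (mollify \<epsilon> f) (\<lambda>x. LINT y|lborel. (f y / bump_mass TYPE('a) \<epsilon>) *\<^sub>R
      bump_gradient \<epsilon> (x - y))"
    (is "C1_gradient _ ?g")
  unfolding C1_gradient_def gderiv_def
proof (intro conjI allI)
  define c where "c = bump_mass TYPE('a) \<epsilon>"
  have c: "c > 0" unfolding c_def by (rule bump_mass_pos[OF e])
  define B where "B = (2 * (\<epsilon> + 1) + 1)\<^sup>2 + 2 * \<epsilon>\<^sup>2"
  have fm [measurable]: "f \<in> borel_measurable borel" using f by auto
  have i2: "integrable lborel (\<lambda>y. (f y / c) *\<^sub>R bump_gradient \<epsilon> (x - y))" for x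
  proof (rule Bochner_Integration.integrable_bound)
    show "integrable lborel (\<lambda>y. (4 * \<epsilon>\<^sup>2 * \<epsilon>) * (f y / c))" using f by simp
    have "\<bar>f y / c\<bar> * norm (bump_gradient \<epsilon> (x - y)) \<le> \<bar>f y / c\<bar> * (4 * \<epsilon>\<^sup>2 * \<epsilon>)" for y
      using bump_gradient_norm_le[of \<epsilon> "x - y"] e by (intro mult_left_mono) auto
    then show "AE y in lborel. norm ((f y / c) *\<^sub>R bump_gradient \<epsilon> (x - y))
        \<le> norm ((4 * \<epsilon>\<^sup>2 * \<epsilon>) * (f y / c))"
      using e by (auto simp: abs_mult mult.commute)
  qed auto
  have i1: "integrable lborel (\<lambda>y. (bump \<epsilon> (x - y) / c) * f y)" for x
    using integrable_mollify(1)[OF f] by simp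
  show "continuous_on UNIV ?g"
    unfolding continuous_on_sequentially
  proof (intro allI ballI impI, clarsimp simp: o_def)
    fix X :: "nat \<Rightarrow> 'a" and x assume X: "X \<longlonglongrightarrow> x"
    show "(\<lambda>n. ?g (X n)) \<longlonglongrightarrow> ?g x"
    proof (rule integral_dominated_convergence[where w = "\<lambda>y. (4 * \<epsilon>\<^sup>2 * \<epsilon>) * \<bar>f y / c\<bar>"])
      show "integrable lborel (\<lambda>y. (4 * \<epsilon>\<^sup>2 * \<epsilon>) * \<bar>f y / c\<bar>)" using f by auto
      show "AE y in lborel. (\<lambda>n. (f y / bump_mass TYPE('a) \<epsilon>) *\<^sub>R bump_gradient \<epsilon> (X n - y))
          \<longlonglongrightarrow> (f y / bump_mass TYPE('a) \<epsilon>) *\<^sub>R bump_gradient \<epsilon> (x - y)"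
        using X by (intro AE_I2 tendsto_scaleR tendsto_const continuous_on_tendsto_compose[OF
            continuous_bump_gradient] tendsto_diff) auto
      fix n
      have "\<bar>f y / c\<bar> * norm (bump_gradient \<epsilon> (X n - y)) \<le> \<bar>f y / c\<bar> * (4 * \<epsilon>\<^sup>2 * \<epsilon>)" for y
        using bump_gradient_norm_le[of \<epsilon> "X n - y"] e by (intro mult_left_mono) auto
      then show "AE y in lborel. norm ((f y / bump_mass TYPE('a) \<epsilon>) *\<^sub>R bump_gradient \<epsilon> (X n - y))
          \<le> (4 * \<epsilon>\<^sup>2 * \<epsilon>) * \<bar>f y / c\<bar>"
        by (auto simp: c_def mult.commute)
    qed auto
  qed
  fix x
  have ineq: "\<bar>mollify \<epsilon> f (x + h) - mollify \<epsilon> f x - h \<bullet> ?g x\<bar> \<le> (B / c *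
      (LINT y|lborel. \<bar>f y\<bar>)) * (norm h)\<^sup>2"
    if h: "norm h \<le> 1" for h
  proof -
    have "mollify \<epsilon> f (x + h) - mollify \<epsilon> f x - h \<bullet> ?g x
      = (LINT y|lborel. (bump \<epsilon> (x + h - y) / c) * f y - (bump \<epsilon> (x - y) / c) * f y - h \<bullet> ((f y / c)
          *\<^sub>R bump_gradient \<epsilon> (x - y)))"
    proof -
      have "h \<bullet> ?g x = (LINT y|lborel. h \<bullet> ((f y / c) *\<^sub>R bump_gradient \<epsilon> (x - y)))"
        unfolding c_def[symmetric] by (rule integral_inner_right[symmetric]) (rule i2)
      moreover have "mollify \<epsilon> f z = (LINT y|lborel. (bump \<epsilon> (z - y) / c) * f y)" for z
        by (simp add: mollify_def c_def)
      moreover have "integrable lborel (\<lambda>y. h \<bullet> ((f y / c) *\<^sub>R bump_gradient \<epsilon> (x - y)))"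
        by (rule integrable_inner_right) (rule i2)
      ultimately show ?thesis
        by (simp only: Bochner_Integration.integral_diff Bochner_Integration.integrable_diff i1)
    qed
    also have "norm \<dots> \<le> (LINT y|lborel. B / c * (norm h)\<^sup>2 * \<bar>f y\<bar>)"
    proof (rule norm_integral_le, safe intro!: AE_I2)
      fix y
      have "(bump \<epsilon> (x + h - y) / c) * f y - (bump \<epsilon> (x - y) / c) * f y - h \<bullet> ((f y / c) *\<^sub>R
          bump_gradient \<epsilon> (x - y))
        = (f y / c) * (bump \<epsilon> ((x - y) + h) - bump \<epsilon> (x - y) - h \<bullet> bump_gradient \<epsilon> (x - y))"
        by (simp add: algebra_simps)
      also have "norm \<dots> = \<bar>f y / c\<bar> * \<bar>bump \<epsilon> ((x - y) + h) - bump \<epsilon> (x - y) - h \<bullet> bump_gradient \<epsilon>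
          (x - y)\<bar>"
        by (simp add: abs_mult)
      also have "\<dots> \<le> \<bar>f y / c\<bar> * (B * (norm h)\<^sup>2)"
        unfolding B_def by (intro mult_left_mono bump_remainder e h) auto
      also have "\<dots> = B / c * (norm h)\<^sup>2 * \<bar>f y\<bar>" using c by simp
      finally show "norm ((bump \<epsilon> (x + h - y) / c) * f y - (bump \<epsilon> (x - y) / c) * f y - h \<bullet> ((f y /
          c) *\<^sub>R bump_gradient \<epsilon> (x - y)))
         \<le> B / c * (norm h)\<^sup>2 * \<bar>f y\<bar>" .
    next
      show "integrable lborel (\<lambda>y. (bump \<epsilon> (x + h - y) / c) * f y - (bump \<epsilon> (x - y) / c) * f y - h \<bullet>
          ((f y / c) *\<^sub>R bump_gradient \<epsilon> (x - y)))"
        by (intro Bochner_Integration.integrable_diff i1 integrable_inner_right i2)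
    qed (use f in auto)
    finally show ?thesis by (simp add: mult_ac)
  qed
  show "(mollify \<epsilon> f has_derivative (\<lambda>h. h \<bullet> ?g x)) (at x)"
    unfolding has_derivative_at_alt
  proof (intro conjI allI impI)
    fix e :: real assume e: "e > 0"
    define A where "A = B / c * (LINT y|lborel. \<bar>f y\<bar>)"
    show "\<exists>d>0. \<forall>y. norm (y - x) < d \<longrightarrow> norm (mollify \<epsilon> f y - mollify \<epsilon> f x - (y - x) \<bullet> ?g x)
        \<le> e * norm (y - x)"
    proof (intro exI[of _ "min 1 (e / (\<bar>A\<bar> + 1))"] conjI allI impI)
      show "0 < min 1 (e / (\<bar>A\<bar> + 1))" using e by (simp add: add_nonneg_pos)
      fix y assume y: "norm (y - x) < min 1 (e / (\<bar>A\<bar> + 1))"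
      then have ye: "norm (y - x) * (\<bar>A\<bar> + 1) \<le> e"
        by (simp add: pos_less_divide_eq add_nonneg_pos less_imp_le)
      have "norm (mollify \<epsilon> f y - mollify \<epsilon> f x - (y - x) \<bullet> ?g x) \<le> A * (norm (y - x))\<^sup>2"
        using ineq[of "y - x"] y unfolding A_def by simp
      also have "\<dots> \<le> (\<bar>A\<bar> + 1) * (norm (y - x))\<^sup>2" by (intro mult_right_mono) auto
      also have "\<dots> = (norm (y - x) * (\<bar>A\<bar> + 1)) * norm (y - x)"
          by (simp add: power2_eq_square mult_ac)
      also have "\<dots> \<le> e * norm (y - x)" by (intro mult_right_mono ye) auto
      finally show "norm (mollify \<epsilon> f y - mollify \<epsilon> f x - (y - x) \<bullet> ?g x) \<le> e * norm (y - x)" .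
    qed
  qed (rule bounded_linear_inner_left)
qed

text \<open>The kernel is a probability density, so averages stay within the bound. This turns the
  essential bound of \<phi> into a bound on its approximations at every point.\<close>

lemma mollify_bound:
  fixes f :: "'a::euclidean_space \<Rightarrow> 'b::euclidean_space"
  assumes e: "0 < \<epsilon>" and f: "AE y in lborel. norm (f y) \<le> C" "integrable lborel f"
  shows "norm (mollify \<epsilon> f x) \<le> C"
proof -
  have "norm (mollify \<epsilon> f x) \<le> (LINT y|lborel. (bump \<epsilon> (x - y) / bump_mass TYPE('a) \<epsilon>) * C)"
    unfolding mollify_def
  proof (rule norm_integral_le)
    show "integrable lborel (\<lambda>y. bump \<epsilon> (x - y) / bump_mass TYPE('a) \<epsilon> * C)"
      using integrable_mult_left[OF integral_bump_shift(2)[OF e, of x], of C] .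
    show "AE y in lborel. norm ((bump \<epsilon> (x - y) / bump_mass TYPE('a) \<epsilon>) *\<^sub>R f y)
        \<le> bump \<epsilon> (x - y) / bump_mass TYPE('a) \<epsilon> * C"
      using f(1) by eventually_elim (use bump_mass_pos[OF e, where 'a='a] in \<open>simp add: bump_nonneg
          divide_right_mono mult_left_mono\<close>)
  qed (rule integrable_mollify(1)[OF f(2)])
  also have "\<dots> = C" using integral_bump_shift[OF e, of x] by simp
  finally show ?thesis .
qed

lemma Lp_cong_AE:
  assumes "Lp M p f" "f' \<in> borel_measurable M" "AE x in M. f x = f' x"
  shows "Lp M p f'"
proof -
  have "integrable M (\<lambda>x. norm (f' x) powr p)"
    by (rule integrable_cong_AE_imp[OF LpD(2)[OF assms(1)]]) (use assms in auto)
  then show ?thesis using assms by (auto simp: Lp_def)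
qed

lemma Lp_tendsto_cong_AE:
  assumes F: "Lp_tendsto M p F f" and F': "\<And>n. F' n \<in> borel_measurable M" "\<And>n. AE x in M. F n x
      = F' n x"
    and f': "f' \<in> borel_measurable M" "AE x in M. f x = f' x"
  shows "Lp_tendsto M p F' f'"
proof -
  note FD = Lp_tendstoD[OF F]
  have "(LINT x|M. norm (F n x - f x) powr p) = (LINT x|M. norm (F' n x - f' x) powr p)" for n
  proof (rule integral_cong_AE)
    show "AE x in M. norm (F n x - f x) powr p = norm (F' n x - f' x) powr p"
      using F'(2)[of n] f'(2) by eventually_elim simp
  qed (use LpD(1)[OF FD(1)] LpD(1)[OF FD(2)] F' f' in auto)
  then show ?thesis using FD Lp_cong_AE[OF FD(1) F'] Lp_cong_AE[OF FD(2) f']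
    by (auto simp: Lp_tendsto_def)
qed

section \<open>Passage from \<open>lborel\<close> to Lebesgue measure on a set\<close>

lemma integrable_lborel_imp_lebesgue_on:
  fixes f :: "'a::euclidean_space \<Rightarrow> 'b::euclidean_space"
  assumes "integrable lborel f" "S \<in> sets lebesgue"
  shows "integrable (lebesgue_on S) f"
proof -
  have "integrable lebesgue f" using assms(1) integrable_completion[of f lborel] by auto
  then have "integrable lebesgue (\<lambda>x. indicator S x *\<^sub>R f x)"
    using assms(2) by (intro integrable_bounded_mult[where C = 1]) (auto simp: indicator_def)
  then show ?thesis using assms(2) by (subst integrable_restrict_space) auto
qed

lemma integral_lebesgue_on_le_lborel:
  fixes f :: "'a::euclidean_space \<Rightarrow> real"
  assumes "integrable lborel f" "S \<in> sets lebesgue" "\<And>x. 0 \<le> f x"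
  shows "(LINT x|lebesgue_on S. f x) \<le> (LINT x|lborel. f x)"
proof -
  have f: "integrable lebesgue f" using assms(1) integrable_completion[of f lborel] by auto
  have "(LINT x|lebesgue_on S. f x) = (LINT x|lebesgue. indicator S x *\<^sub>R f x)"
    using assms(2) by (subst integral_restrict_space) auto
  also have "\<dots> \<le> (LINT x|lebesgue. f x)"
    using assms f by (intro integral_mono integrable_bounded_mult[where C
        = 1]) (auto simp: indicator_def)
  also have "\<dots> = (LINT x|lborel. f x)" using assms(1) by (intro integral_completion) auto
  finally show ?thesis .
qed

lemma Lp_lborel_imp_lebesgue_on:
  fixes f :: "'a::euclidean_space \<Rightarrow> 'b::euclidean_space"
  assumes "Lp lborel p f" "S \<in> sets lebesgue"
  shows "Lp (lebesgue_on S) p f"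
proof -
  have "f \<in> borel_measurable lebesgue"
    using LpD(1)[OF assms(1)] by (intro measurable_completion) auto
  then have "f \<in> borel_measurable (lebesgue_on S)" by (rule measurable_restrict_space1)
  then show ?thesis
    using integrable_lborel_imp_lebesgue_on[OF LpD(2)[OF assms(1)] assms(2)] by (auto simp: Lp_def)
qed

lemma Lp_tendsto_lborel_imp_lebesgue_on:
  fixes f :: "'a::euclidean_space \<Rightarrow> 'b::euclidean_space"
  assumes p: "0 \<le> p" and F: "Lp_tendsto lborel p F f" and S: "S \<in> sets lebesgue"
  shows "Lp_tendsto (lebesgue_on S) p F f"
proof -
  note FD = Lp_tendstoD[OF F]
  have "(\<lambda>n. LINT x|lebesgue_on S. norm (F n x - f x) powr p) \<longlonglongrightarrow> 0"
  proof (rule tendsto_sandwich[OF _ _ tendsto_const FD(3)])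
    show "\<forall>\<^sub>F n in sequentially. (LINT x|lebesgue_on S. norm (F n x - f x) powr p) \<le>
        (LINT x|lborel. norm (F n x - f x) powr p)"
      using LpD(2)[OF Lp_diff[OF p FD(1) FD(2)]] S
      by (intro always_eventually allI integral_lebesgue_on_le_lborel) auto
  qed auto
  then show ?thesis using FD Lp_lborel_imp_lebesgue_on[OF _ S] by (auto simp: Lp_tendsto_def)
qed

lemma measurable_mollify [measurable]:
  fixes f :: "'a::euclidean_space \<Rightarrow> 'b::euclidean_space"
  assumes [measurable]: "f \<in> borel_measurable borel"
  shows "mollify \<epsilon> f \<in> borel_measurable borel"
proof -
  have "(\<lambda>x. LINT y|lborel. (bump \<epsilon> (x - y) / bump_mass TYPE('a) \<epsilon>) *\<^sub>R f y) \<in> borel_measurable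
      borel"
    by (rule lborel.borel_measurable_lebesgue_integral) measurable
  then show ?thesis by (simp add: mollify_def[abs_def])
qed

text \<open>The error is the average of \<open>f y - f x\<close> against the kernel. Jensen's
  inequality moves the power inside; the substitution \<open>y = x + z\<close> and the evenness of
  \<open>bump\<close> then give a form suited to exchanging the integrals over \<open>x\<close> and
  \<open>z\<close>.\<close>

lemma mollify_diff_powr_le:
  fixes f :: "'a::euclidean_space \<Rightarrow> 'b::euclidean_space"
  assumes e: "0 < \<epsilon>" and p: "1 \<le> p" and f: "Lp lborel p f" "integrable lborel f"
  shows "norm (mollify \<epsilon> f x - f x) powr p
    \<le> (LINT z|lborel. bump \<epsilon> z / bump_mass TYPE('a) \<epsilon> * norm (f (x + z) - f x) powr p)"
    and "integrable lborel (\<lambda>z. bump \<epsilon> z / bump_mass TYPE('a) \<epsilon> * norm (f (x + z) - f x) powr p)"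
proof -
  define k where "k y = bump \<epsilon> (x - y) / bump_mass TYPE('a) \<epsilon>" for y
  have [measurable]: "f \<in> borel_measurable borel" using f(2) by auto
  have km: "k \<in> borel_measurable borel" unfolding k_def by measurable
  have k0: "0 \<le> k y" for y
    using bump_nonneg[of \<epsilon> "x - y"] bump_mass_pos[OF e, where 'a='a] by (simp add: k_def)
  have kint: "integrable lborel k" "(LINT y|lborel. k y) = 1"
    using integral_bump_shift[OF e, of x] by (simp_all add: k_def[abs_def])
  have kb: "\<bar>k y\<bar> \<le> (\<epsilon>\<^sup>2)\<^sup>2 / bump_mass TYPE('a) \<epsilon>" for y
    using k0[of y] bump_le[of \<epsilon> "x - y"] bump_mass_pos[OF e, where 'a='a]
        by (simp add: k_def divide_right_mono bump_nonneg)
  have kf: "integrable lborel (\<lambda>y. k y *\<^sub>R f y)"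
    by (rule integrable_bounded_mult[OF f(2) _ kb]) (use km in auto)
  have kd: "integrable lborel (\<lambda>y. k y *\<^sub>R (f y - f x))"
    using kf kint(1) by (simp add: scaleR_diff_right)
  have kn: "integrable lborel (\<lambda>y. k y * norm (f y - f x))"
    using integrable_norm[OF kd] k0 by (simp add: abs_of_nonneg)
  have kp: "integrable lborel (\<lambda>y. k y * norm (f y - f x) powr p)"
  proof (rule Bochner_Integration.integrable_bound)
    show "integrable lborel (\<lambda>y. 2 powr p * (k y *\<^sub>R (norm (f y) powr p)
        + k y * norm (f x) powr p))"
      using kint(1) integrable_bounded_mult[OF LpD(2)[OF f(1)] _ kb] km by auto
    have "norm (k y * norm (f y - f x) powr p) \<le> norm (2 powr p * (k y *\<^sub>R (norm (f y) powr p)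
        + k y * norm (f x) powr p))" for y
    proof -
      have "k y * norm (f y - f x) powr p \<le> k y * (2 powr p * (norm (f y) powr p
          + norm (f x) powr p))"
        using norm_add_powr_le[of p "f y" "- f x"] p k0 by (intro mult_left_mono) auto
      then show ?thesis using k0[of y] by (simp add: algebra_simps abs_of_nonneg)
    qed
    then show "AE y in lborel. norm (k y * norm (f y - f x) powr p)
        \<le> norm (2 powr p * (k y *\<^sub>R (norm (f y) powr p) + k y * norm (f x) powr p))"
      by auto
  qed (use km in measurable)
  have "mollify \<epsilon> f x - f x = (LINT y|lborel. k y *\<^sub>R (f y - f x))"
  proof -
    have "(LINT y|lborel. k y *\<^sub>R (f y - f x)) = (LINT y|lborel. k y *\<^sub>R f y) -
        (LINT y|lborel. k y *\<^sub>R f x)"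
      using kf kint(1) by (simp add: scaleR_diff_right)
    also have "(LINT y|lborel. k y *\<^sub>R f x) = f x"
      using kint by simp
    finally show ?thesis by (simp add: mollify_def k_def)
  qed
  then have "norm (mollify \<epsilon> f x - f x) \<le> (LINT y|lborel. k y * norm (f y - f x))"
    using integral_norm_bound[of lborel "\<lambda>y. k y *\<^sub>R (f y - f x)"] k0 by (simp add: abs_of_nonneg)
  then have "norm (mollify \<epsilon> f x - f x) powr p \<le> (LINT y|lborel. k y * norm (f y - f x)) powr p"
    using p by (intro powr_mono2) auto
  also have "\<dots> \<le> (LINT y|lborel. k y * norm (f y - f x) powr p)"
    by (rule powr_integral_le) (use p k0 kint kn kp in auto)
  also have "\<dots> = (LINT z|lborel. k (z + x) * norm (f (z + x) - f x) powr p)"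
    using lborel_integral_translation(1)[of "\<lambda>y. k y * norm (f y - f x) powr p" x] km by simp
  also have "\<dots> = (LINT z|lborel. bump \<epsilon> z / bump_mass TYPE('a) \<epsilon> * norm (f (x + z) - f x) powr p)"
    by (simp add: k_def bump_minus add.commute)
  finally show "norm (mollify \<epsilon> f x - f x) powr p \<le> \<dots>" .
  have "integrable lborel (\<lambda>z. k (z + x) * norm (f (z + x) - f x) powr p)"
    using lborel_integral_translation(2)[of "\<lambda>y. k y * norm (f y - f x) powr p" x] km kp by simp
  then show "integrable lborel (\<lambda>z. bump \<epsilon> z / bump_mass TYPE('a) \<epsilon> * norm (f (x
      + z) - f x) powr p)"
    by (simp add: k_def bump_minus add.commute)
qed

text \<open>After the exchange of integrals, each shift \<open>z\<close> contributes its translation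
  error, at most \<eta> while \<open>norm z < \<epsilon>\<close>; for larger shifts the kernel is 0.
  With nonnegative integrals the exchange is free of conditions, and integrability comes out as a
  by-product.\<close>

lemma mollify_Lp_close:
  fixes f :: "'a::euclidean_space \<Rightarrow> 'b::euclidean_space"
  assumes e: "0 < \<epsilon>" and p: "1 \<le> p" and f: "Lp lborel p f" "integrable lborel f"
    and T: "\<And>z. norm z < \<epsilon> \<Longrightarrow> (LINT x|lborel. norm (f (x + z) - f x) powr p) \<le> \<eta>" and \<eta>: "0 \<le> \<eta>"
  shows "Lp lborel p (mollify \<epsilon> f)" "(LINT x|lborel. norm (mollify \<epsilon> f x - f x) powr p) \<le> \<eta>"
proof -
  define k where "k z = bump \<epsilon> z / bump_mass TYPE('a) \<epsilon>" for z :: 'a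
  have fm[measurable]: "f \<in> borel_measurable borel" using f(2) by auto
  have km[measurable]: "k \<in> borel_measurable borel" unfolding k_def by measurable
  have k0: "0 \<le> k z" for z
    using bump_nonneg[of \<epsilon> z] bump_mass_pos[OF e, where 'a='a] by (simp add: k_def)
  have k1: "(LINT z|lborel. k z) = 1" "integrable lborel k"
    using bump_mass_pos[OF e, where 'a='a] integrable_bump[OF e, where 'a='a]
    by (simp_all add: k_def[abs_def] bump_mass_def)
  have p0: "0 \<le> p" using p by simp
  have "(\<integral>\<^sup>+x. ennreal (norm (mollify \<epsilon> f x - f x) powr p) \<partial>lborel)
    \<le> (\<integral>\<^sup>+x. (\<integral>\<^sup>+z. ennreal (k z * norm (f (x + z) - f x) powr p) \<partial>lborel) \<partial>lborel)"
  proof (rule nn_integral_mono)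
    fix x :: 'a
    have "(\<integral>\<^sup>+z. ennreal (k z * norm (f (x + z) - f x) powr p) \<partial>lborel)
      = ennreal (LINT z|lborel. k z * norm (f (x + z) - f x) powr p)"
      using mollify_diff_powr_le(2)[OF e p f, of x, folded k_def] k0
          by (intro nn_integral_eq_integral) auto
    then show "ennreal (norm (mollify \<epsilon> f x - f x) powr p) \<le> (\<integral>\<^sup>+z. ennreal (k z * norm (f (x
        + z) - f x) powr p) \<partial>lborel)"
      using mollify_diff_powr_le(1)[OF e p f, of x] by (simp add: k_def ennreal_leI)
  qed
  also have "\<dots> = (\<integral>\<^sup>+z. (\<integral>\<^sup>+x. ennreal (k z * norm (f (x + z) - f x) powr p) \<partial>lborel) \<partial>lborel)"
    by (rule lborel_pair.Fubini') measurable
  also have "\<dots> \<le> (\<integral>\<^sup>+z. ennreal (k z) * ennreal \<eta> \<partial>lborel)"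
  proof (rule nn_integral_mono)
    fix z :: 'a
    have "(\<integral>\<^sup>+x. ennreal (k z * norm (f (x + z) - f x) powr p) \<partial>lborel)
       = ennreal (k z) * (\<integral>\<^sup>+x. ennreal (norm (f (x + z) - f x) powr p) \<partial>lborel)"
      using k0 by (subst nn_integral_cmult[symmetric]) (auto simp: ennreal_mult)
    also have "(\<integral>\<^sup>+x. ennreal (norm (f (x + z) - f x) powr p) \<partial>lborel) = ennreal
        (LINT x|lborel. norm (f (x + z) - f x) powr p)"
      using LpD(2)[OF Lp_diff[OF p0 Lp_translation[OF f(1)] f(1)]]
          by (intro nn_integral_eq_integral) auto
    also have "ennreal (k z) * \<dots> \<le> ennreal (k z) * ennreal \<eta>"
    proof (cases "norm z < \<epsilon>")
      case True
      then show ?thesis by (intro mult_left_mono ennreal_leI T) auto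
    next
      case False
      then have "k z = 0" using e bump_eq_0[of \<epsilon> z] by (simp add: k_def)
      then show ?thesis by simp
    qed
    finally show "(\<integral>\<^sup>+x. ennreal (k z * norm (f (x + z) - f x) powr p) \<partial>lborel)
        \<le> ennreal (k z) * ennreal \<eta>" .
  qed
  also have "\<dots> = (\<integral>\<^sup>+z. ennreal (k z) \<partial>lborel) * ennreal \<eta>"
    by (rule nn_integral_multc) measurable
  also have "(\<integral>\<^sup>+z. ennreal (k z) \<partial>lborel) = 1"
    using k1 k0 by (subst nn_integral_eq_integral) auto
  finally have le: "(\<integral>\<^sup>+x. ennreal (norm (mollify \<epsilon> f x - f x) powr p) \<partial>lborel) \<le> ennreal \<eta>" by simp
  have i: "integrable lborel (\<lambda>x. norm (mollify \<epsilon> f x - f x) powr p)"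
  proof (rule integrableI_nonneg)
    show "(\<integral>\<^sup>+x. ennreal (norm (mollify \<epsilon> f x - f x) powr p) \<partial>lborel) < \<infinity>"
      by (rule le_less_trans[OF le]) simp
  qed auto
  then have "Lp lborel p (\<lambda>x. mollify \<epsilon> f x - f x)" by (auto simp: Lp_def)
  from Lp_add[OF p0 this f(1)] show "Lp lborel p (mollify \<epsilon> f)" by simp
  have "ennreal (LINT x|lborel. norm (mollify \<epsilon> f x - f x) powr p) \<le> ennreal \<eta>"
    using le nn_integral_eq_integral[OF i] by simp
  then show "(LINT x|lborel. norm (mollify \<epsilon> f x - f x) powr p) \<le> \<eta>"
    using \<eta> by (simp add: ennreal_le_iff)
qed

lemma mollify_tendsto:
  fixes f :: "'a::euclidean_space \<Rightarrow> 'b::euclidean_space"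
  assumes p: "1 \<le> p" and f: "Lp lborel p f" "integrable lborel f"
  shows "Lp_tendsto lborel p (\<lambda>n. mollify (1 / real (Suc n)) f) f"
proof -
  have p0: "0 \<le> p" using p by simp
  have fm[measurable]: "f \<in> borel_measurable borel" using f(2) by auto
  \<comment> \<open>A bound for every shift, however large: it gives membership for all
    \<open>n\<close>, including those whose kernel radius is not yet small.\<close>
  have tb: "(LINT x|lborel. norm (f (x + z) - f x) powr p) \<le> 2 powr p * (2 *
      (LINT x|lborel. norm (f x) powr p))" for z
  proof -
    have eq: "(LINT x|lborel. norm (f (x + z)) powr p) = (LINT x|lborel. norm (f x) powr p)"
      using lborel_integral_translation(1)[of "\<lambda>x. norm (f x) powr p" z] by simp
    have "(LINT x|lborel. norm (f (x + z) - f x) powr p)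
      \<le> (LINT x|lborel. 2 powr p * (norm (f (x + z)) powr p + norm (f x) powr p))"
    proof (rule integral_mono)
      show "norm (f (x + z) - f x) powr p \<le> 2 powr p * (norm (f (x + z)) powr p
          + norm (f x) powr p)" for x
        using norm_add_powr_le[OF p0, of "f (x + z)" "- f x"] by simp
    qed (use LpD(2)[OF Lp_diff[OF p0 Lp_translation[OF f(1)] f(1)]] LpD(2)[OF Lp_translation[OF
        f(1)]] LpD(2)[OF f(1)] in auto)
    also have "\<dots> = 2 powr p * (2 * (LINT x|lborel. norm (f x) powr p))"
      using eq LpD(2)[OF Lp_translation[OF f(1)]] LpD(2)[OF f(1)] by simp
    finally show ?thesis .
  qed
  have L: "Lp lborel p (mollify (1 / real (Suc n)) f)" for n
    by (rule mollify_Lp_close(1)[OF _ p f tb]) auto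
  have "(\<lambda>n. LINT x|lborel. norm (mollify (1 / real (Suc n)) f x - f x) powr p) \<longlonglongrightarrow> 0"
  proof (rule LIMSEQ_I)
    fix e :: real assume e: "e > 0"
    obtain d where d: "d > 0" "\<And>z. norm z < d \<Longrightarrow> (LINT x|lborel. norm (f (x
        + z) - f x) powr p) < e / 2"
      using Lp_translation_continuous[OF _ f(1), of "e/2"] p e by auto
    obtain N where N: "1 / real (Suc N) < d" using d(1) nat_approx_posE by blast
    show "\<exists>N. \<forall>n\<ge>N. norm ((LINT x|lborel. norm (mollify (1 / real (Suc n)) f x - f x) powr p) - 0) <
        e"
    proof (intro exI[of _ N] allI impI)
      fix n assume n: "n \<ge> N"
      have "1 / real (Suc n) \<le> 1 / real (Suc N)" using n by (intro divide_left_mono) auto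
      then have "(LINT x|lborel. norm (mollify (1 / real (Suc n)) f x - f x) powr p) \<le> e / 2"
        using N e by (intro mollify_Lp_close(2)[OF _ p f] less_imp_le[OF d(2)]) auto
      then show "norm ((LINT x|lborel. norm (mollify (1 / real (Suc n)) f x - f x) powr p) - 0) < e"
        using e by (simp add: abs_of_nonneg)
    qed
  qed
  then show ?thesis using L f by (simp add: Lp_tendsto_def)
qed

subsection \<open>Uniqueness of the weak gradient\<close>

text \<open>The functions in question are only locally integrable; the indicator of a compact
  \<open>K\<close> makes them integrable on the whole space, where mollification takes
  place.\<close>

lemma integral_lebesgue_on_support:
  fixes g :: "'a::euclidean_space \<Rightarrow> 'b::euclidean_space"
  assumes "\<Omega> \<in> sets lebesgue" "K \<subseteq> \<Omega>" "\<And>y. y \<notin> K \<Longrightarrow> \<psi> y = (0::real)"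
  shows "(LINT y|lebesgue_on \<Omega>. \<psi> y *\<^sub>R g y) = (LINT y|lebesgue. \<psi> y *\<^sub>R (indicator K y *\<^sub>R g y))"
proof -
  have eq: "indicator \<Omega> y *\<^sub>R (\<psi> y *\<^sub>R g y) = \<psi> y *\<^sub>R (indicator K y *\<^sub>R g y)" for y
    using assms(2,3) by (cases "y \<in> K") (auto simp: indicator_def)
  show ?thesis
    using integral_restrict_space[of \<Omega> lebesgue "\<lambda>y. \<psi> y *\<^sub>R g y"] assms(1) unfolding eq by simp
qed

lemma C1_gradient_bump_shift:
  "C1_gradient (\<lambda>y. bump \<epsilon> (x - y)) (\<lambda>y. - bump_gradient \<epsilon> (x - y))"
proof -
  have "C1_gradient (\<lambda>y. bump \<epsilon> (y - x)) (\<lambda>y. bump_gradient \<epsilon> (y - x))"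
    unfolding C1_gradient_def gderiv_def
  proof (intro conjI allI)
    show "continuous_on UNIV (\<lambda>y. bump_gradient \<epsilon> (y - x))"
      by (rule continuous_on_compose2[OF continuous_bump_gradient]) (auto intro!: continuous_intros)
    show "((\<lambda>y. bump \<epsilon> (y - x)) has_derivative (\<lambda>h. h \<bullet> bump_gradient \<epsilon> (y - x))) (at y)" for y
      by (rule has_derivative_compose[OF _ C1_gradientD(3)[OF C1_gradient_bump], of "\<lambda>y. y - x"
          "\<lambda>h. h"])
         (auto intro!: derivative_eq_intros)
  qed
  moreover have "bump \<epsilon> (y - x) = bump \<epsilon> (x - y)" for y
    using bump_minus[of \<epsilon> "x - y"] by simp
  moreover have "bump_gradient \<epsilon> (y - x) = - bump_gradient \<epsilon> (x - y)" for y
  proof -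
    have n: "(y - x) \<bullet> (y - x) = (x - y) \<bullet> (x - y)"
      by (simp add: inner_diff inner_commute add.commute)
    show ?thesis unfolding bump_gradient_def n by (simp add: scaleR_diff_right)
  qed
  ultimately show ?thesis by simp
qed

lemma bump_shift_C1_compact_support:
  assumes "0 < \<epsilon>" "cball x \<epsilon> \<subseteq> \<Omega>"
  shows "(\<lambda>y. bump \<epsilon> (x - y)) \<in> C1_compact_support \<Omega>"
proof (rule C1_compact_supportI[OF C1_gradient_bump_shift, of "cball x \<epsilon>"])
  show "bump \<epsilon> (x - y) = 0" if "y \<notin> cball x \<epsilon>" for y
    using that assms by (intro bump_eq_0) (auto simp: dist_norm)
qed (use assms in auto)

lemma locally_integrable_cball:
  assumes "locally_integrable \<Omega> g" "cball x r \<subseteq> \<Omega>"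
  shows "integrable lebesgue (\<lambda>y. indicator (cball x r) y *\<^sub>R g y)"
  using assms by (auto simp: locally_integrable_def set_integrable_def)

lemma integrable_lborel_imp_lebesgue:
  fixes f :: "'a::euclidean_space \<Rightarrow> 'b::euclidean_space"
  assumes "integrable lborel f"
  shows "integrable lebesgue f"
  using assms by (subst integrable_completion) auto

lemma lborel_representative:
  fixes g :: "'a::euclidean_space \<Rightarrow> 'b::euclidean_space"
  assumes "integrable lebesgue g"
  obtains g' where "integrable lborel g'" "AE x in lebesgue. g x = g' x"
proof -
  obtain g' where g': "g' \<in> borel_measurable borel" "AE x in lborel. g x = g' x"
    using lebesgue_measurable_borel_representative[of g] assms by auto
  then have ae: "AE x in lebesgue. g x = g' x" by (simp add: AE_completion_iff)
  have "g' \<in> borel_measurable lebesgue" using g'(1) by (intro measurable_completion) auto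
  then have "integrable lebesgue g'" using integrable_cong_AE_imp[OF assms _ ] ae by blast
  then have "integrable lborel g'" using g'(1) by (simp add: integrable_completion)
  with ae that show thesis by blast
qed

text \<open>For \<open>x\<close> in the smaller ball and \<epsilon> < r, the kernel centred at
  \<open>x\<close> is a test function supported in the larger ball. Testing both gradients with it
  shows that the mollification of their difference vanishes at \<open>x\<close>, and mollifications
  recover the difference almost everywhere along a subsequence.\<close>

lemma weak_gradient_unique_ball:
  assumes op: "open \<Omega>" and w: "is_weak_gradient \<Omega> u g" "is_weak_gradient \<Omega> u g'"
    and r: "r > 0" "cball x0 (2 * r) \<subseteq> \<Omega>"
  shows "AE x in lebesgue. x \<in> ball x0 r \<longrightarrow> g x = g' x"
proof -
  define K where "K = cball x0 (2 * r)"
  have \<Omega>: "\<Omega> \<in> sets lebesgue" using op by (simp add: borel_open)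
  have gi: "integrable lebesgue (\<lambda>y. indicator K y *\<^sub>R g y)"
    and gi': "integrable lebesgue (\<lambda>y. indicator K y *\<^sub>R g' y)"
    using w r(2) locally_integrable_cball unfolding is_weak_gradient_def K_def by blast+
  define h where "h y = indicator K y *\<^sub>R g y - indicator K y *\<^sub>R g' y" for y
  have hi: "integrable lebesgue h" unfolding h_def by (rule Bochner_Integration.integrable_diff[OF
      gi gi'])
  \<comment> \<open>Mollification is set up over \<open>lborel\<close>, so the difference is
    replaced by a Borel representative.\<close>
  obtain h' where h': "integrable lborel h'" "AE x in lebesgue. h x = h' x"
    using lborel_representative[OF hi] by blast
  have zero: "mollify \<epsilon> h' x = 0" if x: "x \<in> ball x0 r" and e: "0 < \<epsilon>" "\<epsilon> < r" for x \<epsilon>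
  proof -
    define c where "c = bump_mass TYPE('a) \<epsilon>"
    have cb: "cball x \<epsilon> \<subseteq> K"
    proof
      fix y assume "y \<in> cball x \<epsilon>"
      then show "y \<in> K" using x e dist_triangle[of x0 y x] unfolding K_def by simp
    qed
    have supp: "bump \<epsilon> (x - y) = 0" if "y \<notin> K" for y
    proof -
      have "y \<notin> cball x \<epsilon>" using that cb by blast
      then show ?thesis using e by (intro bump_eq_0) (auto simp: dist_norm)
    qed
    have cs: "(\<lambda>y. bump \<epsilon> (x - y)) \<in> C1_compact_support \<Omega>"
      by (rule bump_shift_C1_compact_support) (use e cb r(2) in \<open>auto simp: K_def\<close>)
    have eq: "(LINT y|lebesgue_on \<Omega>. bump \<epsilon> (x - y) *\<^sub>R g y) =
        (LINT y|lebesgue_on \<Omega>. bump \<epsilon> (x - y) *\<^sub>R g' y)"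
    proof -
      have "(LINT y|lebesgue_on \<Omega>. u y *\<^sub>R - bump_gradient \<epsilon> (x - y)) = -
          (LINT y|lebesgue_on \<Omega>. bump \<epsilon> (x - y) *\<^sub>R f y)"
        if "is_weak_gradient \<Omega> u f" for f
        using that cs C1_gradient_bump_shift[of \<epsilon> x] unfolding is_weak_gradient_def by blast
      from this[OF w(1)] this[OF w(2)] show ?thesis by simp
    qed
    have bi: "integrable lebesgue (\<lambda>y. bump \<epsilon> (x - y) *\<^sub>R f y)" if "integrable lebesgue f" for f ::
        "'a \<Rightarrow> 'a"
    proof (rule integrable_bounded_mult[OF that])
      show "\<bar>bump \<epsilon> (x - y)\<bar> \<le> (\<epsilon>\<^sup>2)\<^sup>2" for y
        using bump_le[of \<epsilon> "x - y"] bump_nonneg[of \<epsilon> "x - y"] by simp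
      have "(\<lambda>y. bump \<epsilon> (x - y)) \<in> borel_measurable borel" by measurable
      then show "(\<lambda>y. bump \<epsilon> (x - y)) \<in> borel_measurable lebesgue"
          by (intro measurable_completion) auto
    qed
    have K\<Omega>: "K \<subseteq> \<Omega>" using r(2) by (simp add: K_def)
    have "(LINT y|lebesgue. bump \<epsilon> (x - y) *\<^sub>R h y) = (LINT y|lebesgue. bump \<epsilon> (x - y) *\<^sub>R
        (indicator K y *\<^sub>R g y))
        - (LINT y|lebesgue. bump \<epsilon> (x - y) *\<^sub>R (indicator K y *\<^sub>R g' y))"
      unfolding h_def scaleR_diff_right[of "bump _ _"] by (rule Bochner_Integration.integral_diff[OF
          bi[OF gi] bi[OF gi']])
    also have "\<dots> = 0"
      using eq integral_lebesgue_on_support[OF \<Omega> K\<Omega>, of "\<lambda>y. bump \<epsilon> (x - y)" g, OF supp]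
        integral_lebesgue_on_support[OF \<Omega> K\<Omega>, of "\<lambda>y. bump \<epsilon> (x - y)" g', OF supp] by simp
    finally have "(LINT y|lebesgue. bump \<epsilon> (x - y) *\<^sub>R h y) = 0" .
    moreover have "(LINT y|lebesgue. bump \<epsilon> (x - y) *\<^sub>R h y) =
        (LINT y|lebesgue. bump \<epsilon> (x - y) *\<^sub>R h' y)"
    proof (rule integral_cong_AE)
      show "(\<lambda>y. bump \<epsilon> (x - y) *\<^sub>R h' y) \<in> borel_measurable lebesgue"
        by (rule borel_measurable_integrable[OF bi[OF integrable_lborel_imp_lebesgue[OF h'(1)]]])
      show "(\<lambda>y. bump \<epsilon> (x - y) *\<^sub>R h y) \<in> borel_measurable lebesgue"
        by (rule borel_measurable_integrable[OF bi[OF hi]])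
      show "AE y in lebesgue. bump \<epsilon> (x - y) *\<^sub>R h y = bump \<epsilon> (x - y) *\<^sub>R h' y"
        using h'(2) by eventually_elim simp
    qed
    moreover have "(LINT y|lebesgue. bump \<epsilon> (x - y) *\<^sub>R h' y) =
        (LINT y|lborel. bump \<epsilon> (x - y) *\<^sub>R h' y)"
    proof (rule integral_completion)
      have [measurable]: "h' \<in> borel_measurable borel" using h'(1) by auto
      show "(\<lambda>y. bump \<epsilon> (x - y) *\<^sub>R h' y) \<in> lborel \<rightarrow>\<^sub>M borel" by measurable
    qed
    ultimately have "(LINT y|lborel. bump \<epsilon> (x - y) *\<^sub>R h' y) = 0" by simp
    moreover have "mollify \<epsilon> h' x = (1 / c) *\<^sub>R (LINT y|lborel. bump \<epsilon> (x - y) *\<^sub>R h' y)"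
      by (subst integral_scaleR_right[symmetric]) (simp_all add: mollify_def c_def)
    ultimately show ?thesis by simp
  qed
  \<comment> \<open>Weak gradients are only locally integrable, so the convergence theorem is
    applied with exponent 1.\<close>
  have "Lp lborel 1 h'" using h'(1) by (auto simp: Lp_def)
  note conv = mollify_tendsto[OF order_refl this h'(1)]
  obtain s where s: "strict_mono s" and ae: "AE x in lborel. (\<lambda>n. mollify (1 / real (Suc (s n))) h'
      x) \<longlonglongrightarrow> h' x"
    by (rule Lp_tendsto_AE_subseq[OF zero_less_one conv])
  have "AE x in lborel. x \<in> ball x0 r \<longrightarrow> h' x = 0"
    using ae
  proof eventually_elim
    case (elim x)
    show ?case
    proof
      assume x: "x \<in> ball x0 r"
      obtain N where N: "1 / real (Suc N) < r" using r(1) nat_approx_posE by blast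
      have "\<forall>\<^sub>F n in sequentially. mollify (1 / real (Suc (s n))) h' x = 0"
        unfolding eventually_sequentially
      proof (intro exI[of _ N] allI impI)
        fix n assume "n \<ge> N"
        then have "s n \<ge> N" using seq_suble[OF s, of n] by simp
        then have "1 / real (Suc (s n)) \<le> 1 / real (Suc N)" by (intro divide_left_mono) auto
        then show "mollify (1 / real (Suc (s n))) h' x = 0" using N by (intro zero[OF x]) auto
      qed
      then have "(\<lambda>n. mollify (1 / real (Suc (s n))) h' x) \<longlonglongrightarrow> 0" by (rule tendsto_eventually)
      then show "h' x = 0" by (rule LIMSEQ_unique[OF elim])
    qed
  qed
  then have "AE x in lebesgue. x \<in> ball x0 r \<longrightarrow> h' x = 0" by (simp add: AE_completion_iff)
  with h'(2) show ?thesis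
  proof eventually_elim
    case (elim x)
    show ?case
    proof
      assume x: "x \<in> ball x0 r"
      then have "x \<in> K" using r(1) by (auto simp: K_def)
      then show "g x = g' x" using elim x by (simp add: h_def)
    qed
  qed
qed

text \<open>\<open>locally_negligible_alt\<close> passes from small balls to \<Omega>, in place of
  an explicit countable cover.\<close>

lemma weak_gradient_unique:
  assumes op: "open \<Omega>" and w: "is_weak_gradient \<Omega> u g" "is_weak_gradient \<Omega> u g'"
  shows "AE x in lebesgue_on \<Omega>. g x = g' x"
proof -
  define S where "S = {x \<in> \<Omega>. g x \<noteq> g' x}"
  have "negligible S"
  proof (rule locally_negligible_alt[THEN iffD2], rule ballI)
    fix x assume x: "x \<in> S"
    then have "x \<in> \<Omega>" by (simp add: S_def)
    then obtain e where e: "e > 0" "cball x e \<subseteq> \<Omega>" using op unfolding open_contains_cball by blast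
    have "AE y in lebesgue. y \<in> ball x (e/2) \<longrightarrow> g y = g' y"
      by (rule weak_gradient_unique_ball[OF op w]) (use e in auto)
    then obtain N where "negligible N" "{y. \<not> (y \<in> ball x (e/2) \<longrightarrow> g y = g' y)} \<subseteq> N"
      unfolding eventually_ae_filter_negligible by blast
    moreover have "S \<inter> ball x (e/2) \<subseteq> {y. \<not> (y \<in> ball x (e/2) \<longrightarrow> g y = g' y)}"
      unfolding S_def by blast
    ultimately have "negligible (S \<inter> ball x (e/2))"
      using negligible_subset[of N "S \<inter> ball x (e/2)"] by (meson order_trans)
    then show "\<exists>U. openin (top_of_set S) U \<and> x \<in> U \<and> negligible U"
      using x e by (intro exI[of _ "S \<inter> ball x (e/2)"]) (auto intro: openin_open_Int)
  qed
  then have "AE x in lebesgue. x \<notin> S" by (intro AE_not_in) (simp add: negligible_iff_null_sets)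
  then show ?thesis using op by (subst AE_restrict_space_iff) (auto simp: S_def borel_open)
qed

text \<open>Frees later arguments from the choice made by \<open>SOME\<close>: any weak gradient at
  hand may take its place almost everywhere.\<close>

lemma weak_gradient_AE_eq:
  assumes "open \<Omega>" "is_weak_gradient \<Omega> u g"
  shows "AE x in lebesgue_on \<Omega>. weak_gradient \<Omega> u x = g x"
proof (rule weak_gradient_unique[OF assms(1) _ assms(2)])
  show "is_weak_gradient \<Omega> u (weak_gradient \<Omega> u)"
    unfolding weak_gradient_def by (rule someI[of "is_weak_gradient \<Omega> u", OF assms(2)])
qed

subsection \<open>Strong approximation by \<open>C\<^sup>1\<close> functions\<close>

lemma Lp_tendsto_Lipschitz:
  assumes p: "0 \<le> p" and F: "Lp_tendsto M p F f"
    and H: "\<And>n. H n \<in> borel_measurable M" "Lp M p h"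
    and le: "\<And>n x. x \<in> space M \<Longrightarrow> norm (H n x - h x) \<le> C * norm (F n x - f x)"
  shows "Lp_tendsto M p H h"
proof (rule Lp_tendsto_trans_diff[OF p Lp_tendsto_const[OF H(2)]])
  note FD = Lp_tendstoD[OF F]
  note i = LpD(2)[OF Lp_diff[OF p FD(1) FD(2)]]
  have hm: "h \<in> borel_measurable M" by (rule LpD(1)[OF H(2)])
  have d: "Lp M p (\<lambda>x. H n x - h x)" for n
    by (rule Lp_mono[OF p Lp_diff[OF p FD(1)[of n] FD(2)], where C = C]) (use H hm le in auto)
  show "Lp M p (H n)" for n using Lp_add[OF p d[of n] H(2)] by simp
  show "(\<lambda>n. LINT x|M. norm (H n x - h x) powr p) \<longlonglongrightarrow> 0"
  proof (rule tendsto_sandwich[OF _ _ tendsto_const])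
    show "(\<lambda>n. \<bar>C\<bar> powr p * (LINT x|M. norm (F n x - f x) powr p)) \<longlonglongrightarrow> 0"
      using tendsto_mult_right_zero[OF FD(3)] by blast
    show "\<forall>\<^sub>F n in sequentially. (LINT x|M. norm (H n x - h x) powr p) \<le> \<bar>C\<bar> powr p *
        (LINT x|M. norm (F n x - f x) powr p)"
    proof (intro always_eventually allI)
      fix n
      have "(LINT x|M. norm (H n x - h x) powr p) \<le> (LINT x|M. \<bar>C\<bar> powr p * norm (F n x - f x) powr
          p)"
      proof (rule integral_mono)
        fix x assume x: "x \<in> space M"
        have "norm (H n x - h x) \<le> \<bar>C\<bar> * norm (F n x - f x)"
          using le[OF x, of n] mult_right_mono[OF abs_ge_self[of C], of "norm (F n x - f x)"]
              by simp
        then have "norm (H n x - h x) powr p \<le> (\<bar>C\<bar> * norm (F n x - f x)) powr p"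
          using p by (intro powr_mono2) auto
        then show "norm (H n x - h x) powr p \<le> \<bar>C\<bar> powr p * norm (F n x - f x) powr p"
          by (simp add: powr_mult)
      qed (use i LpD(2)[OF d] in auto)
      then show "(LINT x|M. norm (H n x - h x) powr p) \<le> \<bar>C\<bar> powr p *
          (LINT x|M. norm (F n x - f x) powr p)"
        by simp
    qed
  qed auto
qed

text \<open>A C1 approximation of the positive part that is exactly 0 on the nonpositive half-line,
  so that composition with it creates no new support. It is 1-Lipschitz and within \<delta> of
  \<open>max 0 s\<close>.\<close>

definition smooth_pos :: "real \<Rightarrow> real \<Rightarrow> real" where
  "smooth_pos \<delta> s = sqrt ((max 0 s)\<^sup>2 + \<delta>\<^sup>2) - \<delta>"

definition smooth_pos_deriv :: "real \<Rightarrow> real \<Rightarrow> real" where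
  "smooth_pos_deriv \<delta> s = max 0 s / sqrt ((max 0 s)\<^sup>2 + \<delta>\<^sup>2)"

lemma smooth_pos_root_pos: "\<delta> > 0 \<Longrightarrow> sqrt ((max 0 s)\<^sup>2 + \<delta>\<^sup>2) > 0"
  by (simp add: add_nonneg_pos)

lemma has_real_derivative_smooth_pos:
  assumes "\<delta> > 0"
  shows "(smooth_pos \<delta> has_real_derivative smooth_pos_deriv \<delta> s) (at s)"
proof -
  have "((\<lambda>s. (max 0 s)\<^sup>2 + \<delta>\<^sup>2) has_real_derivative 2 * max 0 s) (at s)"
    using DERIV_add[OF has_real_derivative_pos_part_squared DERIV_const[of "\<delta>\<^sup>2"]] by simp
  from DERIV_diff[OF DERIV_chain2[OF DERIV_real_sqrt this] DERIV_const, of \<delta>]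
  have "((\<lambda>s. sqrt ((max 0 s)\<^sup>2 + \<delta>\<^sup>2) - \<delta>) has_real_derivative
      inverse (sqrt ((max 0 s)\<^sup>2 + \<delta>\<^sup>2)) / 2 * (2 * max 0 s) - 0) (at s)"
    using smooth_pos_root_pos[OF assms, of s] by simp
  moreover have "inverse r / 2 * (2 * m) - 0 = m / r" for r m :: real
      by (simp add: inverse_eq_divide)
  ultimately show ?thesis by (simp only: smooth_pos_def[abs_def] smooth_pos_deriv_def)
qed

lemma continuous_smooth_pos_deriv:
  assumes "\<delta> > 0"
  shows "continuous_on UNIV (smooth_pos_deriv \<delta>)"
proof -
  have "sqrt ((max 0 s)\<^sup>2 + \<delta>\<^sup>2) \<noteq> 0" for s
    using smooth_pos_root_pos[OF assms, of s] by linarith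
  then show ?thesis unfolding smooth_pos_deriv_def[abs_def] by (intro continuous_intros ballI)
qed

lemma smooth_pos_deriv_bounds:
  assumes "\<delta> > 0"
  shows "0 \<le> smooth_pos_deriv \<delta> s" "smooth_pos_deriv \<delta> s \<le> 1"
proof -
  have "max 0 s \<le> sqrt ((max 0 s)\<^sup>2 + \<delta>\<^sup>2)" by (rule real_le_rsqrt) simp
  then show "smooth_pos_deriv \<delta> s \<le> 1"
    using smooth_pos_root_pos[OF assms, of s] by (simp add: smooth_pos_deriv_def)
  show "0 \<le> smooth_pos_deriv \<delta> s" by (simp add: smooth_pos_deriv_def)
qed

lemma smooth_pos_nonpos: "\<delta> > 0 \<Longrightarrow> s \<le> 0 \<Longrightarrow> smooth_pos \<delta> s = 0"
  "s \<le> 0 \<Longrightarrow> smooth_pos_deriv \<delta> s = 0"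
  by (simp_all add: smooth_pos_def smooth_pos_deriv_def max_def)

lemma smooth_pos_Lipschitz:
  assumes "\<delta> > 0"
  shows "\<bar>smooth_pos \<delta> s - smooth_pos \<delta> t\<bar> \<le> \<bar>s - t\<bar>"
proof -
  have "norm (smooth_pos \<delta> s - smooth_pos \<delta> t) \<le> 1 * norm (s - t)"
    by (rule field_differentiable_bound[of UNIV _ "smooth_pos_deriv \<delta>"])
       (use has_real_derivative_smooth_pos[OF assms] smooth_pos_deriv_bounds[OF assms] in auto)
  then show ?thesis by simp
qed

lemma smooth_pos_close:
  assumes "\<delta> > 0"
  shows "\<bar>smooth_pos \<delta> s - max 0 s\<bar> \<le> \<delta>"
proof -
  have "max 0 s \<le> sqrt ((max 0 s)\<^sup>2 + \<delta>\<^sup>2)" by (rule real_le_rsqrt) simp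
  moreover have "sqrt ((max 0 s)\<^sup>2 + \<delta>\<^sup>2) \<le> max 0 s + \<delta>"
    using assms by (intro real_le_lsqrt) (auto simp: power2_sum)
  ultimately show ?thesis by (simp add: smooth_pos_def abs_le_iff)
qed

lemma smooth_pos_abs_le: "\<delta> > 0 \<Longrightarrow> \<bar>smooth_pos \<delta> s\<bar> \<le> \<bar>s\<bar>"
  using smooth_pos_Lipschitz[of \<delta> s 0] smooth_pos_nonpos(1)[of \<delta> 0] by simp

text \<open>At \<open>s = 0\<close> the behaviour would depend on how fast \<open>X n\<close> tends
  to 0 compared with \<open>d n\<close>, so only positive limits are covered.\<close>

lemma smooth_pos_deriv_tendsto:
  assumes X: "X \<longlonglongrightarrow> (s::real)" and d: "d \<longlonglongrightarrow> 0" and s: "s > 0"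
  shows "(\<lambda>n. smooth_pos_deriv (d n) (X n)) \<longlonglongrightarrow> 1"
proof -
  have "(\<lambda>n. smooth_pos_deriv (d n) (X n)) \<longlonglongrightarrow> max 0 s / sqrt ((max 0 s)\<^sup>2 + 0\<^sup>2)"
    unfolding smooth_pos_deriv_def by (intro tendsto_intros X d) (use s in auto)
  then show ?thesis using s by simp
qed

lemma C1_gradient_smooth_pos:
  assumes "\<delta> > 0" "C1_gradient f g"
  shows "C1_gradient (\<lambda>x. smooth_pos \<delta> (f x)) (\<lambda>x. smooth_pos_deriv \<delta> (f x) *\<^sub>R g x)"
  by (rule C1_gradient_compose[OF assms(2) has_real_derivative_smooth_pos[OF assms(1)]
      continuous_smooth_pos_deriv[OF assms(1)]])

text \<open>Encodes a Sobolev function with its gradient as a limit of C1 functions on the whole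
  space. The gradients are arguments, so no choice of a weak gradient enters; calculus rules are
  proved for the approximations and passed to the limit.\<close>

definition W_tendsto :: "'a::euclidean_space set \<Rightarrow> real \<Rightarrow> (nat \<Rightarrow> 'a \<Rightarrow> real) \<Rightarrow> (nat \<Rightarrow> 'a \<Rightarrow> 'a) \<Rightarrow> ('a
    \<Rightarrow> real) \<Rightarrow> ('a \<Rightarrow> 'a) \<Rightarrow> bool" where
  "W_tendsto \<Omega> p F dF f g \<longleftrightarrow> (\<forall>n. C1_gradient (F n) (dF n)) \<and>
     Lp_tendsto (lebesgue_on \<Omega>) p F f \<and> Lp_tendsto (lebesgue_on \<Omega>) p dF g"

lemma W_tendstoD:
  assumes "W_tendsto \<Omega> p F dF f g"
  shows "C1_gradient (F n) (dF n)" "Lp_tendsto (lebesgue_on \<Omega>) p F f" "Lp_tendsto (lebesgue_on \<Omega>) p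
      dF g"
    "Lp (lebesgue_on \<Omega>) p f" "Lp (lebesgue_on \<Omega>) p g" "f \<in> borel_measurable (lebesgue_on \<Omega>)"
    "g \<in> borel_measurable (lebesgue_on \<Omega>)"
  using assms Lp_tendstoD(2) LpD(1) unfolding W_tendsto_def by blast+

lemma W_tendsto_add:
  assumes "0 \<le> p" "W_tendsto \<Omega> p F dF f g" "W_tendsto \<Omega> p F' dF' f' g'"
  shows "W_tendsto \<Omega> p (\<lambda>n x. F n x + F' n x) (\<lambda>n x. dF n x + dF' n x) (\<lambda>x. f x + f' x) (\<lambda>x. g x
      + g' x)"
  using assms unfolding W_tendsto_def by (auto intro!: C1_gradient_add Lp_tendsto_add)

lemma W_tendsto_uminus:
  assumes "W_tendsto \<Omega> p F dF f g"
  shows "W_tendsto \<Omega> p (\<lambda>n x. - F n x) (\<lambda>n x. - dF n x) (\<lambda>x. - f x) (\<lambda>x. - g x)"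
  using assms unfolding W_tendsto_def by (auto intro!: C1_gradient_uminus Lp_tendsto_uminus)

lemma W_tendsto_diff:
  assumes "0 \<le> p" "W_tendsto \<Omega> p F dF f g" "W_tendsto \<Omega> p F' dF' f' g'"
  shows "W_tendsto \<Omega> p (\<lambda>n x. F n x - F' n x) (\<lambda>n x. dF n x - dF' n x) (\<lambda>x. f x - f' x) (\<lambda>x. g x -
      g' x)"
  using W_tendsto_add[OF assms(1,2) W_tendsto_uminus[OF assms(3)]] by simp

section \<open>Sobolev calculus on a bounded open set\<close>

locale bounded_domain =
  fixes \<Omega> :: "'a::euclidean_space set" and p :: real
  assumes open_domain: "open \<Omega>" and bounded_domain: "bounded \<Omega>" and p_ge_1: "1 \<le> p"
begin

lemma p_pos: "0 < p" and p_nonneg: "0 \<le> p"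
  using p_ge_1 by auto

lemma domain_lebesgue: "\<Omega> \<in> sets lebesgue"
  using open_domain by (simp add: borel_open)

lemma space_domain: "space (lebesgue_on \<Omega>) = \<Omega>"
  by simp

sublocale finite_measure "lebesgue_on \<Omega>"
  by (rule finite_measure_lebesgue_on) (simp add: bounded_set_imp_lmeasurable bounded_domain
      domain_lebesgue)

lemma measurable_lebesgue_on_continuous:
  assumes "continuous_on UNIV (f :: 'a \<Rightarrow> 'b::euclidean_space)"
  shows "f \<in> borel_measurable (lebesgue_on \<Omega>)"
  using assms domain_lebesgue by (intro continuous_imp_measurable_on_sets_lebesgue) (auto intro:
      continuous_on_subset)

lemma Lp_continuous:
  assumes c: "continuous_on UNIV (f :: 'a \<Rightarrow> 'b::euclidean_space)"
  shows "Lp (lebesgue_on \<Omega>) p f"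
proof -
  have "compact (f ` closure \<Omega>)"
    using bounded_domain c by (intro compact_continuous_image) (auto intro: continuous_on_subset)
  then obtain C where C: "\<forall>y\<in>f ` closure \<Omega>. norm y \<le> C" using compact_imp_bounded bounded_iff
      by blast
  show ?thesis
  proof (rule Lp_bounded[OF p_nonneg measurable_lebesgue_on_continuous[OF c], of C])
    show "AE x in lebesgue_on \<Omega>. norm (f x) \<le> C"
      using C closure_subset[of \<Omega>] by (intro AE_I2) auto
  qed
qed

lemma W_tendsto_const:
  assumes "C1_gradient f g"
  shows "W_tendsto \<Omega> p (\<lambda>_. f) (\<lambda>_. g) f g"
  using assms C1_gradientD[OF assms] by (auto simp: W_tendsto_def intro!: Lp_tendsto_const
      Lp_continuous)

lemma Lp_imp_locally_integrable:
  assumes "Lp (lebesgue_on \<Omega>) p f"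
  shows "locally_integrable \<Omega> f"
  unfolding locally_integrable_def
proof (intro allI impI)
  fix K assume K: "compact K \<and> K \<subseteq> \<Omega>"
  have "integrable (lebesgue_on \<Omega>) f" by (rule Lp_integrable[OF p_ge_1 assms])
  then have "set_integrable lebesgue \<Omega> f"
    using domain_lebesgue by (subst (asm) integrable_restrict_space) (auto simp: set_integrable_def)
  then show "f absolutely_integrable_on K"
    by (rule set_integrable_subset) (use K in \<open>auto simp: compact_imp_closed borel_closed\<close>)
qed

lemma integral_compact_support_gradient:
  assumes "\<psi> \<in> C1_compact_support \<Omega>" "C1_gradient \<psi> d\<psi>"
  shows "(LINT x|lebesgue_on \<Omega>. d\<psi> x) = 0"
proof -
  obtain K where K: "compact K" "K \<subseteq> \<Omega>" "\<forall>x. x \<notin> K \<longrightarrow> \<psi> x = 0 \<and> d\<psi> x = 0"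
    by (rule C1_compact_supportE[OF assms])
  have eq: "indicator \<Omega> x *\<^sub>R d\<psi> x = d\<psi> x" for x
    using K(2,3) by (cases "x \<in> \<Omega>") auto
  have "(LINT x|lebesgue_on \<Omega>. d\<psi> x) = (LINT x|lebesgue. d\<psi> x)"
    using integral_restrict_space[of \<Omega> lebesgue d\<psi>] domain_lebesgue unfolding eq by simp
  also have "\<dots> = (LINT x|lborel. d\<psi> x)"
    by (rule integral_completion) (use borel_measurable_continuous_onI[OF C1_gradientD(1)[OF
        assms(2)]] in simp)
  also have "\<dots> = 0" by (rule C1_compact_support_integral_gradient[OF assms])
  finally show ?thesis .
qed

lemma C1_compact_support_mult:
  assumes "\<psi> \<in> C1_compact_support \<Omega>" "C1_gradient F dF"
  shows "(\<lambda>x. F x * \<psi> x) \<in> C1_compact_support \<Omega>"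
proof -
  obtain d\<psi> where d: "C1_gradient \<psi> d\<psi>" using assms(1) by (auto simp: C1_compact_support_def)
  obtain K where K: "compact K" "K \<subseteq> \<Omega>" "\<forall>x. x \<notin> K \<longrightarrow> \<psi> x = 0 \<and> d\<psi> x = 0"
    by (rule C1_compact_supportE[OF assms(1) d])
  show ?thesis
    by (rule C1_compact_supportI[OF C1_gradient_mult[OF assms(2) d] K(1,2)]) (use K(3) in simp)
qed

text \<open>The product of \<open>F\<close> and \<psi> is C1 with compact support, so the integral
  of its gradient is 0.\<close>

lemma integration_by_parts_C1:
  assumes psi: "\<psi> \<in> C1_compact_support \<Omega>" "C1_gradient \<psi> d\<psi>" and F: "C1_gradient F dF"
  shows "(LINT x|lebesgue_on \<Omega>. F x *\<^sub>R d\<psi> x) = - (LINT x|lebesgue_on \<Omega>. \<psi> x *\<^sub>R dF x)"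
proof -
  note c = C1_gradientD[OF F] C1_gradientD[OF psi(2)]
  have "integrable (lebesgue_on \<Omega>) (\<lambda>x. F x *\<^sub>R d\<psi> x)" "integrable (lebesgue_on \<Omega>) (\<lambda>x. \<psi> x *\<^sub>R dF
      x)"
    by (intro Lp_integrable[OF p_ge_1] Lp_continuous continuous_on_scaleR c)+
  then have "(LINT x|lebesgue_on \<Omega>. F x *\<^sub>R d\<psi> x) + (LINT x|lebesgue_on \<Omega>. \<psi> x *\<^sub>R dF x)
     = (LINT x|lebesgue_on \<Omega>. F x *\<^sub>R d\<psi> x + \<psi> x *\<^sub>R dF x)" by simp
  also have "\<dots> = 0"
    by (rule integral_compact_support_gradient[OF C1_compact_support_mult[OF psi(1) F]
        C1_gradient_mult[OF F psi(2)]])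
  finally show ?thesis by (simp add: eq_neg_iff_add_eq_0)
qed

lemma compact_support_bounded:
  assumes "\<psi> \<in> C1_compact_support \<Omega>" "C1_gradient \<psi> d\<psi>"
  obtains C where "\<forall>x. norm (\<psi> x) \<le> C" "\<forall>x. norm (d\<psi> x) \<le> C"
proof -
  obtain K where K: "compact K" "K \<subseteq> \<Omega>" "\<forall>x. x \<notin> K \<longrightarrow> \<psi> x = 0 \<and> d\<psi> x = 0"
    by (rule C1_compact_supportE[OF assms])
  have K0: "\<psi> x = 0" "d\<psi> x = 0" if "x \<notin> K" for x using that K(3) by auto
  obtain C where C: "C > 0" "\<And>x. norm (\<psi> x) \<le> C"
    using continuous_compact_support_bounded[OF C1_gradientD(4)[OF assms(2)] K(1) K0(1)] by metis
  obtain D where D: "D > 0" "\<And>x. norm (d\<psi> x) \<le> D"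
    using continuous_compact_support_bounded[OF C1_gradientD(1)[OF assms(2)] K(1) K0(2)] by metis
  show thesis by (rule that[of "max C D"]) (use C(2) D(2) in \<open>auto simp: le_max_iff_disj\<close>)
qed

lemma Lp_tendsto_scaleR_const:
  assumes F: "Lp_tendsto (lebesgue_on \<Omega>) p F (f :: 'a \<Rightarrow> real)" and D: "continuous_on UNIV D"
      "\<And>x. norm (D x :: 'a) \<le> C"
  shows "Lp_tendsto (lebesgue_on \<Omega>) p (\<lambda>n x. F n x *\<^sub>R D x) (\<lambda>x. f x *\<^sub>R D x)"
proof (rule Lp_tendsto_Lipschitz[OF p_nonneg F, where C = C])
  note FD = Lp_tendstoD[OF F]
  note m = measurable_lebesgue_on_continuous[OF D(1)]
  show "(\<lambda>x. F n x *\<^sub>R D x) \<in> borel_measurable (lebesgue_on \<Omega>)" for n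
    using LpD(1)[OF FD(1)] m by simp
  have le: "norm (a *\<^sub>R D x) \<le> C * norm a" for a :: real and x
    using mult_left_mono[OF D(2)[of x], of "\<bar>a\<bar>"] by (simp add: mult.commute)
  show "Lp (lebesgue_on \<Omega>) p (\<lambda>x. f x *\<^sub>R D x)"
    by (rule Lp_mono[OF p_nonneg FD(2), where C = C]) (use LpD(1)[OF FD(2)] m le in auto)
  show "norm (F n x *\<^sub>R D x - f x *\<^sub>R D x) \<le> C * norm (F n x - f x)" for n x
    unfolding scaleR_diff_left[symmetric] by (rule le)
qed

text \<open>Both sides of integration by parts for \<open>F n\<close> pass to the limit, because the
  test function and its gradient are bounded and \<Omega> has finite measure.\<close>

lemma W_tendsto_imp_weak_gradient:
  assumes W: "W_tendsto \<Omega> p F dF f g"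
  shows "is_weak_gradient \<Omega> f g"
  unfolding is_weak_gradient_def
proof (intro conjI allI impI)
  note WD = W_tendstoD[OF W]
  show "locally_integrable \<Omega> f" "locally_integrable \<Omega> g"
    by (intro Lp_imp_locally_integrable WD)+
  fix \<psi> d\<psi> assume psi: "\<psi> \<in> C1_compact_support \<Omega> \<and> C1_gradient \<psi> d\<psi>"
  obtain C where "\<forall>x. norm (\<psi> x) \<le> C" "\<forall>x. norm (d\<psi> x) \<le> C"
    by (rule compact_support_bounded[OF conjunct1[OF psi] conjunct2[OF psi]])
  then have C: "\<And>x. norm (\<psi> x) \<le> C" "\<And>x. norm (d\<psi> x) \<le> C" by simp_all
  have c: "continuous_on UNIV \<psi>" "continuous_on UNIV d\<psi>"
    using C1_gradientD(1,4)[OF conjunct2[OF psi]] by simp_all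
  have "(\<lambda>n. LINT x|lebesgue_on \<Omega>. F n x *\<^sub>R d\<psi> x) \<longlonglongrightarrow> (LINT x|lebesgue_on \<Omega>. f x *\<^sub>R d\<psi> x)"
    by (rule Lp_tendsto_integral[OF p_ge_1 Lp_tendsto_scaleR_const[OF WD(2) c(2) C(2)]])
  moreover have "(\<lambda>n. - (LINT x|lebesgue_on \<Omega>. \<psi> x *\<^sub>R dF n x)) \<longlonglongrightarrow> -
      (LINT x|lebesgue_on \<Omega>. \<psi> x *\<^sub>R g x)"
    by (intro tendsto_minus Lp_tendsto_integral[OF p_ge_1] Lp_tendsto_scaleR[OF p_pos WD(3), where C
        = C])
       (use C(1) measurable_lebesgue_on_continuous[OF c(1)] in auto)
  moreover have "(LINT x|lebesgue_on \<Omega>. F n x *\<^sub>R d\<psi> x) = -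
      (LINT x|lebesgue_on \<Omega>. \<psi> x *\<^sub>R dF n x)" for n
    by (rule integration_by_parts_C1[OF conjunct1[OF psi] conjunct2[OF psi] WD(1)])
  ultimately show "(LINT x|lebesgue_on \<Omega>. f x *\<^sub>R d\<psi> x) = - (LINT x|lebesgue_on \<Omega>. \<psi> x *\<^sub>R g x)"
    using LIMSEQ_unique by simp
qed

text \<open>Formulated for arbitrary weak gradients: it is applied to elements of
  \<open>sobolev0\<close> before their approximation by \<open>W_tendsto\<close> is
  established.\<close>

lemma is_weak_gradient_diff:
  assumes w: "is_weak_gradient \<Omega> u g" "is_weak_gradient \<Omega> u' g'"
    and L: "Lp (lebesgue_on \<Omega>) p u" "Lp (lebesgue_on \<Omega>) p g" "Lp (lebesgue_on \<Omega>) p u'" "Lp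
        (lebesgue_on \<Omega>) p g'"
  shows "is_weak_gradient \<Omega> (\<lambda>x. u x - u' x) (\<lambda>x. g x - g' x)"
  unfolding is_weak_gradient_def
proof (intro conjI allI impI)
  show "locally_integrable \<Omega> (\<lambda>x. u x - u' x)" "locally_integrable \<Omega> (\<lambda>x. g x - g' x)"
    by (intro Lp_imp_locally_integrable Lp_diff p_nonneg L)+
  fix \<psi> d\<psi> assume psi: "\<psi> \<in> C1_compact_support \<Omega> \<and> C1_gradient \<psi> d\<psi>"
  obtain C where "\<forall>x. norm (\<psi> x) \<le> C" "\<forall>x. norm (d\<psi> x) \<le> C"
    by (rule compact_support_bounded[OF conjunct1[OF psi] conjunct2[OF psi]])
  then have C: "\<And>x. norm (\<psi> x) \<le> C" "\<And>x. norm (d\<psi> x) \<le> C" by simp_all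
  have c: "continuous_on UNIV \<psi>" "continuous_on UNIV d\<psi>"
    using C1_gradientD(1,4)[OF conjunct2[OF psi]] by simp_all
  have i1: "integrable (lebesgue_on \<Omega>) (\<lambda>x. v x *\<^sub>R d\<psi> x)" if "Lp (lebesgue_on \<Omega>) p v" for v
    using Lp_integrable[OF p_ge_1 Lp_tendstoD(2)[OF Lp_tendsto_scaleR_const[OF Lp_tendsto_const[OF
        that] c(2) C(2)]]] .
  have i2: "integrable (lebesgue_on \<Omega>) (\<lambda>x. \<psi> x *\<^sub>R v x)" if "Lp (lebesgue_on \<Omega>) p v" for v :: "'a \<Rightarrow>
      'a"
    by (rule integrable_bounded_mult[OF Lp_integrable[OF p_ge_1 that], where C = C])
       (use C(1) measurable_lebesgue_on_continuous[OF c(1)] in auto)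
  have "(LINT x|lebesgue_on \<Omega>. u x *\<^sub>R d\<psi> x) = - (LINT x|lebesgue_on \<Omega>. \<psi> x *\<^sub>R g x)"
    "(LINT x|lebesgue_on \<Omega>. u' x *\<^sub>R d\<psi> x) = - (LINT x|lebesgue_on \<Omega>. \<psi> x *\<^sub>R g' x)"
    using w psi unfolding is_weak_gradient_def by blast+
  then show "(LINT x|lebesgue_on \<Omega>. (u x - u' x) *\<^sub>R d\<psi> x) = -
      (LINT x|lebesgue_on \<Omega>. \<psi> x *\<^sub>R (g x - g' x))"
    using i1[OF L(1)] i1[OF L(3)] i2[OF L(2)] i2[OF L(4)]
        by (simp add: scaleR_diff_left scaleR_diff_right)
qed

text \<open>A diagonal choice: for a fixed smoothing parameter \<open>d k\<close> the compositions
  with \<open>F n\<close> converge along a subsequence, and \<open>n k\<close> makes the error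
  smaller than \<open>d k\<close>; then \<open>d k\<close> tends to 0. Since
  \<open>smooth_pos_deriv\<close> vanishes at 0, the limit gradient is 0 wherever \<open>f\<close>
  is 0. The approximations are displayed in the conclusion because their supports are read off from
  this form.\<close>

lemma W_tendsto_pos_part:
  assumes W: "W_tendsto \<Omega> p F dF f g"
  obtains n d where "\<And>k::nat. n k \<ge> (k::nat)" "\<And>k. d k > 0"
    "W_tendsto \<Omega> p (\<lambda>k x. smooth_pos (d k) (F (n k) x)) (\<lambda>k x. smooth_pos_deriv (d k) (F (n k) x)
        *\<^sub>R dF (n k) x)
      (\<lambda>x. max 0 (f x)) (\<lambda>x. (if f x > 0 then 1 else 0) *\<^sub>R g x)"
proof -
  let ?M = "lebesgue_on \<Omega>"
  note WD = W_tendstoD[OF W]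
  define d where "d k = 1 / real (Suc k)" for k
  have d: "d k > 0" for k by (simp add: d_def)
  have d0: "d \<longlonglongrightarrow> 0" unfolding d_def[abs_def] by (rule LIMSEQ_Suc[OF lim_const_over_n])
  have sm: "smooth_pos (d k) \<in> borel_measurable borel" "smooth_pos_deriv (d k) \<in> borel_measurable
      borel" for k
    unfolding smooth_pos_def[abs_def] smooth_pos_deriv_def[abs_def] by measurable
  have fm: "F n \<in> borel_measurable ?M" "dF n \<in> borel_measurable ?M" for n
    using Lp_tendstoD(1)[OF WD(2)] Lp_tendstoD(1)[OF WD(3)] LpD(1) by blast+
  have [measurable]: "f \<in> borel_measurable ?M" "g \<in> borel_measurable ?M" by (rule WD)+
  have Ls: "Lp ?M p (\<lambda>x. smooth_pos (d k) (f x))" for k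
    by (rule Lp_mono[OF p_nonneg WD(4), where C = 1])
       (use measurable_compose[OF WD(6) sm(1)] smooth_pos_abs_le[OF d] in auto)
  have db: "\<bar>smooth_pos_deriv (d k) s\<bar> \<le> 1" for k s using smooth_pos_deriv_bounds[OF d, of k s]
      by simp
  \<comment> \<open>Almost everywhere convergence is needed for the coefficients
    \<open>smooth_pos_deriv\<close>, which enter as bounded factors of the gradients.\<close>
  obtain r where r: "strict_mono r" "AE x in ?M. (\<lambda>n. F (r n) x) \<longlonglongrightarrow> f x"
    by (rule Lp_tendsto_AE_subseq[OF p_pos WD(2)])
  have "\<exists>n\<ge>k. (LINT x|?M. norm (smooth_pos (d k) (F n x) - smooth_pos (d k) (f x)) powr p) < d k \<and>
     (LINT x|?M. norm (smooth_pos_deriv (d k) (F n x) *\<^sub>R dF n x - smooth_pos_deriv (d k) (f x) *\<^sub>R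
         g x) powr p) < d k" for k
  proof -
    have 1: "Lp_tendsto ?M p (\<lambda>n x. smooth_pos (d k) (F (r n) x)) (\<lambda>x. smooth_pos (d k) (f x))"
      by (rule Lp_tendsto_Lipschitz[OF p_nonneg Lp_tendsto_subseq[OF WD(2) r(1)] _ Ls, where C = 1])
         (use measurable_compose[OF fm(1) sm(1)] smooth_pos_Lipschitz[OF d] in auto)
    have 2: "Lp_tendsto ?M p (\<lambda>n x. smooth_pos_deriv (d k) (F (r n) x) *\<^sub>R dF (r n) x) (\<lambda>x.
        smooth_pos_deriv (d k) (f x) *\<^sub>R g x)"
    proof (rule Lp_tendsto_scaleR[OF p_pos Lp_tendsto_subseq[OF WD(3) r(1)], where C = 1])
      show "AE x in ?M. (\<lambda>n. smooth_pos_deriv (d k) (F (r n) x)) \<longlonglongrightarrow> smooth_pos_deriv (d k) (f x)"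
        using r(2)
      proof eventually_elim
        case (elim x)
        show ?case by (rule continuous_on_tendsto_compose[OF continuous_smooth_pos_deriv[OF d]
            elim]) auto
      qed
    qed (use measurable_compose[OF fm(1) sm(2)] measurable_compose[OF WD(6) sm(2)] db in auto)
    have "\<forall>\<^sub>F n in sequentially. n \<ge> k \<and> (LINT x|?M. norm (smooth_pos (d k) (F (r n) x) - smooth_pos
        (d k) (f x)) powr p) < d k \<and>
     (LINT x|?M. norm (smooth_pos_deriv (d k) (F (r n) x) *\<^sub>R dF (r n) x - smooth_pos_deriv (d k) (f
         x) *\<^sub>R g x) powr p) < d k"
      by (intro eventually_conj eventually_ge_at_top order_tendstoD(2)[OF Lp_tendstoD(3)[OF 1] d]
          order_tendstoD(2)[OF Lp_tendstoD(3)[OF 2] d])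
    then obtain n where n: "n \<ge> k" "(LINT x|?M. norm (smooth_pos (d k) (F (r n) x) - smooth_pos (d
        k) (f x)) powr p) < d k"
     "(LINT x|?M. norm (smooth_pos_deriv (d k) (F (r n) x) *\<^sub>R dF (r n) x - smooth_pos_deriv (d k)
         (f x) *\<^sub>R g x) powr p) < d k"
      unfolding eventually_sequentially by blast
    have "r n \<ge> k" using seq_suble[OF r(1), of n] n(1) by simp
    with n(2,3) show ?thesis by blast
  qed
  then have "\<exists>n. n \<ge> k \<and> (LINT x|?M. norm (smooth_pos (d k) (F n x) - smooth_pos (d k) (f x)) powr
      p) < d k \<and>
     (LINT x|?M. norm (smooth_pos_deriv (d k) (F n x) *\<^sub>R dF n x - smooth_pos_deriv (d k) (f x) *\<^sub>R
         g x) powr p) < d k" for k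
    by simp
  from choice[OF allI[OF this]] obtain n where n': "\<forall>k. n k \<ge> k \<and>
      (LINT x|?M. norm (smooth_pos (d k) (F (n k) x) - smooth_pos (d k) (f x)) powr p) < d k \<and>
     (LINT x|?M. norm (smooth_pos_deriv (d k) (F (n k) x) *\<^sub>R dF (n k) x - smooth_pos_deriv (d k) (f
         x) *\<^sub>R g x) powr p) < d k"
    by (rule exE)
  have n: "n k \<ge> k"
    "(LINT x|?M. norm (smooth_pos (d k) (F (n k) x) - smooth_pos (d k) (f x)) powr p) < d k"
    "(LINT x|?M. norm (smooth_pos_deriv (d k) (F (n k) x) *\<^sub>R dF (n k) x - smooth_pos_deriv (d k) (f
        x) *\<^sub>R g x) powr p) < d k" for k
    using n'[rule_format, of k] by blast+
  have lim1: "Lp_tendsto ?M p (\<lambda>k x. smooth_pos (d k) (f x)) (\<lambda>x. max 0 (f x))"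
  proof (rule Lp_tendsto_dominated[OF p_pos WD(4)])
    show "AE x in ?M. (\<lambda>k. smooth_pos (d k) (f x)) \<longlonglongrightarrow> max 0 (f x)"
    proof (intro AE_I2)
      fix x
      show "(\<lambda>k. smooth_pos (d k) (f x)) \<longlonglongrightarrow> max 0 (f x)"
        by (rule LIM_zero_cancel, rule Lim_null_comparison[OF _ d0])
           (use smooth_pos_close[OF d] in auto)
    qed
  qed (use measurable_compose[OF WD(6) sm(1)] smooth_pos_abs_le[OF d] in auto)
  have lim2: "Lp_tendsto ?M p (\<lambda>k x. smooth_pos_deriv (d k) (f x) *\<^sub>R g x) (\<lambda>x. (if f x > 0 then 1
      else 0) *\<^sub>R g x)"
  proof (rule Lp_tendsto_scaleR[OF p_pos Lp_tendsto_const[OF WD(5)], where C = 1])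
    show "AE x in ?M. (\<lambda>k. smooth_pos_deriv (d k) (f x)) \<longlonglongrightarrow> (if f x > 0 then 1 else 0)"
    proof (intro AE_I2)
      fix x
      show "(\<lambda>k. smooth_pos_deriv (d k) (f x)) \<longlonglongrightarrow> (if f x > 0 then 1 else 0)"
        using smooth_pos_deriv_tendsto[OF tendsto_const d0, of "f x"] smooth_pos_nonpos(2)[of "f x"]
            by auto
    qed
  qed (use measurable_compose[OF WD(6) sm(2)] db in auto)
  have C1: "C1_gradient (\<lambda>x. smooth_pos (d k) (F (n k) x)) (\<lambda>x. smooth_pos_deriv (d k) (F (n k) x)
      *\<^sub>R dF (n k) x)" for k
    by (rule C1_gradient_smooth_pos[OF d WD(1)])
  have "W_tendsto \<Omega> p (\<lambda>k x. smooth_pos (d k) (F (n k) x)) (\<lambda>k x. smooth_pos_deriv (d k) (F (n k) x)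
      *\<^sub>R dF (n k) x)
      (\<lambda>x. max 0 (f x)) (\<lambda>x. (if f x > 0 then 1 else 0) *\<^sub>R g x)"
    unfolding W_tendsto_def
  proof (intro conjI allI)
    have c1: "(\<lambda>k. LINT x|?M. norm (smooth_pos (d k) (F (n k) x) - smooth_pos (d k) (f x)) powr p)
        \<longlonglongrightarrow> 0"
    proof (rule tendsto_sandwich[OF _ _ tendsto_const d0])
      show "\<forall>\<^sub>F k in sequentially. (LINT x|?M. norm (smooth_pos (d k) (F (n k) x) - smooth_pos (d k)
          (f x)) powr p) \<le> d k"
        by (intro always_eventually allI less_imp_le n(2))
    qed simp
    have c2: "(\<lambda>k. LINT x|?M. norm (smooth_pos_deriv (d k) (F (n k) x) *\<^sub>R dF (n k) x -
        smooth_pos_deriv (d k) (f x) *\<^sub>R g x) powr p) \<longlonglongrightarrow> 0"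
    proof (rule tendsto_sandwich[OF _ _ tendsto_const d0])
      show "\<forall>\<^sub>F k in sequentially. (LINT x|?M. norm (smooth_pos_deriv (d k) (F (n k) x) *\<^sub>R dF (n k)
          x - smooth_pos_deriv (d k) (f x) *\<^sub>R g x) powr p) \<le> d k"
        by (intro always_eventually allI less_imp_le n(3))
    qed simp
    show "Lp_tendsto ?M p (\<lambda>k x. smooth_pos (d k) (F (n k) x)) (\<lambda>x. max 0 (f x))"
      by (rule Lp_tendsto_trans_diff[OF p_nonneg lim1 c1 Lp_continuous[OF C1_gradientD(4)[OF C1]]])
    show "Lp_tendsto ?M p (\<lambda>k x. smooth_pos_deriv (d k) (F (n k) x) *\<^sub>R dF (n k) x) (\<lambda>x. (if f x > 0
        then 1 else 0) *\<^sub>R g x)"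
      by (rule Lp_tendsto_trans_diff[OF p_nonneg lim2 c2 Lp_continuous[OF C1_gradientD(1)[OF C1]]])
  qed (rule C1)
  then show thesis by (rule that[OF n(1) d])
qed

end

text \<open>Completeness of Lebesgue measure. It yields measurability of the chosen
  \<open>weak_gradient\<close>, which is known only to agree almost everywhere with a measurable
  function.\<close>

lemma borel_measurable_lebesgue_on_AE:
  fixes f g :: "'a::euclidean_space \<Rightarrow> 'b::euclidean_space"
  assumes S: "S \<in> sets lebesgue" and f: "f \<in> borel_measurable (lebesgue_on S)"
    and ae: "AE x in lebesgue_on S. f x = g x"
  shows "g \<in> borel_measurable (lebesgue_on S)"
proof -
  have "(\<lambda>x. indicator S x *\<^sub>R f x) \<in> borel_measurable lebesgue"
    using f S by (subst (asm) borel_measurable_restrict_space_iff) auto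
  moreover have "AE x in lebesgue. indicator S x *\<^sub>R f x = indicator S x *\<^sub>R g x"
    using ae S by (subst (asm) AE_restrict_space_iff) (auto elim!: eventually_mono simp:
        indicator_def)
  ultimately have "(\<lambda>x. indicator S x *\<^sub>R g x) \<in> borel_measurable lebesgue"
    by (rule borel_measurable_AE)
  then show ?thesis using S by (subst borel_measurable_restrict_space_iff) auto
qed

lemma Lp_lborel_representative:
  fixes h :: "'a::euclidean_space \<Rightarrow> 'b::euclidean_space"
  assumes h: "Lp lebesgue p h" "integrable lebesgue h"
  obtains h' where "Lp lborel p h'" "integrable lborel h'" "AE x in lebesgue. h x = h' x"
proof -
  obtain h' where h': "integrable lborel h'" "AE x in lebesgue. h x = h' x"
    by (rule lborel_representative[OF h(2)])
  have bm: "h' \<in> borel_measurable borel" using h'(1) by auto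
  have "h' \<in> borel_measurable lebesgue" by (rule borel_measurable_integrable[OF
      integrable_lborel_imp_lebesgue[OF h'(1)]])
  from Lp_cong_AE[OF h(1) this h'(2)] have "integrable lebesgue (\<lambda>x. norm (h' x) powr p)"
      by (rule LpD(2))
  then have "integrable lborel (\<lambda>x. norm (h' x) powr p)"
    using bm by (subst (asm) integrable_completion) auto
  then have "Lp lborel p h'" using bm by (simp add: Lp_def)
  from that[OF this h'] show thesis .
qed

lemma Lp_restrict_cball:
  fixes h :: "'a::euclidean_space \<Rightarrow> 'b::euclidean_space"
  assumes p: "1 \<le> p" and h: "Lp lebesgue p h"
  shows "Lp lebesgue p (\<lambda>x. indicator (cball a r) x *\<^sub>R h x)" "integrable lebesgue (\<lambda>x. indicator
      (cball a r) x *\<^sub>R h x)"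
proof -
  have m: "(\<lambda>x. indicator (cball a r) x *\<^sub>R h x) \<in> borel_measurable lebesgue"
    by (intro borel_measurable_scaleR borel_measurable_indicator LpD(1)[OF h]) simp
  show "Lp lebesgue p (\<lambda>x. indicator (cball a r) x *\<^sub>R h x)"
    by (rule Lp_mono[OF _ h m, where C = 1]) (use p in \<open>auto simp: indicator_def\<close>)
  have i: "integrable lebesgue (indicat_real (cball a r))"
    by (rule integrable_lborel_imp_lebesgue[OF integrable_indicator_cball])
  show "integrable lebesgue (\<lambda>x. indicator (cball a r) x *\<^sub>R h x)"
  proof (rule Bochner_Integration.integrable_bound[OF _ m])
    show "integrable lebesgue (\<lambda>x. indicat_real (cball a r) x + norm (h x) powr p)"
      using i LpD(2)[OF h] by (rule Bochner_Integration.integrable_add)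
    have "norm (indicator (cball a r) x *\<^sub>R h x) \<le> norm (indicat_real (cball a r) x
        + norm (h x) powr p)" for x
    proof (cases "norm (h x) \<le> 1")
      case False
      then have "norm (h x) powr 1 \<le> norm (h x) powr p" using p by (intro powr_mono) auto
      then show ?thesis by (auto simp: indicator_def)
    qed (auto simp: indicator_def add_increasing2)
    then show "AE x in lebesgue. norm (indicator (cball a r) x *\<^sub>R h x)
        \<le> norm (indicat_real (cball a r) x + norm (h x) powr p)"
      by (intro AE_I2)
  qed
qed

text \<open>Moves the derivative from the kernel to \<phi> by testing with the kernel itself; the
  minus sign in the definition of a weak gradient cancels against the one from differentiating
  \<open>x - y\<close> in \<open>y\<close>. Agreement is required only on
  \<open>cball x \<epsilon>\<close>, because \<open>f\<close> and \<open>g\<close> will be cut-off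
  versions of \<phi> and \<open>G\<close>.\<close>

lemma mollify_gradient_eq:
  fixes \<phi> :: "'a::euclidean_space \<Rightarrow> real"
  assumes e: "0 < \<epsilon>" and w: "is_weak_gradient UNIV \<phi> G"
    and f: "integrable lborel f" "AE y in lebesgue. y \<in> cball x \<epsilon> \<longrightarrow> f y = \<phi> y"
    and g: "integrable lborel g" "AE y in lebesgue. y \<in> cball x \<epsilon> \<longrightarrow> g y = G y"
  shows "(LINT y|lborel. (f y / bump_mass TYPE('a) \<epsilon>) *\<^sub>R bump_gradient \<epsilon> (x - y)) = mollify \<epsilon> g x"
proof -
  define c where "c = bump_mass TYPE('a) \<epsilon>"
  define K where "K = cball x \<epsilon>"
  have fm[measurable]: "f \<in> borel_measurable borel" using f(1) by auto
  have gm[measurable]: "g \<in> borel_measurable borel" using g(1) by auto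
  have "locally_integrable UNIV \<phi>" "locally_integrable UNIV G"
    using w by (auto simp: is_weak_gradient_def)
  from this[THEN locally_integrable_cball, of x \<epsilon>]
  have pi: "(\<lambda>y. indicator K y *\<^sub>R \<phi> y) \<in> borel_measurable lebesgue"
      "(\<lambda>y. indicator K y *\<^sub>R G y) \<in> borel_measurable lebesgue"
    by (auto simp: K_def)
  have out: "bump \<epsilon> (x - y) = 0" "bump_gradient \<epsilon> (x - y) = 0" if "y \<notin> K" for y
  proof -
    have "\<epsilon> \<le> norm (x - y)" using that by (simp add: K_def dist_norm)
    then show "bump \<epsilon> (x - y) = 0" "bump_gradient \<epsilon> (x - y) = 0"
      using e by (simp_all add: bump_eq_0 bump_gradient_eq_0)
  qed
  have mb: "(\<lambda>y. bump \<epsilon> (x - y)) \<in> borel_measurable lebesgue"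
      "(\<lambda>y. bump_gradient \<epsilon> (x - y)) \<in> borel_measurable lebesgue"
  proof -
    have "(\<lambda>y. bump \<epsilon> (x - y)) \<in> borel_measurable lborel"
        "(\<lambda>y. bump_gradient \<epsilon> (x - y)) \<in> borel_measurable lborel"
      by measurable
    then show "(\<lambda>y. bump \<epsilon> (x - y)) \<in> borel_measurable lebesgue"
        "(\<lambda>y. bump_gradient \<epsilon> (x - y)) \<in> borel_measurable lebesgue"
      by (simp_all add: measurable_completion)
  qed
  have fl: "f \<in> borel_measurable lebesgue" "g \<in> borel_measurable lebesgue"
    by (rule borel_measurable_integrable[OF integrable_lborel_imp_lebesgue] f g)+
  have 1: "(LINT y|lborel. f y *\<^sub>R bump_gradient \<epsilon> (x - y)) =
      (LINT y|lebesgue. \<phi> y *\<^sub>R bump_gradient \<epsilon> (x - y))"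
  proof -
    have "(LINT y|lborel. f y *\<^sub>R bump_gradient \<epsilon> (x - y)) =
        (LINT y|lebesgue. f y *\<^sub>R bump_gradient \<epsilon> (x - y))"
      by (rule integral_completion[symmetric]) measurable
    also have "\<dots> = (LINT y|lebesgue. (indicator K y *\<^sub>R \<phi> y) *\<^sub>R bump_gradient \<epsilon> (x - y))"
    proof (rule integral_cong_AE)
      show "AE y in lebesgue. f y *\<^sub>R bump_gradient \<epsilon> (x - y)
          = (indicator K y *\<^sub>R \<phi> y) *\<^sub>R bump_gradient \<epsilon> (x - y)"
        using f(2)
      proof eventually_elim
        case (elim y)
        show ?case using elim out(2)[of y] by (cases "y \<in> K") (auto simp: K_def)
      qed
    qed (intro borel_measurable_scaleR fl pi mb)+
    also have "(\<lambda>y. (indicator K y *\<^sub>R \<phi> y) *\<^sub>R bump_gradient \<epsilon> (x - y))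
        = (\<lambda>y. \<phi> y *\<^sub>R bump_gradient \<epsilon> (x - y))"
    proof
      show "(indicator K y *\<^sub>R \<phi> y) *\<^sub>R bump_gradient \<epsilon> (x - y)
          = \<phi> y *\<^sub>R bump_gradient \<epsilon> (x - y)" for y
        using out(2)[of y] by (cases "y \<in> K") auto
    qed
    finally show ?thesis .
  qed
  have 2: "(LINT y|lborel. bump \<epsilon> (x - y) *\<^sub>R g y) = (LINT y|lebesgue. bump \<epsilon> (x - y) *\<^sub>R G y)"
  proof -
    have "(LINT y|lborel. bump \<epsilon> (x - y) *\<^sub>R g y) = (LINT y|lebesgue. bump \<epsilon> (x - y) *\<^sub>R g y)"
      by (rule integral_completion[symmetric]) measurable
    also have "\<dots> = (LINT y|lebesgue. bump \<epsilon> (x - y) *\<^sub>R (indicator K y *\<^sub>R G y))"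
    proof (rule integral_cong_AE)
      show "AE y in lebesgue. bump \<epsilon> (x - y) *\<^sub>R g y = bump \<epsilon> (x - y) *\<^sub>R (indicator K y *\<^sub>R G y)"
        using g(2)
      proof eventually_elim
        case (elim y)
        show ?case using elim out(1)[of y] by (cases "y \<in> K") (auto simp: K_def)
      qed
    qed (intro borel_measurable_scaleR fl pi mb)+
    also have "(\<lambda>y. bump \<epsilon> (x - y) *\<^sub>R (indicator K y *\<^sub>R G y)) = (\<lambda>y. bump \<epsilon> (x - y) *\<^sub>R G y)"
    proof
      show "bump \<epsilon> (x - y) *\<^sub>R (indicator K y *\<^sub>R G y) = bump \<epsilon> (x - y) *\<^sub>R G y" for y
        using out(1)[of y] by (cases "y \<in> K") auto
    qed
    finally show ?thesis .
  qed
  have 3: "(LINT y|lebesgue. \<phi> y *\<^sub>R bump_gradient \<epsilon> (x - y)) =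
      (LINT y|lebesgue. bump \<epsilon> (x - y) *\<^sub>R G y)"
  proof -
    have "(\<lambda>y. bump \<epsilon> (x - y)) \<in> C1_compact_support UNIV"
      by (rule bump_shift_C1_compact_support[OF e]) simp
    then have "(LINT y|lebesgue. \<phi> y *\<^sub>R - bump_gradient \<epsilon> (x - y)) = -
        (LINT y|lebesgue. bump \<epsilon> (x - y) *\<^sub>R G y)"
      using w C1_gradient_bump_shift[of \<epsilon> x] unfolding is_weak_gradient_def lebesgue_on_UNIV_eq
          by blast
    then show ?thesis by simp
  qed
  have "(LINT y|lborel. (f y / c) *\<^sub>R bump_gradient \<epsilon> (x - y)) = (1 / c) *\<^sub>R
      (LINT y|lborel. f y *\<^sub>R bump_gradient \<epsilon> (x - y))"
    by (subst integral_scaleR_right[symmetric]) (simp_all add: field_simps)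
  also have "\<dots> = (1 / c) *\<^sub>R (LINT y|lborel. bump \<epsilon> (x - y) *\<^sub>R g y)"
    unfolding 1 2 3 ..
  also have "\<dots> = mollify \<epsilon> g x"
    by (subst integral_scaleR_right[symmetric]) (simp_all add: mollify_def c_def)
  finally show ?thesis by (simp add: c_def)
qed

section \<open>C1 approximation of \<phi> and of the elements of \<open>sobolev0\<close>\<close>

context bounded_domain
begin

text \<open>Cutting \<phi> and \<open>G\<close> off outside the ball of radius \<open>R + 1\<close>
  makes them integrable but breaks the relation between them across the sphere. Kernels of radius at
  most 1 centred in \<Omega> never leave that ball, so on \<Omega> the gradient of the mollified
  function is still the mollified gradient.\<close>

lemma bounded_sobolev_approx:
  assumes \<phi>: "Lp lebesgue p \<phi>" "Lp lebesgue p G" "is_weak_gradient UNIV \<phi> G"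
    and M: "AE x in lebesgue. \<bar>\<phi> x\<bar> \<le> M" "0 \<le> M"
  obtains F dF where "W_tendsto \<Omega> p F dF \<phi> G" "\<And>n x. \<bar>F n x\<bar> \<le> M"
proof -
  obtain R where "\<forall>x\<in>\<Omega>. norm x \<le> R" using bounded_domain bounded_iff by blast
  then have R: "norm x \<le> R" if "x \<in> \<Omega>" for x using that by blast
  define B where "B = cball (0::'a) (R + 1)"
  obtain f where f: "Lp lborel p f" "integrable lborel f" "AE x in lebesgue. indicator B x *\<^sub>R \<phi> x
      = f x"
    by (rule Lp_lborel_representative[OF Lp_restrict_cball[OF p_ge_1 \<phi>(1), of 0 "R
        + 1", folded B_def]])
  obtain g where g: "Lp lborel p g" "integrable lborel g" "AE x in lebesgue. indicator B x *\<^sub>R G x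
      = g x"
    by (rule Lp_lborel_representative[OF Lp_restrict_cball[OF p_ge_1 \<phi>(2), of 0 "R
        + 1", folded B_def]])
  have fb: "AE y in lborel. norm (f y) \<le> M"
  proof -
    have "AE y in lebesgue. norm (f y) \<le> M"
      using f(3) M(1)
    proof eventually_elim
      case (elim y)
      have "norm (indicator B y *\<^sub>R \<phi> y) \<le> M" using elim(2) M(2) by (auto simp: indicator_def)
      then show ?case unfolding elim(1) .
    qed
    then show ?thesis by (simp add: AE_completion_iff)
  qed
  define \<epsilon> where "\<epsilon> n = 1 / real (Suc n)" for n
  have \<epsilon>: "0 < \<epsilon> n" "\<epsilon> n \<le> 1" for n by (simp_all add: \<epsilon>_def)
  define F where "F n = mollify (\<epsilon> n) f" for n
  define dF where "dF n x = (LINT y|lborel. (f y / bump_mass TYPE('a) (\<epsilon> n)) *\<^sub>R bump_gradient (\<epsilon> n)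
      (x - y))" for n x
  have C1: "C1_gradient (F n) (dF n)" for n
    unfolding F_def dF_def[abs_def] by (rule C1_gradient_mollify[OF \<epsilon>(1) f(2)])
  have B\<Omega>: "cball x (\<epsilon> n) \<subseteq> B" if "x \<in> \<Omega>" for x n
  proof
    fix y assume "y \<in> cball x (\<epsilon> n)"
    then have "norm (y - x) \<le> 1" using \<epsilon>(2)[of n] by (simp add: dist_norm norm_minus_commute)
    then show "y \<in> B" using R[OF that] norm_triangle_ineq[of x "y - x"] by (simp add: B_def)
  qed
  have dF: "dF n x = mollify (\<epsilon> n) g x" if x: "x \<in> \<Omega>" for n x
    unfolding dF_def
  proof (rule mollify_gradient_eq[OF \<epsilon>(1) \<phi>(3) f(2) _ g(2)])
    show "AE y in lebesgue. y \<in> cball x (\<epsilon> n) \<longrightarrow> f y = \<phi> y"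
      using f(3)
    proof eventually_elim
      case (elim y)
      show ?case using elim B\<Omega>[OF x, of n] by (auto simp: indicator_def)
    qed
    show "AE y in lebesgue. y \<in> cball x (\<epsilon> n) \<longrightarrow> g y = G y"
      using g(3)
    proof eventually_elim
      case (elim y)
      show ?case using elim B\<Omega>[OF x, of n] by (auto simp: indicator_def)
    qed
  qed
  have xB: "x \<in> B" if "x \<in> \<Omega>" for x using R[OF that] by (simp add: B_def)
  have aef: "AE x in lebesgue_on \<Omega>. f x = \<phi> x"
  proof -
    have "AE x in lebesgue. x \<in> \<Omega> \<longrightarrow> f x = \<phi> x"
      using f(3) by eventually_elim (auto simp: indicator_def xB)
    then show ?thesis using domain_lebesgue by (subst AE_restrict_space_iff) auto
  qed
  have aeg: "AE x in lebesgue_on \<Omega>. g x = G x"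
  proof -
    have "AE x in lebesgue. x \<in> \<Omega> \<longrightarrow> g x = G x"
      using g(3) by eventually_elim (auto simp: indicator_def xB)
    then show ?thesis using domain_lebesgue by (subst AE_restrict_space_iff) auto
  qed
  have \<phi>m: "\<phi> \<in> borel_measurable (lebesgue_on \<Omega>)" by (rule measurable_restrict_space1[OF LpD(1)[OF
      \<phi>(1)]])
  have Gm: "G \<in> borel_measurable (lebesgue_on \<Omega>)" by (rule measurable_restrict_space1[OF LpD(1)[OF
      \<phi>(2)]])
  have "Lp_tendsto (lebesgue_on \<Omega>) p F \<phi>"
    by (rule Lp_tendsto_cong_AE[OF Lp_tendsto_lborel_imp_lebesgue_on[OF p_nonneg mollify_tendsto[OF
        p_ge_1 f(1,2)] domain_lebesgue] _ _ \<phi>m aef])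
       (use measurable_lebesgue_on_continuous[OF C1_gradientD(4)[OF C1]] in \<open>auto simp: F_def
           \<epsilon>_def\<close>)
  moreover have "Lp_tendsto (lebesgue_on \<Omega>) p dF G"
  proof (rule Lp_tendsto_cong_AE[OF Lp_tendsto_lborel_imp_lebesgue_on[OF p_nonneg mollify_tendsto[OF
      p_ge_1 g(1,2)] domain_lebesgue] _ _ Gm aeg])
    show "AE x in lebesgue_on \<Omega>. mollify (1 / real (Suc n)) g x = dF n x" for n
      by (intro AE_I2) (use dF in \<open>simp add: \<epsilon>_def\<close>)
  qed (rule measurable_lebesgue_on_continuous[OF C1_gradientD(1)[OF C1]])
  ultimately have "W_tendsto \<Omega> p F dF \<phi> G" using C1 by (simp add: W_tendsto_def)
  moreover have "\<bar>F n x\<bar> \<le> M" for n x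
    using mollify_bound[OF \<epsilon>(1) fb f(2), of n x] by (simp add: F_def)
  ultimately show thesis by (rule that)
qed

lemma sobolev_norm_eq:
  assumes "is_weak_gradient \<Omega> f g" "g \<in> borel_measurable (lebesgue_on \<Omega>)"
  shows "sobolev_norm \<Omega> p f = (LINT x|lebesgue_on \<Omega>. norm (f x) powr p) powr (1 / p)
    + (LINT x|lebesgue_on \<Omega>. norm (g x) powr p) powr (1 / p)"
proof -
  have ae: "AE x in lebesgue_on \<Omega>. weak_gradient \<Omega> f x = g x"
    by (rule weak_gradient_AE_eq[OF open_domain assms(1)])
  then have ae': "AE x in lebesgue_on \<Omega>. g x = weak_gradient \<Omega> f x" by eventually_elim simp
  have m: "weak_gradient \<Omega> f \<in> borel_measurable (lebesgue_on \<Omega>)"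
    by (rule borel_measurable_lebesgue_on_AE[OF domain_lebesgue assms(2) ae'])
  have "(LINT x|lebesgue_on \<Omega>. norm (weak_gradient \<Omega> f x) powr p) =
      (LINT x|lebesgue_on \<Omega>. norm (g x) powr p)"
  proof (rule integral_cong_AE)
    show "AE x in lebesgue_on \<Omega>. norm (weak_gradient \<Omega> f x) powr p = norm (g x) powr p"
      using ae by eventually_elim simp
  qed (use m assms(2) in auto)
  then show ?thesis by (simp add: sobolev_norm_def Lp_norm_def)
qed

lemma sobolev_norm_tendsto_0:
  assumes w: "\<And>n. is_weak_gradient \<Omega> (f n) (g n)" "\<And>n. g n \<in> borel_measurable (lebesgue_on \<Omega>)"
    and f: "(\<lambda>n. LINT x|lebesgue_on \<Omega>. norm (f n x) powr p) \<longlonglongrightarrow> 0"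
    and g: "(\<lambda>n. LINT x|lebesgue_on \<Omega>. norm (g n x) powr p) \<longlonglongrightarrow> 0"
  shows "(\<lambda>n. sobolev_norm \<Omega> p (f n)) \<longlonglongrightarrow> 0"
proof -
  have root: "(\<lambda>n. a n powr (1 / p)) \<longlonglongrightarrow> 0" if "a \<longlonglongrightarrow> 0" "\<And>n. 0 \<le> a n" for a :: "nat \<Rightarrow> real"
  proof -
    have "(\<lambda>n. a n powr (1 / p)) \<longlonglongrightarrow> 0 powr (1 / p)"
      using that p_pos by (intro tendsto_powr' tendsto_const) auto
    then show ?thesis using p_pos by simp
  qed
  show ?thesis
    unfolding sobolev_norm_eq[OF w] by (intro tendsto_add_zero root f g) auto
qed

lemma sobolev_normD:
  assumes w: "is_weak_gradient \<Omega> f g" "g \<in> borel_measurable (lebesgue_on \<Omega>)"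
    and n: "sobolev_norm \<Omega> p f < e" and e: "0 < e"
  shows "(LINT x|lebesgue_on \<Omega>. norm (f x) powr p) \<le> e powr p"
      "(LINT x|lebesgue_on \<Omega>. norm (g x) powr p) \<le> e powr p"
proof -
  have a: "a \<le> e powr p" if "a powr (1 / p) < e" "0 \<le> a" for a
  proof -
    have "(a powr (1 / p)) powr p \<le> e powr p" using that p_pos by (intro powr_mono2) auto
    then show ?thesis using that(2) p_pos by (simp add: powr_powr)
  qed
  have "(LINT x|lebesgue_on \<Omega>. norm (f x) powr p) powr (1 / p) < e"
      "(LINT x|lebesgue_on \<Omega>. norm (g x) powr p) powr (1 / p) < e"
    using n unfolding sobolev_norm_eq[OF w]
    by (smt (verit) powr_ge_zero)+
  then show "(LINT x|lebesgue_on \<Omega>. norm (f x) powr p) \<le> e powr p"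
      "(LINT x|lebesgue_on \<Omega>. norm (g x) powr p) \<le> e powr p"
    by (auto intro!: a)
qed

lemma W_tendsto_imp_sobolev:
  assumes "W_tendsto \<Omega> p F dF f g"
  shows "f \<in> sobolev \<Omega> p"
  using W_tendstoD(4,5)[OF assms] W_tendsto_imp_weak_gradient[OF assms]
  by (auto simp: sobolev_def Lp_space_iff)

lemma W_tendsto_imp_sobolev0:
  assumes W: "W_tendsto \<Omega> p F dF f g" and F: "\<And>n. F n \<in> C1_compact_support \<Omega>"
  shows "f \<in> sobolev0 \<Omega> p"
  unfolding sobolev0_def
proof (intro CollectI conjI allI impI W_tendsto_imp_sobolev[OF W])
  fix \<epsilon> :: real assume e: "\<epsilon> > 0"
  note WD = W_tendstoD[OF W]
  have "(\<lambda>n. sobolev_norm \<Omega> p (\<lambda>x. F n x - f x)) \<longlonglongrightarrow> 0"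
  proof (rule sobolev_norm_tendsto_0)
    show "is_weak_gradient \<Omega> (\<lambda>x. F n x - f x) (\<lambda>x. dF n x - g x)" for n
      by (rule W_tendsto_imp_weak_gradient[OF W_tendsto_diff[OF p_nonneg W_tendsto_const[OF WD(1)]
          W]])
    show "(\<lambda>x. dF n x - g x) \<in> borel_measurable (lebesgue_on \<Omega>)" for n
      by (rule borel_measurable_diff[OF LpD(1)[OF Lp_tendstoD(1)[OF WD(3)]] WD(7)])
  qed (rule Lp_tendstoD(3)[OF WD(2)] Lp_tendstoD(3)[OF WD(3)])+
  then have "\<forall>\<^sub>F n in sequentially. sobolev_norm \<Omega> p (\<lambda>x. F n x - f x) < \<epsilon>" using e
      by (rule order_tendstoD)
  then obtain n where "sobolev_norm \<Omega> p (\<lambda>x. F n x - f x) < \<epsilon>"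
      by (auto simp: eventually_sequentially)
  then show "\<exists>\<psi>\<in>C1_compact_support \<Omega>. sobolev_norm \<Omega> p (\<lambda>x. \<psi> x - f x) < \<epsilon>" using F by blast
qed

text \<open>Approximants within \<open>1 / real (Suc n)\<close> come from the definition of
  \<open>sobolev0\<close>. The norm there involves the chosen gradient of a difference, which
  \<open>is_weak_gradient_diff\<close> and uniqueness identify with
  \<open>dF n x - g x\<close>.\<close>

lemma sobolev0_imp_W_tendsto:
  assumes v: "v \<in> sobolev0 \<Omega> p"
  obtains F dF g where "W_tendsto \<Omega> p F dF v g" "\<And>n. F n \<in> C1_compact_support \<Omega>"
proof -
  obtain g where g: "Lp (lebesgue_on \<Omega>) p v" "Lp (lebesgue_on \<Omega>) p g" "is_weak_gradient \<Omega> v g"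
    using v by (auto simp: sobolev0_def sobolev_def Lp_space_iff)
  define d where "d n = 1 / real (Suc n)" for n
  have d: "d n > 0" for n by (simp add: d_def)
  have d0: "d \<longlonglongrightarrow> 0" unfolding d_def[abs_def] by (rule LIMSEQ_Suc[OF lim_const_over_n])
  have "\<forall>n. \<exists>\<psi>. \<psi> \<in> C1_compact_support \<Omega> \<and> sobolev_norm \<Omega> p (\<lambda>x. \<psi> x - v x) < d n"
    using v d unfolding sobolev0_def by blast
  from choice[OF this] obtain F where F: "\<forall>n. F n \<in> C1_compact_support \<Omega>
      \<and> sobolev_norm \<Omega> p (\<lambda>x. F n x - v x) < d n"
    by (rule exE)
  then have "\<forall>n. \<exists>dF. C1_gradient (F n) dF" unfolding C1_compact_support_def by blast
  from choice[OF this] obtain dF where dF: "\<forall>n. C1_gradient (F n) (dF n)" by (rule exE)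
  note W = W_tendsto_const[OF dF[rule_format]]
  note L = W_tendstoD(4,5)[OF W]
  have w: "is_weak_gradient \<Omega> (\<lambda>x. F n x - v x) (\<lambda>x. dF n x - g x)" for n
    by (rule is_weak_gradient_diff[OF W_tendsto_imp_weak_gradient[OF W] g(3) L g(1,2)])
  have m: "(\<lambda>x. dF n x - g x) \<in> borel_measurable (lebesgue_on \<Omega>)" for n
    by (rule borel_measurable_diff[OF LpD(1)[OF L(2)] LpD(1)[OF g(2)]])
  note le = sobolev_normD[OF w m conjunct2[OF F[rule_format]] d]
  have dp: "(\<lambda>n. d n powr p) \<longlonglongrightarrow> 0"
  proof -
    have "(\<lambda>n. d n powr p) \<longlonglongrightarrow> 0 powr p"
      by (intro tendsto_powr' d0 tendsto_const) (simp add: p_pos less_imp_le[OF d])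
    then show ?thesis using p_pos by simp
  qed
  have "W_tendsto \<Omega> p F dF v g"
    unfolding W_tendsto_def Lp_tendsto_def
  proof (intro conjI allI dF[rule_format] L g(1,2))
    show "(\<lambda>n. LINT x|lebesgue_on \<Omega>. norm (F n x - v x) powr p) \<longlonglongrightarrow> 0"
      by (rule tendsto_sandwich[OF _ _ tendsto_const dp]; intro always_eventually allI le) simp
    show "(\<lambda>n. LINT x|lebesgue_on \<Omega>. norm (dF n x - g x) powr p) \<longlonglongrightarrow> 0"
      by (rule tendsto_sandwich[OF _ _ tendsto_const dp]; intro always_eventually allI le) simp
  qed
  then show thesis by (rule that) (use F in blast)
qed

end

subsection \<open>Truncation and vanishing flux\<close>

lemma C1_compact_support_add:
  assumes "f \<in> C1_compact_support \<Omega>" "g \<in> C1_compact_support \<Omega>"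
  shows "(\<lambda>x. f x + g x) \<in> C1_compact_support \<Omega>"
proof -
  obtain df dg where d: "C1_gradient f df" "C1_gradient g dg"
    using assms by (auto simp: C1_compact_support_def)
  obtain K where K: "compact K" "K \<subseteq> \<Omega>" "\<forall>x. x \<notin> K \<longrightarrow> f x = 0 \<and> df x = 0"
    by (rule C1_compact_supportE[OF assms(1) d(1)])
  obtain K' where K': "compact K'" "K' \<subseteq> \<Omega>" "\<forall>x. x \<notin> K' \<longrightarrow> g x = 0 \<and> dg x = 0"
    by (rule C1_compact_supportE[OF assms(2) d(2)])
  show ?thesis
    by (rule C1_compact_supportI[OF C1_gradient_add[OF d], of "K \<union> K'"]) (use K K' in \<open>auto intro:
        compact_Un\<close>)
qed

lemma C1_compact_support_uminus:
  assumes "f \<in> C1_compact_support \<Omega>"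
  shows "(\<lambda>x. - f x) \<in> C1_compact_support \<Omega>"
proof -
  obtain df where d: "C1_gradient f df" using assms by (auto simp: C1_compact_support_def)
  obtain K where K: "compact K" "K \<subseteq> \<Omega>" "\<forall>x. x \<notin> K \<longrightarrow> f x = 0 \<and> df x = 0"
    by (rule C1_compact_supportE[OF assms d])
  show ?thesis
    by (rule C1_compact_supportI[OF C1_gradient_uminus[OF d] K(1,2)]) (use K(3) in simp)
qed

lemma C1_compact_support_dominated:
  assumes V: "V \<in> C1_compact_support \<Omega>" and f: "C1_gradient f g" and z: "\<And>x. V x = 0 \<Longrightarrow> f x = 0"
  shows "f \<in> C1_compact_support \<Omega>"
proof -
  obtain dV where d: "C1_gradient V dV" using V by (auto simp: C1_compact_support_def)
  obtain K where K: "compact K" "K \<subseteq> \<Omega>" "\<forall>x. x \<notin> K \<longrightarrow> V x = 0 \<and> dV x = 0"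
    by (rule C1_compact_supportE[OF V d])
  show ?thesis by (rule C1_compact_supportI[OF f K(1,2)]) (use K(3) z in simp)
qed

context bounded_domain
begin

text \<open>Where \<open>V n\<close> vanishes, \<open>F n x \<le> M \<le> W n x\<close>, so the
  smoothed positive part of \<open>F n x - W n x\<close> is exactly 0. This is how the boundary
  values of \<open>u\<close> put the excess over \<open>w\<close> into the zero boundary
  class.\<close>

lemma excess_in_sobolev0:
  assumes u: "W_tendsto \<Omega> p F dF u g" and V: "\<And>n. V n \<in> C1_compact_support \<Omega>"
    and FV: "\<And>n x. V n x = 0 \<Longrightarrow> F n x \<le> M"
    and w: "W_tendsto \<Omega> p W dW w dw" and Wn: "\<And>n x. M \<le> W n x"
  obtains H dH where "W_tendsto \<Omega> p H dH (\<lambda>x. max 0 (u x - w x)) (\<lambda>x. (if u x > w x then 1 else 0)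
      *\<^sub>R (g x - dw x))"
    "\<And>n. H n \<in> C1_compact_support \<Omega>"
proof -
  obtain n d where nd: "\<And>k::nat. n k \<ge> (k::nat)" "\<And>k. d k > (0::real)"
    "W_tendsto \<Omega> p (\<lambda>k x. smooth_pos (d k) (F (n k) x - W (n k) x))
      (\<lambda>k x. smooth_pos_deriv (d k) (F (n k) x - W (n k) x) *\<^sub>R (dF (n k) x - dW (n k) x))
      (\<lambda>x. max 0 (u x - w x)) (\<lambda>x. (if u x - w x > 0 then 1 else 0) *\<^sub>R (g x - dw x))"
    using W_tendsto_pos_part[OF W_tendsto_diff[OF p_nonneg u w]] by auto
  have "(\<lambda>x. smooth_pos (d k) (F (n k) x - W (n k) x)) \<in> C1_compact_support \<Omega>" for k
  proof (rule C1_compact_support_dominated[OF V[of "n k"] W_tendstoD(1)[OF nd(3), of k]])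
    fix x assume "V (n k) x = 0"
    then have "F (n k) x - W (n k) x \<le> 0" using FV[of "n k" x] Wn[of "n k" x] by simp
    then show "smooth_pos (d k) (F (n k) x - W (n k) x) = 0" using nd(2)
        by (simp add: smooth_pos_nonpos)
  qed
  with nd(3) show thesis by (intro that) simp_all
qed

text \<open>The primitive \<open>B\<close> of \<beta> that vanishes at 0 vanishes on all of
  \<open>{-M..M}\<close>. Hence \<open>B (F n x)\<close> is 0 wherever \<open>V n x\<close> is 0,
  has compact support, and its gradient \<open>\<beta> (F n x) *\<^sub>R dF n x\<close> integrates
  to 0. The limit is taken along an almost everywhere convergent subsequence.\<close>

lemma zero_flux_continuous:
  assumes u: "W_tendsto \<Omega> p F dF u g" and V: "\<And>n. V n \<in> C1_compact_support \<Omega>"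
    and FV: "\<And>n x. V n x = 0 \<Longrightarrow> \<bar>F n x\<bar> \<le> M"
    and \<beta>: "continuous_on UNIV \<beta>" "\<And>t. \<bar>\<beta> t\<bar> \<le> C" "\<And>t. \<bar>t\<bar> \<le> M \<Longrightarrow> \<beta> t = (0::real)"
  shows "(LINT x|lebesgue_on \<Omega>. \<beta> (u x) *\<^sub>R g x) = 0"
proof -
  note D = W_tendstoD[OF u]
  have "\<exists>B0. \<forall>x. (-\<infinity>::ereal) < ereal x \<longrightarrow> ereal x < \<infinity> \<longrightarrow> (B0 has_vector_derivative \<beta> x) (at x)"
    by (rule einterval_antiderivative) (use \<beta>(1) in \<open>auto simp: continuous_on_eq_continuous_at\<close>)
  then obtain B0 where B0: "(B0 has_real_derivative \<beta> x) (at x)" for x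
    by (auto simp: has_real_derivative_iff_has_vector_derivative)
  define B where "B t = B0 t - B0 0" for t
  have B: "(B has_real_derivative \<beta> x) (at x)" for x
    unfolding B_def[abs_def] using DERIV_diff[OF B0 DERIV_const] by simp
  have Bz: "B t = 0" if t: "\<bar>t\<bar> \<le> M" for t
  proof -
    have "norm (B t - B 0) \<le> 0 * norm (t - 0)"
    proof (rule field_differentiable_bound[of "{-M..M}" B \<beta>])
      show "(B has_real_derivative \<beta> z) (at z within {-M..M})" for z
        by (rule has_field_derivative_at_within[OF B])
      show "norm (\<beta> z) \<le> 0" if "z \<in> {-M..M}" for z using \<beta>(3)[of z] that by (simp add: abs_le_iff)
    qed (use t in auto)
    then show ?thesis by (simp add: B_def)
  qed
  have zero: "(LINT x|lebesgue_on \<Omega>. \<beta> (F n x) *\<^sub>R dF n x) = 0" for n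
  proof -
    have C1: "C1_gradient (\<lambda>x. B (F n x)) (\<lambda>x. \<beta> (F n x) *\<^sub>R dF n x)"
      by (rule C1_gradient_compose[OF D(1) B \<beta>(1)])
    have "(\<lambda>x. B (F n x)) \<in> C1_compact_support \<Omega>"
      by (rule C1_compact_support_dominated[OF V C1]) (rule Bz[OF FV])
    from integral_compact_support_gradient[OF this C1] show ?thesis .
  qed
  obtain r where r: "strict_mono r" "AE x in lebesgue_on \<Omega>. (\<lambda>n. F (r n) x) \<longlonglongrightarrow> u x"
    by (rule Lp_tendsto_AE_subseq[OF p_pos D(2)])
  have \<beta>m: "\<beta> \<in> borel_measurable borel" by (rule borel_measurable_continuous_onI[OF \<beta>(1)])
  have "Lp_tendsto (lebesgue_on \<Omega>) p (\<lambda>n x. \<beta> (F (r n) x) *\<^sub>R dF (r n) x) (\<lambda>x. \<beta> (u x) *\<^sub>R g x)"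
  proof (rule Lp_tendsto_scaleR[OF p_pos Lp_tendsto_subseq[OF D(3) r(1)], where C = C])
    show "(\<lambda>x. \<beta> (F (r n) x)) \<in> borel_measurable (lebesgue_on \<Omega>)" for n
      by (rule measurable_compose[OF LpD(1)[OF Lp_tendstoD(1)[OF D(2)]] \<beta>m])
    show "(\<lambda>x. \<beta> (u x)) \<in> borel_measurable (lebesgue_on \<Omega>)"
      by (rule measurable_compose[OF D(6) \<beta>m])
    show "AE x in lebesgue_on \<Omega>. (\<lambda>n. \<beta> (F (r n) x)) \<longlonglongrightarrow> \<beta> (u x)"
      using r(2)
    proof eventually_elim
      case (elim x)
      show ?case by (rule continuous_on_tendsto_compose[OF \<beta>(1) elim]) auto
    qed
  qed (rule \<beta>(2))
  from Lp_tendsto_integral[OF p_ge_1 this]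
  have "(\<lambda>n. 0) \<longlonglongrightarrow> (LINT x|lebesgue_on \<Omega>. \<beta> (u x) *\<^sub>R g x)" unfolding zero .
  then show ?thesis by (rule LIMSEQ_unique[OF _ tendsto_const])
qed

text \<open>Bounded pointwise limits are reached by dominated convergence with
  \<open>norm (g x)\<close> as majorant; this leads from continuous coefficients to indicators of
  sets of levels.\<close>

lemma zero_flux_limit:
  assumes u: "W_tendsto \<Omega> p F dF u g" and V: "\<And>n. V n \<in> C1_compact_support \<Omega>"
    and FV: "\<And>n x. V n x = 0 \<Longrightarrow> \<bar>F n x\<bar> \<le> M"
    and \<beta>: "\<And>n. continuous_on UNIV (\<beta> n)" "\<And>n t. \<bar>\<beta> n t\<bar> \<le> 1" "\<And>n t. \<bar>t\<bar> \<le> M \<Longrightarrow> \<beta> n t = (0::real)"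
    and lim: "\<And>t. (\<lambda>n. \<beta> n t) \<longlonglongrightarrow> b t"
  shows "(LINT x|lebesgue_on \<Omega>. b (u x) *\<^sub>R g x) = 0"
proof -
  note D = W_tendstoD[OF u]
  have \<beta>m: "\<beta> n \<in> borel_measurable borel" for n by (rule borel_measurable_continuous_onI[OF \<beta>(1)])
  have bm: "b \<in> borel_measurable borel" by (rule borel_measurable_LIMSEQ_metric[OF \<beta>m]) (rule lim)
  have "(\<lambda>n. LINT x|lebesgue_on \<Omega>. \<beta> n (u x) *\<^sub>R g x) \<longlonglongrightarrow> (LINT x|lebesgue_on \<Omega>. b (u x) *\<^sub>R g x)"
  proof (rule integral_dominated_convergence[where w = "\<lambda>x. norm (g x)"])
    show "(\<lambda>x. b (u x) *\<^sub>R g x) \<in> borel_measurable (lebesgue_on \<Omega>)"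
      by (rule borel_measurable_scaleR[OF measurable_compose[OF D(6) bm] D(7)])
    show "(\<lambda>x. \<beta> n (u x) *\<^sub>R g x) \<in> borel_measurable (lebesgue_on \<Omega>)" for n
      by (rule borel_measurable_scaleR[OF measurable_compose[OF D(6) \<beta>m] D(7)])
    show "integrable (lebesgue_on \<Omega>) (\<lambda>x. norm (g x))" by (intro integrable_norm Lp_integrable[OF
        p_ge_1 D(5)])
    show "AE x in lebesgue_on \<Omega>. (\<lambda>n. \<beta> n (u x) *\<^sub>R g x) \<longlonglongrightarrow> b (u x) *\<^sub>R g x"
      by (intro AE_I2 tendsto_scaleR lim tendsto_const)
    show "AE x in lebesgue_on \<Omega>. norm (\<beta> n (u x) *\<^sub>R g x) \<le> norm (g x)" for n
      using \<beta>(2) by (intro AE_I2) (simp add: mult_left_le_one_le)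
  qed
  moreover have "(LINT x|lebesgue_on \<Omega>. \<beta> n (u x) *\<^sub>R g x) = 0" for n
    by (rule zero_flux_continuous[where V = V, OF u V FV \<beta>])
  ultimately have "(\<lambda>n. 0) \<longlonglongrightarrow> (LINT x|lebesgue_on \<Omega>. b (u x) *\<^sub>R g x)" by simp
  then show ?thesis by (rule LIMSEQ_unique[OF _ tendsto_const])
qed

text \<open>The sets \<open>A\<close> with this property contain the intervals and are closed under
  complement and countable disjoint union, which gives all Borel sets. Complements are taken
  relative to \<open>{t. M < \<bar>t\<bar>}\<close>, whence a separate identity for that whole
  set.\<close>

lemma zero_flux:
  assumes u: "W_tendsto \<Omega> p F dF u g" and V: "\<And>n. V n \<in> C1_compact_support \<Omega>"
    and FV: "\<And>n x. V n x = 0 \<Longrightarrow> \<bar>F n x\<bar> \<le> M" and A: "A \<in> sets borel"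
  shows "(LINT x|lebesgue_on \<Omega>. indicat_real (A \<inter> {t. M < \<bar>t\<bar>}) (u x) *\<^sub>R g x) = 0"
  using A
proof (induction A rule: borel_set_induct)
  case empty
  then show ?case by simp
next
  note D = W_tendstoD[OF u]
  have gi: "integrable (lebesgue_on \<Omega>) g" by (rule Lp_integrable[OF p_ge_1 D(5)])
  have M: "{t::real. M < \<bar>t\<bar>} \<in> sets borel" by measurable
  have ii: "integrable (lebesgue_on \<Omega>) (\<lambda>x. indicat_real A (u x) *\<^sub>R g x)" if "A \<in> sets borel" for A
    by (rule integrable_bounded_mult[OF gi, where C = 1])
       (use measurable_compose[OF D(6) borel_measurable_indicator[OF that]] in \<open>auto simp:
           indicator_def\<close>)
  \<comment> \<open>Continuous and increasing with \<open>n\<close> to the indicator of the positive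
    half-line; the indicators needed below are built from it.\<close>
  define ramp where "ramp n s = min 1 (real n * max 0 s)" for n :: nat and s
  have ramp: "continuous_on UNIV (ramp n)" "0 \<le> ramp n s" "ramp n s \<le> 1" "s \<le> 0 \<Longrightarrow> ramp n s
      = 0" for n s
    unfolding ramp_def by (auto intro!: continuous_intros)
  have ramp_lim: "(\<lambda>n. ramp n s) \<longlonglongrightarrow> (if s > 0 then 1 else 0)" for s
  proof (cases "s > 0")
    case True
    obtain N where N: "1 / s < real N" using reals_Archimedean2 by blast
    have "\<forall>\<^sub>F n in sequentially. ramp n s = 1"
      unfolding eventually_sequentially
    proof (intro exI[of _ N] allI impI)
      fix n assume "n \<ge> N"
      then have "1 / s < real n" using N by linarith
      then have "1 < real n * s" using True by (simp add: pos_divide_less_eq)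
      then show "ramp n s = 1" using True by (simp add: ramp_def)
    qed
    then show ?thesis using True by (simp add: tendsto_eventually)
  qed (simp add: ramp(4))
  {
    case (interval a b)
    \<comment> \<open>The first factor switches on for \<open>M < \<bar>t\<bar>\<close>; the
      argument of the second ramp is positive exactly outside \<open>{a..b}\<close>. The product
      tends to the indicator of the required set.\<close>
    define \<beta> where "\<beta> n t = ramp n (\<bar>t\<bar> - M) * (1 - ramp n (max (a - t) (t - b)))" for n t
    have "(LINT x|lebesgue_on \<Omega>. ((if \<bar>u x\<bar> - M > 0 then 1 else 0) * (1 - (if max (a - u x) (u x -
        b) > 0 then 1 else 0))) *\<^sub>R g x) = 0"
    proof (rule zero_flux_limit[where V = V, OF u V FV, where \<beta> = \<beta>])
      show "continuous_on UNIV (\<beta> n)" for n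
        unfolding \<beta>_def[abs_def] by (intro continuous_intros continuous_on_compose2[OF ramp(1)])
            auto
      show "\<bar>\<beta> n t\<bar> \<le> 1" for n t
        using ramp(2,3)[of n "\<bar>t\<bar> - M"] ramp(2,3)[of n "max (a - t) (t - b)"]
        unfolding \<beta>_def abs_mult by (intro mult_le_one) auto
      show "\<beta> n t = 0" if "\<bar>t\<bar> \<le> M" for n t using that ramp(4) by (simp add: \<beta>_def)
      show "(\<lambda>n. \<beta> n t) \<longlonglongrightarrow> (if \<bar>t\<bar> - M > 0 then 1 else 0) * (1 - (if max (a - t) (t - b) > 0 then 1
          else 0))" for t
        unfolding \<beta>_def by (intro tendsto_intros ramp_lim)
    qed
    moreover have "(if \<bar>t\<bar> - M > 0 then 1 else 0) * (1 - (if max (a - t) (t - b) > 0 then 1 else 0))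
        = indicat_real ({a..b} \<inter> {t. M < \<bar>t\<bar>}) t" for t
      by (auto simp: indicator_def max_def)
    ultimately show ?case by simp
  next
    case (compl A)
    have "(LINT x|lebesgue_on \<Omega>. (if \<bar>u x\<bar> - M > 0 then 1 else 0) *\<^sub>R g x) = 0"
    proof (rule zero_flux_limit[where V = V, OF u V FV, where \<beta> = "\<lambda>n t. ramp n (\<bar>t\<bar> - M)"])
      show "continuous_on UNIV (\<lambda>t. ramp n (\<bar>t\<bar> - M))" for n
        by (intro continuous_intros continuous_on_compose2[OF ramp(1)]) auto
      show "\<bar>ramp n (\<bar>t\<bar> - M)\<bar> \<le> 1" for n t
        using ramp(2,3)[of n "\<bar>t\<bar> - M"] by simp
      show "ramp n (\<bar>t\<bar> - M) = 0" if "\<bar>t\<bar> \<le> M" for n t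
        by (rule ramp(4)) (use that in simp)
    qed (assumption | rule ramp_lim)+
    moreover have "(if \<bar>t\<bar> - M > 0 then 1 else 0) = indicat_real {t. M < \<bar>t\<bar>} t" for t
      by (simp add: indicator_def)
    ultimately have "(LINT x|lebesgue_on \<Omega>. indicat_real {t. M < \<bar>t\<bar>} (u x) *\<^sub>R g x) = 0" by simp
    then have "(LINT x|lebesgue_on \<Omega>. indicat_real {t. M < \<bar>t\<bar>} (u x) *\<^sub>R g x - indicat_real (A \<inter>
        {t. M < \<bar>t\<bar>}) (u x) *\<^sub>R g x) = 0"
      using compl.IH ii[OF M] ii[OF sets.Int[OF compl.hyps M]] by simp
    moreover have "indicat_real {t. M < \<bar>t\<bar>} (u x) *\<^sub>R g x - indicat_real (A \<inter> {t. M < \<bar>t\<bar>}) (u x)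
        *\<^sub>R g x
       = indicat_real (- A \<inter> {t. M < \<bar>t\<bar>}) (u x) *\<^sub>R g x" for x
      by (auto simp: indicator_def)
    ultimately show ?case by simp
  next
    case (union f)
    define E where "E i = f i \<inter> {t. M < \<bar>t\<bar>}" for i
    have E: "E i \<in> sets borel" for i unfolding E_def using union(2) M by blast
    have UE: "(\<Union>i. f i) \<inter> {t. M < \<bar>t\<bar>} = (\<Union>i. E i)" by (auto simp: E_def)
    have disj: "E i \<inter> E j = {}" if "i \<noteq> j" for i j
      using union(1) that unfolding E_def disjoint_family_on_def by blast
    have sums: "(\<lambda>n. \<Sum>i<n. indicat_real (E i) t) \<longlonglongrightarrow> indicat_real (\<Union>i. E i) t" for t
      using indicator_sums[OF disj] unfolding sums_def .
    have le: "(\<Sum>i<n. indicat_real (E i) t) \<le> 1" for n t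
    proof -
      have "disjoint_family_on E {..<n}" unfolding disjoint_family_on_def using disj by blast
      then have "(\<Sum>i<n. indicat_real (E i) t) = indicat_real (\<Union>i<n. E i) t"
        by (intro indicator_UN_disjoint[symmetric]) simp_all
      also have "\<dots> \<le> 1" by (simp add: indicator_def)
      finally show ?thesis .
    qed
    have "(\<lambda>n. LINT x|lebesgue_on \<Omega>. (\<Sum>i<n. indicat_real (E i) (u x)) *\<^sub>R g x) \<longlonglongrightarrow>
        (LINT x|lebesgue_on \<Omega>. indicat_real (\<Union>i. E i) (u x) *\<^sub>R g x)"
    proof (rule integral_dominated_convergence[where w = "\<lambda>x. norm (g x)"])
      have "(\<Union>i. E i) \<in> sets borel" using E by blast
      then show "(\<lambda>x. indicat_real (\<Union>i. E i) (u x) *\<^sub>R g x) \<in> borel_measurable (lebesgue_on \<Omega>)"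
        by (rule borel_measurable_integrable[OF ii])
      show "(\<lambda>x. (\<Sum>i<n. indicat_real (E i) (u x)) *\<^sub>R g x) \<in> borel_measurable (lebesgue_on \<Omega>)" for n
        by (intro borel_measurable_scaleR borel_measurable_sum measurable_compose[OF D(6)
            borel_measurable_indicator[OF E]] D(7))
      show "AE x in lebesgue_on \<Omega>. (\<lambda>n. (\<Sum>i<n. indicat_real (E i) (u x)) *\<^sub>R g x)
          \<longlonglongrightarrow> indicat_real (\<Union>i. E i) (u x) *\<^sub>R g x"
        by (intro AE_I2 tendsto_scaleR sums tendsto_const)
      show "AE x in lebesgue_on \<Omega>. norm ((\<Sum>i<n. indicat_real (E i) (u x)) *\<^sub>R g x)
          \<le> norm (g x)" for n
        using le by (intro AE_I2) (simp add: mult_left_le_one_le sum_nonneg abs_of_nonneg)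
    qed (use gi in auto)
    moreover have "(LINT x|lebesgue_on \<Omega>. (\<Sum>i<n. indicat_real (E i) (u x)) *\<^sub>R g x) = 0" for n
    proof -
      have "(LINT x|lebesgue_on \<Omega>. (\<Sum>i<n. indicat_real (E i) (u x)) *\<^sub>R g x)
          = (\<Sum>i<n. LINT x|lebesgue_on \<Omega>. indicat_real (E i) (u x) *\<^sub>R g x)"
        unfolding scaleR_sum_left by (rule Bochner_Integration.integral_sum) (rule ii[OF E])
      also have "\<dots> = 0" using union(3) by (simp add: E_def)
      finally show ?thesis .
    qed
    ultimately have "(\<lambda>n::nat. 0) \<longlonglongrightarrow> (LINT x|lebesgue_on \<Omega>. indicat_real (\<Union>i. E i) (u x) *\<^sub>R g x)"
        by simp
    then show ?case unfolding UE by (rule LIMSEQ_unique[OF _ tendsto_const])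
  }
qed

end

subsection \<open>Levels and sawtooth functions\<close>

text \<open>Let \<open>A t\<close> be the set where \<open>t \<le> u x\<close>, and suppose
  \<open>e < f t * measure M (A t)\<close> for all \<open>t \<ge> T\<close>. For \<open>x\<close> in
  \<open>A s\<close> the choice \<open>t = u x\<close>, together with the inclusion of
  \<open>A (u x)\<close> in \<open>A s\<close>, gives
  \<open>e \<le> f (u x) * measure M (A s)\<close>. Integrating over \<open>A s\<close> and dividing
  by its measure bounds the integral of \<open>f (u x)\<close> over \<open>A s\<close> below by
  \<open>e\<close>, although it tends to 0 as \<open>s\<close> grows.\<close>

lemma (in finite_measure) small_level_exists:
  fixes f :: "real \<Rightarrow> real" and u :: "'a \<Rightarrow> real"
  assumes u: "u \<in> borel_measurable M" and f: "\<And>t. 0 \<le> f t" and fu: "integrable M (\<lambda>x. f (u x))"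
      and e: "e > 0"
  shows "\<exists>t\<ge>T. f t * measure M {x \<in> space M. t \<le> u x} \<le> e"
proof (rule ccontr)
  define A where "A t = {x \<in> space M. t \<le> u x}" for t
  have A[measurable]: "A t \<in> sets M" for t unfolding A_def using u by measurable
  assume "\<not> (\<exists>t\<ge>T. f t * measure M {x \<in> space M. t \<le> u x} \<le> e)"
  then have big: "e < f t * measure M (A t)" if "t \<ge> T" for t
    using that unfolding A_def by (meson not_le)
  have "(\<lambda>n. LINT x|M. indicator (A (T + real n)) x * f (u x)) \<longlonglongrightarrow> (LINT x|M. 0)"
  proof (rule integral_dominated_convergence[where w = "\<lambda>x. f (u x)"])
    show "AE x in M. (\<lambda>n. indicator (A (T + real n)) x * f (u x)) \<longlonglongrightarrow> 0"
    proof (intro AE_I2 tendsto_eventually)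
      fix x
      obtain N where N: "u x - T < real N" using reals_Archimedean2 by blast
      show "\<forall>\<^sub>F n in sequentially. indicator (A (T + real n)) x * f (u x) = 0"
        unfolding eventually_sequentially by (intro exI[of _ N]) (use N in \<open>auto simp: A_def
            indicator_def\<close>)
    qed
    show "AE x in M. norm (indicator (A (T + real n)) x * f (u x)) \<le> f (u x)" for n
      using f by (intro AE_I2) (simp add: indicator_def)
  qed (use fu in auto)
  then have "\<forall>\<^sub>F n in sequentially. (LINT x|M. indicator (A (T + real n)) x * f (u x)) < e"
    using e by (intro order_tendstoD(2)) auto
  then obtain n where n: "(LINT x|M. indicator (A (T + real n)) x * f (u x)) < e"
      by (auto simp: eventually_sequentially)
  define s where "s = T + real n"
  have s: "s \<ge> T" by (simp add: s_def)
  have m0: "measure M (A s) > 0"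
    using big[OF s] e f[of s] by (metis less_asym measure_nonneg mult_zero_right order_less_le)
  have "e * measure M (A s) = (LINT x|M. e * indicator (A s) x)" by simp
  also have "\<dots> \<le> (LINT x|M. (indicator (A s) x * f (u x)) * measure M (A s))"
  proof (rule integral_mono)
    show "integrable M (\<lambda>x. e * indicator (A s) x)" by (intro integrable_mult_right
        integrable_real_indicator) (auto simp: emeasure_eq_measure)
    have "integrable M (\<lambda>x. indicat_real (A s) x *\<^sub>R f (u x))"
        by (rule integrable_mult_indicator[OF A fu])
    then show "integrable M (\<lambda>x. (indicator (A s) x * f (u x)) * measure M (A s))" by simp
    fix x assume x: "x \<in> space M"
    show "e * indicator (A s) x \<le> (indicator (A s) x * f (u x)) * measure M (A s)"
    proof (cases "x \<in> A s")
      case True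
      then have "s \<le> u x" by (simp add: A_def)
      then have "A (u x) \<subseteq> A s" by (auto simp: A_def)
      then have "measure M (A (u x)) \<le> measure M (A s)" by (rule finite_measure_mono) simp
      then have "f (u x) * measure M (A (u x)) \<le> f (u x) * measure M (A s)" using f
          by (intro mult_left_mono) auto
      then show ?thesis using big[of "u x"] s \<open>s \<le> u x\<close> True by simp
    qed simp
  qed
  also have "\<dots> = (LINT x|M. indicator (A s) x * f (u x)) * measure M (A s)" by simp
  also have "\<dots> < e * measure M (A s)" using n m0 by (simp add: s_def)
  finally show False by simp
qed

text \<open>A gradient is assigned at every point, kinks included, as the pointwise limit of
  classical gradients. The class is therefore stable under maximum and minimum with gradients
  staying in a prescribed set everywhere. The explicit uniform error \<open>e\<close> determines the
  smoothing scale when maxima are formed.\<close>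

definition uniform_C1_limit :: "('a::euclidean_space \<Rightarrow> real) \<Rightarrow> ('a \<Rightarrow> 'a) \<Rightarrow> bool" where
  "uniform_C1_limit f g \<longleftrightarrow> (\<exists>F dF e C. (\<forall>n::nat. C1_gradient (F n) (dF n)) \<and> e \<longlonglongrightarrow> 0 \<and>
     (\<forall>n x. \<bar>F n x - f x\<bar> \<le> e n) \<and> (\<forall>n x. norm (dF n x) \<le> C) \<and> (\<forall>x. (\<lambda>n. dF n x) \<longlonglongrightarrow> g x))"

lemma uniform_C1_limit_affine: "uniform_C1_limit (\<lambda>x. c + a \<bullet> (x - b)) (\<lambda>_. a)"
  unfolding uniform_C1_limit_def
  by (intro exI[of _ "\<lambda>n x. c + a \<bullet> (x - b)"] exI[of _ "\<lambda>n x. a"] exI[of _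
      "\<lambda>_. 0"] exI[of _ "norm a"])
     (auto intro: C1_gradient_affine)

lemma uniform_C1_limit_uminus:
  assumes "uniform_C1_limit f g"
  shows "uniform_C1_limit (\<lambda>x. - f x) (\<lambda>x. - g x)"
proof -
  obtain F dF e C where F: "\<forall>n::nat. C1_gradient (F n) (dF n)" "e \<longlonglongrightarrow> 0" "\<forall>n x. \<bar>F n x - f x\<bar> \<le> e n"
    "\<forall>n x. norm (dF n x) \<le> C" "\<forall>x. (\<lambda>n. dF n x) \<longlonglongrightarrow> g x"
    using assms unfolding uniform_C1_limit_def by blast
  show ?thesis
    unfolding uniform_C1_limit_def
  proof (intro exI[of _ "\<lambda>n x. - F n x"] exI[of _ "\<lambda>n x. - dF n x"] exI[of _ e] exI[of _ C] conjI
      allI)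
    show "C1_gradient (\<lambda>x. - F n x) (\<lambda>x. - dF n x)" for n using F(1)
        by (intro C1_gradient_uminus) blast
    show "\<bar>- F n x - - f x\<bar> \<le> e n" for n x using F(3)[rule_format, of n x]
        by (simp add: abs_minus_commute)
    show "(\<lambda>n. - dF n x) \<longlonglongrightarrow> - g x" for x by (intro tendsto_minus F(5)[rule_format])
  qed (use F in auto)
qed

text \<open>Smoothing the maximum at the scale \<open>\<surd>\<eta>\<^sub>n\<close>, where \<open>\<eta>\<^sub>n\<close> is the uniform error, makes the
  gradients converge everywhere, on the contact set \<open>f = f'\<close> as well.\<close>

lemma uniform_C1_limit_max:
  assumes "uniform_C1_limit f g" "uniform_C1_limit f' g'"
  shows "uniform_C1_limit (\<lambda>x. max (f x) (f' x)) (\<lambda>x. if f' x > f x then g' x else g x)"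
proof -
  obtain F dF e C where F: "\<forall>n::nat. C1_gradient (F n) (dF n)" "e \<longlonglongrightarrow> 0" "\<forall>n x. \<bar>F n x - f x\<bar> \<le> e n"
    "\<forall>n x. norm (dF n x) \<le> C" "\<forall>x. (\<lambda>n. dF n x) \<longlonglongrightarrow> g x"
    using assms(1) unfolding uniform_C1_limit_def by blast
  obtain F' dF' e' C' where F': "\<forall>n::nat. C1_gradient (F' n) (dF' n)" "e' \<longlonglongrightarrow> 0"
      "\<forall>n x. \<bar>F' n x - f' x\<bar> \<le> e' n"
    "\<forall>n x. norm (dF' n x) \<le> C'" "\<forall>x. (\<lambda>n. dF' n x) \<longlonglongrightarrow> g' x"
    using assms(2) unfolding uniform_C1_limit_def by blast
  \<comment> \<open>The last term keeps \<eta> positive when both approximations are exact, as for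
    affine functions.\<close>
  define \<eta> where "\<eta> n = e n + e' n + 1 / real (Suc n)" for n
  define d where "d n = sqrt (\<eta> n)" for n
  have e0: "0 \<le> e n" "0 \<le> e' n" for n
    using F(3)[rule_format, of n undefined] F'(3)[rule_format, of n undefined] by auto
  have \<eta>: "\<eta> n > 0" "e n + e' n \<le> \<eta> n" for n using e0[of n] unfolding \<eta>_def
      by (auto intro!: add_nonneg_pos)
  have \<eta>0: "\<eta> \<longlonglongrightarrow> 0"
    using tendsto_add[OF tendsto_add[OF F(2) F'(2)] LIMSEQ_Suc[OF lim_const_over_n[of "1::real"]]]
        by (simp add: \<eta>_def[abs_def])
  have d: "d n > 0" for n using \<eta> by (simp add: d_def)
  have d0: "d \<longlonglongrightarrow> 0" using tendsto_real_sqrt[OF \<eta>0] by (simp add: d_def[abs_def])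
  have diff: "\<bar>(F' n x - F n x) - (f' x - f x)\<bar> \<le> \<eta> n" for n x
    using F(3)[rule_format, of n x] F'(3)[rule_format, of n x] \<eta>(2)[of n] by linarith
  define b where "b n x = smooth_pos_deriv (d n) (F' n x - F n x)" for n x
  have b: "0 \<le> b n x" "b n x \<le> 1" for n x unfolding b_def using smooth_pos_deriv_bounds[OF d]
      by blast+
  have blim: "(\<lambda>n. b n x) \<longlonglongrightarrow> (if f' x > f x then 1 else 0)" for x
  proof (cases "f' x > f x")
    case True
    have "(\<lambda>n. F' n x - F n x) \<longlonglongrightarrow> f' x - f x"
      by (rule LIM_zero_cancel, rule Lim_null_comparison[OF _ \<eta>0]) (use diff in simp)
    from smooth_pos_deriv_tendsto[OF this d0] True show ?thesis by (simp add: b_def)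
  next
    case False
    \<comment> \<open>Here \<open>f' x \<le> f x\<close>, so the positive part of
      \<open>F' n x - F n x\<close> is at most \<open>\<eta> n\<close>; divided by
      \<open>d n\<close>, the square root of \<open>\<eta> n\<close>, it leaves
      \<open>d n\<close>.\<close>
    have "b n x \<le> d n" for n
    proof -
      define m where "m = max 0 (F' n x - F n x)"
      have m: "0 \<le> m" "m \<le> \<eta> n" using diff[of n x] False \<eta>(1)[of n] by (auto simp: m_def)
      have "d n \<le> sqrt (m\<^sup>2 + (d n)\<^sup>2)" by (rule real_le_rsqrt) simp
      then have "b n x \<le> m / d n"
        unfolding b_def smooth_pos_deriv_def m_def[symmetric] using d[of n] m(1)
        by (intro divide_left_mono mult_pos_pos) (auto intro: add_nonneg_pos)
      also have "\<dots> \<le> \<eta> n / d n" using m(2) d[of n] by (intro divide_right_mono) auto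
      also have "\<dots> = d n" using \<eta>(1)[of n] unfolding d_def by (simp add: real_div_sqrt)
      finally show ?thesis .
    qed
    then have "(\<lambda>n. b n x) \<longlonglongrightarrow> 0"
      by (intro tendsto_sandwich[OF _ _ tendsto_const d0] always_eventually allI b)
    then show ?thesis using False by simp
  qed
  define H where "H n x = F n x + smooth_pos (d n) (F' n x - F n x)" for n x
  define dH where "dH n x = dF n x + b n x *\<^sub>R (dF' n x - dF n x)" for n x
  show ?thesis
    unfolding uniform_C1_limit_def
  proof (intro exI[of _ H] exI[of _ dH] exI[of _ "\<lambda>n. e n + (d n + \<eta> n)"] exI[of _ "C + (C'
      + C)"] conjI allI)
    show "C1_gradient (H n) (dH n)" for n
      unfolding H_def[abs_def] dH_def[abs_def] b_def
      by (intro C1_gradient_add C1_gradient_smooth_pos[OF d] C1_gradient_diff F(1)[rule_format]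
          F'(1)[rule_format])
    show "(\<lambda>n. e n + (d n + \<eta> n)) \<longlonglongrightarrow> 0" by (intro tendsto_add_zero F(2) d0 \<eta>0)
    show "\<bar>H n x - max (f x) (f' x)\<bar> \<le> e n + (d n + \<eta> n)" for n x
    proof -
      have "\<bar>max 0 (F' n x - F n x) - max 0 (f' x - f x)\<bar> \<le> \<eta> n" using diff[of n x]
          by (auto simp: max_def)
      moreover have "\<bar>smooth_pos (d n) (F' n x - F n x) - max 0 (F' n x - F n x)\<bar> \<le> d n"
          by (rule smooth_pos_close[OF d])
      moreover have "max (f x) (f' x) = f x + max 0 (f' x - f x)" by (simp add: max_def)
      ultimately show ?thesis using F(3)[rule_format, of n x] unfolding H_def by linarith
    qed
    show "norm (dH n x) \<le> C + (C' + C)" for n x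
    proof -
      have "norm (b n x *\<^sub>R (dF' n x - dF n x)) \<le> norm (dF' n x - dF n x)"
        using b[of n x] by (simp add: mult_left_le_one_le)
      also have "\<dots> \<le> norm (dF' n x) + norm (dF n x)" by (rule norm_triangle_ineq4)
      finally show ?thesis
        unfolding dH_def using F(4)[rule_format, of n x] F'(4)[rule_format, of n x]
          norm_triangle_ineq[of "dF n x" "b n x *\<^sub>R (dF' n x - dF n x)"] by linarith
    qed
    show "(\<lambda>n. dH n x) \<longlonglongrightarrow> (if f' x > f x then g' x else g x)" for x
    proof -
      have "(\<lambda>n. dH n x) \<longlonglongrightarrow> g x + (if f' x > f x then 1 else 0) *\<^sub>R (g' x - g x)"
        unfolding dH_def by (intro tendsto_intros blim F(5)[rule_format] F'(5)[rule_format])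
      then show ?thesis by (simp split: if_splits)
    qed
  qed
qed

lemma uniform_C1_limit_Max:
  assumes "finite I" "I \<noteq> {}" "\<And>i. i \<in> I \<Longrightarrow> \<exists>g. uniform_C1_limit (f i) g \<and> range g \<subseteq> S"
  shows "\<exists>g. uniform_C1_limit (\<lambda>x. MAX i\<in>I. f i x) g \<and> range g \<subseteq> S"
  using assms
proof (induction I rule: finite_ne_induct)
  case (singleton i)
  then show ?case by simp
next
  case (insert i I)
  obtain g where g: "uniform_C1_limit (\<lambda>x. MAX i\<in>I. f i x) g" "range g \<subseteq> S" using insert by auto
  obtain g' where g': "uniform_C1_limit (f i) g'" "range g' \<subseteq> S"
    using insert.prems[of i] by auto
  have "(\<lambda>x. MAX j\<in>insert i I. f j x) = (\<lambda>x. max (f i x) (MAX i\<in>I. f i x))"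
    using insert.hyps by auto
  then show ?case
    using uniform_C1_limit_max[OF g'(1) g(1)] g(2) g'(2)
    by (intro exI[of _ "\<lambda>x. if (MAX i\<in>I. f i x) > f i x then g x else g' x"]) auto
qed

lemma uniform_C1_limit_Min:
  assumes I: "finite I" "I \<noteq> {}" and f: "\<And>i. i \<in> I \<Longrightarrow> \<exists>g. uniform_C1_limit (f i) g \<and> range g \<subseteq> S"
  shows "\<exists>g. uniform_C1_limit (\<lambda>x. MIN i\<in>I. f i x) g \<and> range g \<subseteq> S"
proof -
  have "\<exists>g. uniform_C1_limit (\<lambda>x. - f i x) g \<and> range g \<subseteq> uminus ` S" if i: "i \<in> I" for i
  proof -
    obtain g where "uniform_C1_limit (f i) g" "range g \<subseteq> S" using f[OF i] by blast
    then show ?thesis by (intro exI[of _ "\<lambda>x. - g x"]) (auto intro: uniform_C1_limit_uminus)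
  qed
  from uniform_C1_limit_Max[of I "\<lambda>i x. - f i x", OF I this]
  obtain g where g: "uniform_C1_limit (\<lambda>x. MAX i\<in>I. - f i x) g" "range g \<subseteq> uminus ` S" by blast
  have "- (MAX i\<in>I. - f i x) = (MIN i\<in>I. f i x)" for x
    using I by (simp add: image_image)
  then show ?thesis
    using uniform_C1_limit_uminus[OF g(1)] g(2) by (intro exI[of _ "\<lambda>x. - g x"]) auto
qed

text \<open>\<open>h y\<close> is a cone with vertex \<open>y\<close>. It stays above
  \<open>t\<close>, because the numbers \<open>\<xi> i \<bullet> (x - y)\<close> have weighted
  average 0 and cannot all be negative, and it is at most \<open>t + \<delta>\<close> within
  distance \<open>\<delta> / B\<close> of \<open>y\<close>. The minimum over vertices forming a
  finite net keeps the lower bound everywhere and obeys the upper bound on all of \<Omega>.\<close>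

lemma sawtooth_exists:
  fixes \<xi> :: "'i \<Rightarrow> 'a::euclidean_space"
  assumes I: "finite I" "I \<noteq> {}" and lam: "\<And>i. i \<in> I \<Longrightarrow> 0 < lam i" "(\<Sum>i\<in>I. lam i *\<^sub>R \<xi> i) = 0"
    and \<Omega>: "bounded \<Omega>" and \<delta>: "\<delta> > 0"
  obtains w g where "uniform_C1_limit w g" "range g \<subseteq> \<xi> ` I" "\<And>x. t \<le> w x" "\<And>x. x \<in> \<Omega> \<Longrightarrow> w x \<le> t + \<delta>"
proof -
  \<comment> \<open>A common bound for the slopes; the added 1 keeps it positive when all the
    vectors are 0.\<close>
  define B where "B = (\<Sum>i\<in>I. norm (\<xi> i)) + 1"
  have B: "B > 0" unfolding B_def by (auto intro!: add_nonneg_pos sum_nonneg)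
  have \<xi>B: "norm (\<xi> i) \<le> B" if "i \<in> I" for i
    using member_le_sum[of i I "\<lambda>i. norm (\<xi> i)"] I(1) that by (simp add: B_def)
  have "compact (closure \<Omega>)" using \<Omega> by simp
  then obtain k where k: "finite k" "closure \<Omega> \<subseteq> (\<Union>x\<in>k. ball x (\<delta> / B))"
    unfolding compact_eq_totally_bounded using \<delta> B by (meson divide_pos_pos)
  \<comment> \<open>The vertex 0 keeps the minimum well defined when the net is empty; an additional
    vertex can only lower \<open>w\<close>.\<close>
  define Y where "Y = insert 0 k"
  have Y: "finite Y" "Y \<noteq> {}" using k by (simp_all add: Y_def)
  define h where "h y x = (MAX i\<in>I. t + \<xi> i \<bullet> (x - y))" for x y
  define w where "w x = (MIN y\<in>Y. h y x)" for x
  have "\<exists>g. uniform_C1_limit (h y) g \<and> range g \<subseteq> \<xi> ` I" for y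
    unfolding h_def
  proof (rule uniform_C1_limit_Max[OF I])
    show "\<exists>g. uniform_C1_limit (\<lambda>x. t + \<xi> i \<bullet> (x - y)) g \<and> range g \<subseteq> \<xi> ` I" if "i \<in> I" for i
      using that by (intro exI[of _ "\<lambda>_. \<xi> i"] conjI uniform_C1_limit_affine) auto
  qed
  then obtain g where g: "uniform_C1_limit w g" "range g \<subseteq> \<xi> ` I"
    using uniform_C1_limit_Min[OF Y, of h "\<xi> ` I"] unfolding w_def[abs_def] by blast
  have h0: "t \<le> h y x" for y x
  proof (rule ccontr)
    assume "\<not> t \<le> h y x"
    then have "\<forall>i\<in>I. \<xi> i \<bullet> (x - y) < 0" unfolding h_def using I by (simp add: not_le)
    then have "(\<Sum>i\<in>I. lam i * (\<xi> i \<bullet> (x - y))) < (\<Sum>i\<in>I. 0)"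
      using I lam(1) by (intro sum_strict_mono) (auto simp: mult_pos_neg)
    moreover have "(\<Sum>i\<in>I. lam i * (\<xi> i \<bullet> (x - y))) = (\<Sum>i\<in>I. lam i *\<^sub>R \<xi> i) \<bullet> (x - y)"
      by (simp add: inner_sum_left)
    ultimately show False using lam(2) by simp
  qed
  have w0: "t \<le> w x" for x using Y h0 by (simp add: w_def)
  have "w x \<le> t + \<delta>" if x: "x \<in> \<Omega>" for x
  proof -
    have "x \<in> closure \<Omega>" using x closure_subset by blast
    then obtain y where y: "y \<in> k" "dist y x < \<delta> / B" using k(2) by auto
    have "w x \<le> h y x" unfolding w_def using Y y by (intro Min_le) (auto simp: Y_def)
    also have "\<dots> \<le> t + \<delta>"
      unfolding h_def
    proof (intro Max.boundedI)
      fix a assume "a \<in> (\<lambda>i. t + \<xi> i \<bullet> (x - y)) ` I"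
      then obtain i where i: "i \<in> I" "a = t + \<xi> i \<bullet> (x - y)" by auto
      have "\<xi> i \<bullet> (x - y) \<le> norm (\<xi> i) * norm (x - y)" by (rule norm_cauchy_schwarz)
      also have "\<dots> \<le> B * (\<delta> / B)" using \<xi>B[OF i(1)] y(2) B
          by (intro mult_mono) (auto simp: dist_norm norm_minus_commute)
      also have "\<dots> = \<delta>" using B by simp
      finally show "a \<le> t + \<delta>" unfolding i(2) by simp
    qed (use I in auto)
    finally show ?thesis .
  qed
  from that[OF g w0 this] show thesis .
qed

section \<open>Sawtooth functions as Sobolev limits\<close>

context bounded_domain
begin

text \<open>Dropping finitely many approximations makes the uniform error at most \<eta> from the
  start. It holds on the whole space because the approximations will be compared with the level
  \<open>M\<close> at every point.\<close>

lemma uniform_C1_limit_W_tendsto: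
  assumes f: "uniform_C1_limit f g" and b: "\<And>x. x \<in> \<Omega> \<Longrightarrow> \<bar>f x\<bar> \<le> C" and \<eta>: "\<eta> > 0"
  obtains F dF where "W_tendsto \<Omega> p F dF f g" "\<And>n x. \<bar>F n x - f x\<bar> \<le> \<eta>"
proof -
  obtain F dF e D where F: "\<forall>n::nat. C1_gradient (F n) (dF n)" "e \<longlonglongrightarrow> 0" "\<forall>n x. \<bar>F n x - f x\<bar> \<le> e n"
    "\<forall>n x. norm (dF n x) \<le> D" "\<forall>x. (\<lambda>n. dF n x) \<longlonglongrightarrow> g x"
    using f unfolding uniform_C1_limit_def by blast
  have "\<forall>\<^sub>F n in sequentially. e n < \<eta>" using F(2) \<eta> by (rule order_tendstoD)
  then obtain N where N: "\<And>n. n \<ge> N \<Longrightarrow> e n < \<eta>" by (auto simp: eventually_sequentially)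
  define F' where "F' n = F (n + N)" for n
  define dF' where "dF' n = dF (n + N)" for n
  have C1: "C1_gradient (F' n) (dF' n)" for n using F(1) by (simp add: F'_def dF'_def)
  have close: "\<bar>F' n x - f x\<bar> \<le> \<eta>" for n x
    using F(3)[rule_format, of "n + N" x] N[of "n + N"] by (simp add: F'_def)
  have lim: "(\<lambda>n. F' n x) \<longlonglongrightarrow> f x" for x
    unfolding F'_def
    by (rule LIMSEQ_ignore_initial_segment, rule LIM_zero_cancel, rule Lim_null_comparison[OF _
        F(2)]) (use F(3) in simp)
  have dlim: "(\<lambda>n. dF' n x) \<longlonglongrightarrow> g x" for x
    unfolding dF'_def by (rule LIMSEQ_ignore_initial_segment) (use F(5) in blast)
  have m: "F' n \<in> borel_measurable (lebesgue_on \<Omega>)" "dF' n \<in> borel_measurable (lebesgue_on \<Omega>)" for n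
    by (rule measurable_lebesgue_on_continuous C1_gradientD(1,4)[OF C1])+
  have fm: "f \<in> borel_measurable (lebesgue_on \<Omega>)" "g \<in> borel_measurable (lebesgue_on \<Omega>)"
    by (rule borel_measurable_LIMSEQ_metric[OF m(1) lim] borel_measurable_LIMSEQ_metric[OF m(2)
        dlim])+
  have const: "Lp (lebesgue_on \<Omega>) p (\<lambda>_. c)" for c :: real
      by (rule Lp_continuous) (rule continuous_on_const)
  have "W_tendsto \<Omega> p F' dF' f g"
    unfolding W_tendsto_def
  proof (intro conjI allI C1)
    show "Lp_tendsto (lebesgue_on \<Omega>) p F' f"
    proof (rule Lp_tendsto_dominated[OF p_pos const[of "C + \<eta>"] m(1) fm(1)])
      have "norm (F' n x) \<le> norm (C + \<eta>)" if "x \<in> \<Omega>" for n x using b[OF that] close[of n x] by simp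
      then show "AE x in lebesgue_on \<Omega>. norm (F' n x) \<le> norm (C + \<eta>)" for n by (intro AE_I2) simp
      show "AE x in lebesgue_on \<Omega>. (\<lambda>n. F' n x) \<longlonglongrightarrow> f x" by (intro AE_I2 lim)
    qed
    show "Lp_tendsto (lebesgue_on \<Omega>) p dF' g"
    proof (rule Lp_tendsto_dominated[OF p_pos const[of D] m(2) fm(2)])
      have "norm (dF' n x) \<le> norm D" for n x using F(4)[rule_format, of "n + N" x]
          by (simp add: dF'_def)
      then show "AE x in lebesgue_on \<Omega>. norm (dF' n x) \<le> norm D" for n by (intro AE_I2)
      show "AE x in lebesgue_on \<Omega>. (\<lambda>n. dF' n x) \<longlonglongrightarrow> g x" by (intro AE_I2 dlim)
    qed
  qed
  from that[OF this close] show thesis .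
qed

end

subsection \<open>Integrability and regularity\<close>

context bounded_domain
begin

text \<open>The approximations are mollifications of \<phi>, which inherit its essential bound, plus
  compactly supported \<open>V n\<close> for the remaining part. Where \<open>V n\<close> is 0 only
  the bounded summand is left.\<close>

lemma sobolev_affine_approx:
  assumes \<phi>: "\<phi> \<in> sobolev UNIV p \<inter> Linf_space UNIV" and u: "u \<in> sobolev_affine \<Omega> p \<phi>"
  obtains F dF g V M where "W_tendsto \<Omega> p F dF u g" "\<And>n. V n \<in> C1_compact_support \<Omega>"
    "\<And>n x. V n x = 0 \<Longrightarrow> \<bar>F n x\<bar> \<le> M" "0 \<le> M"
proof -
  obtain G where G: "Lp lebesgue p \<phi>" "Lp lebesgue p G" "is_weak_gradient UNIV \<phi> G"
    using \<phi> by (auto simp: sobolev_def Lp_space_iff lebesgue_on_UNIV_eq)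
  obtain C where C: "AE x in lebesgue. \<bar>\<phi> x\<bar> \<le> C"
    using \<phi> unfolding Linf_space_def lebesgue_on_UNIV_eq by blast
  have C': "AE x in lebesgue. \<bar>\<phi> x\<bar> \<le> max 0 C" using C by eventually_elim simp
  obtain \<Phi> d\<Phi> where \<Phi>: "W_tendsto \<Omega> p \<Phi> d\<Phi> \<phi> G" "\<And>n x. \<bar>\<Phi> n x\<bar> \<le> max 0 C"
    by (rule bounded_sobolev_approx[OF G C' max.cobounded1]) blast
  obtain v where v: "v \<in> sobolev0 \<Omega> p" "u = (\<lambda>x. \<phi> x + v x)" using u
      by (auto simp: sobolev_affine_def)
  obtain V dV gv where V: "W_tendsto \<Omega> p V dV v gv" "\<And>n. V n \<in> C1_compact_support \<Omega>"
    by (rule sobolev0_imp_W_tendsto[OF v(1)]) blast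
  show thesis
  proof (rule that[of "\<lambda>n x. \<Phi> n x + V n x" "\<lambda>n x. d\<Phi> n x + dV n x" "\<lambda>x. G x + gv x" V "max 0 C"])
    show "W_tendsto \<Omega> p (\<lambda>n x. \<Phi> n x + V n x) (\<lambda>n x. d\<Phi> n x + dV n x) u (\<lambda>x. G x + gv x)"
      unfolding v(2) by (rule W_tendsto_add[OF p_nonneg \<Phi>(1) V(1)])
  qed (use V(2) \<Phi>(2) in auto)
qed

lemma sobolev_affine_add:
  assumes u: "u \<in> sobolev_affine \<Omega> p \<phi>" and z: "W_tendsto \<Omega> p H dH z gz"
      "\<And>n. H n \<in> C1_compact_support \<Omega>"
  shows "(\<lambda>x. u x + z x) \<in> sobolev_affine \<Omega> p \<phi>"
proof -
  obtain v where v: "v \<in> sobolev0 \<Omega> p" "u = (\<lambda>x. \<phi> x + v x)" using u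
      by (auto simp: sobolev_affine_def)
  obtain V dV gv where V: "W_tendsto \<Omega> p V dV v gv" "\<And>n. V n \<in> C1_compact_support \<Omega>"
    by (rule sobolev0_imp_W_tendsto[OF v(1)]) blast
  have "(\<lambda>x. v x + z x) \<in> sobolev0 \<Omega> p"
    by (rule W_tendsto_imp_sobolev0[OF W_tendsto_add[OF p_nonneg V(1) z(1)]]) (rule
        C1_compact_support_add[OF V(2) z(2)])
  moreover have "(\<lambda>x. u x + z x) = (\<lambda>x. \<phi> x + (v x + z x))" unfolding v(2) by (simp add: add.assoc)
  ultimately show ?thesis
    unfolding sobolev_affine_def using rev_image_eqI[of "\<lambda>x. v x + z x"] by simp
qed

lemma measurable_integrand:
  fixes H :: "real \<times> 'a \<Rightarrow> real"
  assumes H: "continuous_on UNIV H" and "v \<in> borel_measurable (lebesgue_on \<Omega>)" "g \<in> borel_measurable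
      (lebesgue_on \<Omega>)"
  shows "(\<lambda>x. H (v x, g x)) \<in> borel_measurable (lebesgue_on \<Omega>)"
  by (rule measurable_compose[OF borel_measurable_Pair[OF assms(2,3)]
      borel_measurable_continuous_onI[OF H]])

text \<open>The slope \<open>b(t) = \<Sum>\<^sub>i \<lambda>\<^sub>i \<zeta>\<^sub>i\<^sub>,\<^sub>t\<close> need not depend measurably on \<open>t\<close>. It is replaced by the
  first point \<open>d(t)\<close> of a countable dense set for which the inequality holds up to an error \<open>|\<eta>|\<close>;
  this choice is Borel, and on each set where \<open>d(u)\<close> is constant \<open>\<langle>d(u), \<nabla>u\<rangle>\<close> integrates to zero
  (lemma \<open>zero_flux\<close>).\<close>

lemma convex_combination_integrable:
  fixes H :: "real \<times> 'a \<Rightarrow> real" and \<xi> :: "'i \<Rightarrow> 'a"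
  assumes u: "W_tendsto \<Omega> p F dF u g" and V: "\<And>n. V n \<in> C1_compact_support \<Omega>"
    and FV: "\<And>n x. V n x = 0 \<Longrightarrow> \<bar>F n x\<bar> \<le> M"
    and H: "continuous_on UNIV H" "\<And>z. 0 \<le> H z" and q: "q \<in> borel_measurable borel" "\<And>t. 0 \<le> q t"
    and I: "finite I" and lam: "\<And>i. i \<in> I \<Longrightarrow> 0 < lam i" "(\<Sum>i\<in>I. lam i) = 1"
    and \<zeta>: "\<And>t. \<exists>\<zeta>. (\<forall>i\<in>I. \<forall>\<eta>. H (t, \<eta>) \<ge> H (t, \<xi> i) + \<zeta> i \<bullet> (\<eta> - \<xi> i))
        \<and> (\<Sum>i\<in>I. lam i * (\<zeta> i \<bullet> \<xi> i)) \<le> q t"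
    and Hu: "integrable (lebesgue_on \<Omega>) (\<lambda>x. H (u x, g x))"
        and qu: "integrable (lebesgue_on \<Omega>) (\<lambda>x. q (u x))"
    and i: "i \<in> I"
  shows "integrable (lebesgue_on \<Omega>) (\<lambda>x. H (u x, \<xi> i))"
proof -
  let ?M = "lebesgue_on \<Omega>"
  note D = W_tendstoD[OF u]
  have um[measurable]: "u \<in> borel_measurable ?M" and gm[measurable]: "g \<in> borel_measurable ?M"
      by (rule D)+
  define S where "S t = (\<Sum>i\<in>I. lam i * H (t, \<xi> i))" for t
  have Hct: "continuous_on UNIV (\<lambda>t. H (t, \<eta>))" for \<eta>
    by (rule continuous_on_compose2[OF H(1)]) (auto intro!: continuous_intros)
  have Hc\<eta>: "continuous_on UNIV (\<lambda>\<eta>. H (t, \<eta>))" for t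
    by (rule continuous_on_compose2[OF H(1)]) (auto intro!: continuous_intros)
  have Sc: "continuous_on UNIV S" unfolding S_def[abs_def] by (intro continuous_intros Hct)
  have Sm[measurable]: "S \<in> borel_measurable borel" by (rule borel_measurable_continuous_onI[OF Sc])
  have Hm[measurable]: "(\<lambda>t. H (t, \<eta>)) \<in> borel_measurable borel" for \<eta>
      by (rule borel_measurable_continuous_onI[OF Hct])
  note q(1)[measurable]
  have S0: "0 \<le> S t" for t unfolding S_def using lam(1) H(2)
      by (intro sum_nonneg mult_nonneg_nonneg) (auto intro: less_imp_le)
  obtain e :: "nat \<Rightarrow> 'a" where e: "closure (range e) = UNIV"
  proof -
    obtain D :: "'a set" where D: "countable D" "\<And>X. open X \<Longrightarrow> X \<noteq> {} \<Longrightarrow> \<exists>d\<in>D. d \<in> X"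
      by (rule countable_dense_setE) blast
    have "D \<noteq> {}" using D(2)[of UNIV] by auto
    then have r: "range (from_nat_into D) = D" using D(1) by (rule range_from_nat_into)
    have "closure D = UNIV"
    proof (rule ccontr)
      assume "closure D \<noteq> UNIV"
      then have "- closure D \<noteq> {}" "open (- closure D)" by auto
      then obtain d where "d \<in> D" "d \<in> - closure D" using D(2) by blast
      then show False using closure_subset by blast
    qed
    with r show thesis by (intro that[of "from_nat_into D"]) simp
  qed
  \<comment> \<open>Quantification over a countable dense family makes \<open>P j\<close> a Borel
    condition on the level; \<open>P_all\<close> recovers all vectors by continuity. The slack
    \<open>norm (e l)\<close> pays for replacing the exact slope by a nearby
    \<open>e j\<close>.\<close>
  define P where "P j t \<longleftrightarrow> (\<forall>l. S t \<le> H (t, e l) + q t - e j \<bullet> e l + norm (e l))" for j t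
  have P_all: "S t \<le> H (t, \<eta>) + q t - e j \<bullet> \<eta> + norm \<eta>" if "P j t" for j t \<eta>
  proof -
    have cl: "closed {\<eta>. S t \<le> H (t, \<eta>) + q t - e j \<bullet> \<eta> + norm \<eta>}"
      by (intro closed_Collect_le continuous_intros Hc\<eta>)
    have "range e \<subseteq> {\<eta>. S t \<le> H (t, \<eta>) + q t - e j \<bullet> \<eta> + norm \<eta>}" using that by (auto simp: P_def)
    from closure_minimal[OF this cl] e show ?thesis by auto
  qed
  have P_ex: "\<exists>j. P j t" for t
  proof -
    obtain \<zeta> where z: "\<And>i \<eta>. i \<in> I \<Longrightarrow> H (t, \<eta>) \<ge> H (t, \<xi> i) + \<zeta> i \<bullet> (\<eta> - \<xi> i)"
        "(\<Sum>i\<in>I. lam i * (\<zeta> i \<bullet> \<xi> i)) \<le> q t"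
      using \<zeta>[of t] by blast
    define b where "b = (\<Sum>i\<in>I. lam i *\<^sub>R \<zeta> i)"
    have b: "S t \<le> H (t, \<eta>) + q t - b \<bullet> \<eta>" for \<eta>
    proof -
      have "(\<Sum>i\<in>I. lam i * (H (t, \<xi> i) + \<zeta> i \<bullet> (\<eta> - \<xi> i))) \<le> (\<Sum>i\<in>I. lam i * H (t, \<eta>))"
        using z(1) lam(1) by (intro sum_mono mult_left_mono) (auto intro: less_imp_le)
      moreover have "(\<Sum>i\<in>I. lam i * H (t, \<eta>)) = H (t, \<eta>)" using lam(2)
          by (simp add: sum_distrib_right[symmetric])
      moreover have "(\<Sum>i\<in>I. lam i * (H (t, \<xi> i) + \<zeta> i \<bullet> (\<eta> - \<xi> i))) = S t
          + b \<bullet> \<eta> - (\<Sum>i\<in>I. lam i * (\<zeta> i \<bullet> \<xi> i))"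
        unfolding S_def b_def
        by (simp add: inner_sum_left inner_diff_right algebra_simps sum.distrib sum_subtractf)
      ultimately show ?thesis using z(2) by linarith
    qed
    have "b \<in> closure (range e)" using e by simp
    \<comment> \<open>Distance below 1 is enough: by Cauchy-Schwarz the error in the slope costs at
      most \<open>norm (e l)\<close>.\<close>
    then obtain j where j: "dist (e j) b < 1" unfolding closure_approachable using zero_less_one
        by blast
    have "P j t"
      unfolding P_def
    proof
      fix l
      have "(e j - b) \<bullet> e l \<le> norm (e j - b) * norm (e l)" by (rule norm_cauchy_schwarz)
      also have "\<dots> \<le> 1 * norm (e l)" using j by (intro mult_right_mono) (auto simp: dist_norm)
      finally show "S t \<le> H (t, e l) + q t - e j \<bullet> e l + norm (e l)"
        using b[of "e l"] by (simp add: inner_diff_left)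
    qed
    then show ?thesis by blast
  qed
  define idx where "idx t = (LEAST j. P j t)" for t
  have P_idx: "P (idx t) t" for t unfolding idx_def using P_ex by (rule LeastI_ex)
  have Pm: "Measurable.pred borel (P j)" for j unfolding P_def by measurable
  have idxm: "idx \<in> measurable borel (count_space UNIV)"
    unfolding idx_def by (rule measurable_Least) (rule Pm)
  define A where "A j = idx -` {j}" for j
  have A: "A j \<in> sets borel" for j
    using measurable_sets[OF idxm, of "{j}"] by (simp add: A_def)
  \<comment> \<open>The majorant of \<open>S (u x)\<close> once the flux term is removed. The slack
    \<open>norm (g x)\<close> is integrable as well, since \<open>g\<close> is p-integrable on a set
    of finite measure.\<close>
  define R where "R x = H (u x, g x) + q (u x) + norm (g x)" for x
  have gi: "integrable ?M g" by (rule Lp_integrable[OF p_ge_1 D(5)])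
  have Ri: "integrable ?M R" unfolding R_def using Hu qu gi by simp
  have R0: "0 \<le> R x" for x unfolding R_def using H(2) q(2) by simp
  have Rm[measurable]: "R \<in> borel_measurable ?M" using Ri by auto
  define X where "X j = {x \<in> space ?M. u x \<in> A j \<inter> {t. M < \<bar>t\<bar>}}" for j
  have EM: "A j \<inter> {t. M < \<bar>t\<bar>} \<in> sets borel" for j using A by measurable
  have X[measurable]: "X j \<in> sets ?M" for j
    unfolding X_def using measurable_sets[OF um EM] by (simp add: vimage_def Int_def conj_commute)
  \<comment> \<open>Integrability of \<open>S (u x)\<close> is the goal and cannot be presupposed.
    The two densities are compared as measures on each \<open>X j\<close> and summed by countable
    additivity; finiteness appears only at the end.\<close>
  define N1 where "N1 = density ?M (\<lambda>x. ennreal (S (u x)))"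
  define N2 where "N2 = density ?M (\<lambda>x. ennreal (R x))"
  have le: "emeasure N1 (X j) \<le> emeasure N2 (X j)" for j
  proof -
    define k where "k x = indicat_real (A j \<inter> {t. M < \<bar>t\<bar>}) (u x)" for x
    have km[measurable]: "k \<in> borel_measurable ?M" unfolding k_def
        by (rule measurable_compose[OF um borel_measurable_indicator[OF EM]])
    have kR: "integrable ?M (\<lambda>x. k x *\<^sub>R R x)" and kg: "integrable ?M (\<lambda>x. k x *\<^sub>R g x)"
      by (rule integrable_bounded_mult[OF Ri km, where C
          = 1] integrable_bounded_mult[OF gi km, where C = 1], simp add: k_def indicator_def)+
    have kS: "k x * S (u x) \<le> k x *\<^sub>R R x - e j \<bullet> (k x *\<^sub>R g x)" for x
    proof (cases "u x \<in> A j \<inter> {t. M < \<bar>t\<bar>}")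
      case True
      then have "P j (u x)" using P_idx[of "u x"] by (auto simp: A_def)
      from P_all[OF this, of "g x"] True show ?thesis by (simp add: k_def R_def)
    qed (simp add: k_def)
    have ii: "integrable ?M (\<lambda>x. k x *\<^sub>R R x - e j \<bullet> (k x *\<^sub>R g x))"
      using kR kg by (intro Bochner_Integration.integrable_diff integrable_inner_right)
    have kS0: "0 \<le> k x * S (u x)" for x using S0 by (simp add: k_def)
    \<comment> \<open>On a single \<open>X j\<close> the slope is the constant vector
      \<open>e j\<close>, so this majorant is integrable, although no bound uniform in
      \<open>j\<close> is available.\<close>
    have kSi: "integrable ?M (\<lambda>x. k x * S (u x))"
    proof (rule Bochner_Integration.integrable_bound[OF ii])
      show "AE x in ?M. norm (k x * S (u x)) \<le> norm (k x *\<^sub>R R x - e j \<bullet> (k x *\<^sub>R g x))"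
        using kS kS0 by (intro AE_I2) (metis abs_of_nonneg order_trans real_norm_def)
    qed measurable
    have "(LINT x|?M. k x * S (u x)) \<le> (LINT x|?M. k x *\<^sub>R R x - e j \<bullet> (k x *\<^sub>R g x))"
      by (rule integral_mono[OF kSi ii kS])
    also have "\<dots> = (LINT x|?M. k x *\<^sub>R R x) - e j \<bullet> (LINT x|?M. k x *\<^sub>R g x)"
      using kR kg by (simp add: Bochner_Integration.integral_diff integrable_inner_right del:
          inner_scaleR_right)
    also have "(LINT x|?M. k x *\<^sub>R g x) = 0"
      unfolding k_def by (rule zero_flux[where V = V, OF u V FV A])
    finally have *: "(LINT x|?M. k x * S (u x)) \<le> (LINT x|?M. k x * R x)" by simp
    have "emeasure N1 (X j) = (\<integral>\<^sup>+x. ennreal (k x * S (u x)) \<partial>?M)"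
    proof -
      have "emeasure N1 (X j) = (\<integral>\<^sup>+x. ennreal (S (u x)) * indicator (X j) x \<partial>?M)"
        unfolding N1_def by (rule emeasure_density) measurable
      also have "\<dots> = (\<integral>\<^sup>+x. ennreal (k x * S (u x)) \<partial>?M)"
        by (intro nn_integral_cong) (auto simp: k_def X_def indicator_def)
      finally show ?thesis by simp
    qed
    also have "\<dots> = ennreal (LINT x|?M. k x * S (u x))" using kSi kS0
        by (intro nn_integral_eq_integral) auto
    also have "\<dots> \<le> ennreal (LINT x|?M. k x * R x)" using * by (rule ennreal_leI)
    also have "\<dots> = (\<integral>\<^sup>+x. ennreal (k x * R x) \<partial>?M)" using kR R0
        by (intro nn_integral_eq_integral[symmetric]) (auto simp: k_def)
    also have "\<dots> = emeasure N2 (X j)"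
    proof -
      have "emeasure N2 (X j) = (\<integral>\<^sup>+x. ennreal (R x) * indicator (X j) x \<partial>?M)"
        unfolding N2_def by (rule emeasure_density) measurable
      also have "\<dots> = (\<integral>\<^sup>+x. ennreal (k x * R x) \<partial>?M)"
        by (intro nn_integral_cong) (auto simp: k_def X_def indicator_def)
      finally show ?thesis by simp
    qed
    finally show ?thesis .
  qed
  have disj: "disjoint_family X" by (auto simp: disjoint_family_on_def X_def A_def)
  have sets1: "X j \<in> sets N1" "X j \<in> sets N2" for j by (simp_all add: N1_def N2_def X)
  have "emeasure N1 (\<Union>j. X j) = (\<Sum>j. emeasure N1 (X j))"
    using sets1(1) disj by (intro suminf_emeasure[symmetric]) auto
  also have "\<dots> \<le> (\<Sum>j. emeasure N2 (X j))" by (rule suminf_le[OF le]) simp_all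
  also have "\<dots> = emeasure N2 (\<Union>j. X j)" using sets1(2) disj by (intro suminf_emeasure) auto
  also have "\<dots> \<le> emeasure N2 (space N2)" by (intro emeasure_mono) (auto simp: N2_def X_def)
  also have "\<dots> = (\<integral>\<^sup>+x. ennreal (R x) \<partial>?M)"
    unfolding N2_def by (subst emeasure_density) (auto intro!: nn_integral_cong)
  also have "\<dots> < \<infinity>" using Ri R0 by (subst nn_integral_eq_integral) auto
  finally have fin1: "emeasure N1 (\<Union>j. X j) < \<infinity>" .
  define X0 where "X0 = {x \<in> space ?M. \<bar>u x\<bar> \<le> M}"
  have X0[measurable]: "X0 \<in> sets ?M" unfolding X0_def by measurable
  \<comment> \<open>The flux identity says nothing for \<open>\<bar>u x\<bar> \<le> M\<close>; there
    \<open>S\<close> is bounded by continuity on a compact interval, and \<Omega> has finite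
    measure.\<close>
  have fin0: "emeasure N1 X0 < \<infinity>"
  proof -
    have "bounded (S ` {-M..M})"
      by (intro compact_imp_bounded compact_continuous_image continuous_on_subset[OF Sc]) auto
    then obtain C where C: "\<forall>y\<in>S ` {-M..M}. norm y \<le> C" unfolding bounded_iff by blast
    have SC: "S (u x) \<le> C" if "x \<in> X0" for x
    proof -
      have "u x \<in> {-M..M}" using that by (auto simp: X0_def abs_le_iff)
      then have "norm (S (u x)) \<le> C" using C by blast
      then show ?thesis by simp
    qed
    have "emeasure N1 X0 = (\<integral>\<^sup>+x. ennreal (S (u x)) * indicator X0 x \<partial>?M)"
      unfolding N1_def by (rule emeasure_density) measurable
    also have "\<dots> \<le> (\<integral>\<^sup>+x. ennreal C * indicator X0 x \<partial>?M)"
      using SC by (intro nn_integral_mono) (auto simp: indicator_def intro: ennreal_leI)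
    also have "\<dots> = ennreal C * emeasure ?M X0" by (rule nn_integral_cmult_indicator[OF X0])
    also have "\<dots> < \<infinity>" by (simp add: emeasure_eq_measure ennreal_mult_less_top)
    finally show ?thesis .
  qed
  have "space ?M \<subseteq> X0 \<union> (\<Union>j. X j)" by (auto simp: X0_def X_def A_def)
  then have "emeasure N1 (space ?M) \<le> emeasure N1 (X0 \<union> (\<Union>j. X j))"
    by (intro emeasure_mono) (auto simp: N1_def)
  also have "\<dots> \<le> emeasure N1 X0 + emeasure N1 (\<Union>j. X j)"
    by (intro emeasure_subadditive) (auto simp: N1_def)
  also have "\<dots> < \<infinity>" using fin0 fin1 by simp
  finally have "emeasure N1 (space ?M) < \<infinity>" .
  moreover have "emeasure N1 (space ?M) = (\<integral>\<^sup>+x. ennreal (S (u x)) \<partial>?M)"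
    unfolding N1_def by (subst emeasure_density) (auto intro!: nn_integral_cong)
  ultimately have Si: "integrable ?M (\<lambda>x. S (u x))"
    using S0 by (intro integrableI_nonneg) auto
  show ?thesis
  proof (rule Bochner_Integration.integrable_bound)
    show "integrable ?M (\<lambda>x. S (u x) / lam i)" using Si by simp
    have "lam i * H (u x, \<xi> i) \<le> S (u x)" for x
      unfolding S_def using lam(1) H(2) i I by (intro member_le_sum) (auto intro: mult_nonneg_nonneg
          less_imp_le)
    then have "H (u x, \<xi> i) \<le> S (u x) / lam i" for x
      using lam(1)[OF i] by (simp add: pos_le_divide_eq mult.commute)
    then show "AE x in ?M. norm (H (u x, \<xi> i)) \<le> norm (S (u x) / lam i)"
      using H(2) S0 lam(1)[OF i] by (intro AE_I2) (simp add: abs_of_nonneg)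
  qed measurable
qed

end

section \<open>Truncation with controlled energy\<close>

context bounded_domain
begin

text \<open>Only an upper bound on \<open>F n\<close> is assumed where \<open>V n\<close> is 0, so
  that the result applies to \<open>u\<close> and to \<open>- u\<close> alike. Since
  \<open>w\<close> lies above \<open>t\<close>, it replaces \<open>u\<close> only inside the set
  where \<open>t \<le> u x\<close>, at energy at most \<open>c\<close> per unit of measure.\<close>

lemma upper_excess:
  fixes H :: "real \<times> 'a \<Rightarrow> real" and \<xi> :: "'i \<Rightarrow> 'a"
  assumes u: "W_tendsto \<Omega> p F dF u g" and V: "\<And>n. V n \<in> C1_compact_support \<Omega>"
    and FV: "\<And>n x. V n x = 0 \<Longrightarrow> F n x \<le> M"
    and H: "continuous_on UNIV H" "\<And>z. 0 \<le> H z"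
    and I: "finite I" "I \<noteq> {}" and lam: "\<And>i. i \<in> I \<Longrightarrow> 0 < lam i" "(\<Sum>i\<in>I. lam i *\<^sub>R \<xi> i) = 0"
    and Hi: "\<And>i. i \<in> I \<Longrightarrow> integrable (lebesgue_on \<Omega>) (\<lambda>x. H (u x, \<xi> i))"
    and T: "T > M" and \<epsilon>: "\<epsilon> > 0"
  shows "\<exists>t w dw E dE c. T \<le> t \<and> (\<forall>x. t \<le> w x) \<and> (\<forall>x\<in>\<Omega>. w x \<le> t + 1) \<and> (\<forall>x. dw x \<in> \<xi> ` I) \<and>
    W_tendsto \<Omega> p E dE (\<lambda>x. max 0 (u x - w x)) (\<lambda>x. (if u x > w x then 1 else 0) *\<^sub>R (g x - dw x)) \<and>
    (\<forall>n. E n \<in> C1_compact_support \<Omega>) \<and>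
    0 \<le> c \<and> (\<forall>x\<in>\<Omega>. H (w x, dw x) \<le> c) \<and> c * measure (lebesgue_on \<Omega>) {x \<in> \<Omega>. t \<le> u x} \<le> \<epsilon>"
proof -
  note D = W_tendstoD[OF u]
  \<comment> \<open>The added 1 absorbs the oscillation of \<open>H (s, \<xi> i)\<close> for
    \<open>s\<close> between \<open>t\<close> and \<open>t + d\<close>. The energy density of the
    sawtooth is then at most \<open>f t\<close>, which serves as \<open>c\<close>.\<close>
  define f where "f t = (\<Sum>i\<in>I. H (t, \<xi> i)) + 1" for t
  have f0: "0 \<le> f t" for t unfolding f_def using H(2) by (simp add: sum_nonneg)
  have fi: "integrable (lebesgue_on \<Omega>) (\<lambda>x. f (u x))"
    unfolding f_def using Hi by (intro Bochner_Integration.integrable_add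
        Bochner_Integration.integrable_sum) auto
  obtain t where t: "T \<le> t" "f t * measure (lebesgue_on \<Omega>) {x \<in> \<Omega>. t \<le> u x} \<le> \<epsilon>"
    using small_level_exists[OF D(6) f0 fi \<epsilon>, of T] unfolding space_domain by blast
  have "\<exists>d>0. \<forall>i\<in>I. \<forall>s. \<bar>s - t\<bar> \<le> d \<longrightarrow> H (s, \<xi> i) \<le> H (t, \<xi> i) + 1"
  proof -
    have "\<forall>\<^sub>F d in at_right (0::real). \<forall>i\<in>I. \<forall>s. \<bar>s - t\<bar> \<le> d \<longrightarrow> H (s, \<xi> i) \<le> H (t, \<xi> i) + 1"
    proof (intro eventually_ball_finite I(1) ballI)
      fix i assume "i \<in> I"
      have "continuous_on UNIV (\<lambda>s. H (s, \<xi> i))"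
        by (rule continuous_on_compose2[OF H(1)]) (auto intro!: continuous_intros)
      then have "isCont (\<lambda>s. H (s, \<xi> i)) t" by (simp add: continuous_on_eq_continuous_at)
      then obtain d where d: "d > 0" "\<forall>s. dist s t < d \<longrightarrow> dist (H (s, \<xi> i)) (H (t, \<xi> i)) < 1"
        unfolding continuous_at_eps_delta by (meson zero_less_one)
      show "\<forall>\<^sub>F d in at_right 0. \<forall>s. \<bar>s - t\<bar> \<le> d \<longrightarrow> H (s, \<xi> i) \<le> H (t, \<xi> i) + 1"
        unfolding eventually_at_right_field
      proof (intro exI[of _ d] conjI allI impI d(1))
        fix y s :: real assume "0 < y" "y < d" "\<bar>s - t\<bar> \<le> y"
        then have "dist s t < d" by (simp add: dist_real_def)
        then have "dist (H (s, \<xi> i)) (H (t, \<xi> i)) < 1" using d(2) by blast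
        then show "H (s, \<xi> i) \<le> H (t, \<xi> i) + 1" by (simp add: dist_real_def)
      qed
    qed
    then have "\<forall>\<^sub>F d in at_right (0::real). (\<forall>i\<in>I. \<forall>s. \<bar>s - t\<bar> \<le> d \<longrightarrow> H (s, \<xi> i) \<le> H (t, \<xi> i) + 1)
        \<and> d > 0"
      by (intro eventually_conj eventually_at_right_less)
    then show ?thesis by (auto dest: eventually_happens)
  qed
  then obtain d where d: "d > 0" "\<And>i s. i \<in> I \<Longrightarrow> \<bar>s - t\<bar> \<le> d \<Longrightarrow> H (s, \<xi> i) \<le> H (t, \<xi> i) + 1" by blast
  obtain w dw where w: "uniform_C1_limit w dw" "range dw \<subseteq> \<xi> ` I" "\<And>x. t \<le> w x" "\<And>x. x \<in> \<Omega> \<Longrightarrow> w x \<le> t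
      + min d 1"
    by (rule sawtooth_exists[OF I lam bounded_domain, where \<delta> = "min d 1" and t
        = t]) (use d(1) in auto)
  have wb: "\<bar>w x\<bar> \<le> \<bar>t\<bar> + 1" if "x \<in> \<Omega>" for x using w(3)[of x] w(4)[OF that] by auto
  \<comment> \<open>The tolerance \<open>t - M\<close> is positive since
    \<open>M < T \<le> t\<close>; it keeps the approximations of \<open>w\<close> above
    \<open>M\<close>, as \<open>excess_in_sobolev0\<close> demands.\<close>
  obtain W dW where W: "W_tendsto \<Omega> p W dW w dw" "\<And>n x. \<bar>W n x - w x\<bar> \<le> t - M"
    by (rule uniform_C1_limit_W_tendsto[OF w(1) wb, of "t - M"]) (use t(1) T in auto)
  have WM: "M \<le> W n x" for n x using W(2)[of n x] w(3)[of x] by linarith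
  obtain E dE where E: "W_tendsto \<Omega> p E dE (\<lambda>x. max 0 (u x - w x)) (\<lambda>x. (if u x > w x then 1 else 0)
      *\<^sub>R (g x - dw x))"
    "\<And>n. E n \<in> C1_compact_support \<Omega>"
    by (rule excess_in_sobolev0[where V = V, OF u V FV W(1) WM]) blast+
  have dw: "dw x \<in> \<xi> ` I" for x using w(2) by blast
  have Hw: "H (w x, dw x) \<le> f t" if x: "x \<in> \<Omega>" for x
  proof -
    obtain i where i: "i \<in> I" "dw x = \<xi> i" using dw by blast
    have "\<bar>w x - t\<bar> \<le> d" using w(3)[of x] w(4)[OF x] by simp
    then have "H (w x, \<xi> i) \<le> H (t, \<xi> i) + 1" using d(2)[OF i(1)] by blast
    also have "H (t, \<xi> i) \<le> (\<Sum>i\<in>I. H (t, \<xi> i))" using I(1) i(1) H(2) by (intro member_le_sum) auto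
    finally show ?thesis unfolding i(2) f_def by simp
  qed
  have w1: "w x \<le> t + 1" if "x \<in> \<Omega>" for x using w(4)[OF that] by simp
  show ?thesis
    using t w(3) w1 dw E f0[of t] Hw by blast
qed

text \<open>The conclusion is shaped for dominated convergence: nothing changes where
  \<open>\<bar>u x\<bar> < K\<close>, the changes are bounded by \<open>\<bar>u x\<bar>\<close> and
  \<open>norm (g x) + B\<close>, and the energy error is the energy of \<open>u\<close> on high
  levels plus one \<epsilon> for each side.\<close>

lemma truncation_step:
  fixes H :: "real \<times> 'a \<Rightarrow> real" and \<xi> :: "'i \<Rightarrow> 'a"
  assumes u: "W_tendsto \<Omega> p F dF u g" and V: "\<And>n. V n \<in> C1_compact_support \<Omega>"
    and FV: "\<And>n x. V n x = 0 \<Longrightarrow> \<bar>F n x\<bar> \<le> M" and M: "0 \<le> M"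
    and ua: "u \<in> sobolev_affine \<Omega> p \<phi>"
    and H: "continuous_on UNIV H" "\<And>z. 0 \<le> H z"
    and I: "finite I" "I \<noteq> {}" and lam: "\<And>i. i \<in> I \<Longrightarrow> 0 < lam i" "(\<Sum>i\<in>I. lam i *\<^sub>R \<xi> i) = 0"
    and Hi: "\<And>i. i \<in> I \<Longrightarrow> integrable (lebesgue_on \<Omega>) (\<lambda>x. H (u x, \<xi> i))"
    and Hu: "integrable (lebesgue_on \<Omega>) (\<lambda>x. H (u x, g x))"
    and K: "K > M" and \<epsilon>: "\<epsilon> > 0" and B: "\<And>i. i \<in> I \<Longrightarrow> norm (\<xi> i) \<le> B"
  shows "\<exists>w gw. w \<in> sobolev_affine \<Omega> p \<phi> \<and> (\<exists>C. \<forall>x\<in>\<Omega>. \<bar>w x\<bar> \<le> C) \<and>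
     is_weak_gradient \<Omega> w gw \<and> Lp (lebesgue_on \<Omega>) p w \<and> Lp (lebesgue_on \<Omega>) p gw \<and>
     (\<forall>x\<in>\<Omega>. \<bar>u x\<bar> < K \<longrightarrow> w x = u x \<and> gw x = g x) \<and>
     (\<forall>x\<in>\<Omega>. \<bar>w x - u x\<bar> \<le> \<bar>u x\<bar> \<and> norm (gw x - g x) \<le> norm (g x) + B) \<and>
     integrable (lebesgue_on \<Omega>) (\<lambda>x. H (w x, gw x)) \<and>
     (LINT x|lebesgue_on \<Omega>. \<bar>H (w x, gw x) - H (u x, g x)\<bar>)
       \<le> (LINT x|lebesgue_on \<Omega>. indicator {x. K \<le> \<bar>u x\<bar>} x * H (u x, g x)) + 2 * \<epsilon>"
proof -
  let ?M = "lebesgue_on \<Omega>"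
  note D = W_tendstoD[OF u]
  note um = D(6) and gm = D(7)
  have FV1: "F n x \<le> M" if "V n x = 0" for n x using FV[OF that] by simp
  obtain t1 w1 dw1 E1 dE1 c1 where 1: "K \<le> t1" "\<forall>x. t1 \<le> w1 x" "\<forall>x\<in>\<Omega>. w1 x \<le> t1 + 1"
      "\<forall>x. dw1 x \<in> \<xi> ` I"
    "W_tendsto \<Omega> p E1 dE1 (\<lambda>x. max 0 (u x - w1 x)) (\<lambda>x. (if u x > w1 x then 1 else 0) *\<^sub>R (g x - dw1
        x))"
    "\<forall>n. E1 n \<in> C1_compact_support \<Omega>" "0 \<le> c1" "\<forall>x\<in>\<Omega>. H (w1 x, dw1 x) \<le> c1"
    "c1 * measure ?M {x \<in> \<Omega>. t1 \<le> u x} \<le> \<epsilon>"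
    using upper_excess[where V = V, OF u V FV1 H I lam Hi K \<epsilon>] by blast
  \<comment> \<open>Reflection turns truncation from below into truncation of \<open>- u\<close>
    from above, with the vectors \<open>- \<xi> i\<close>, whose weighted sum is again 0.\<close>
  define H' where "H' z = H (- fst z, - snd z)" for z
  have H': "continuous_on UNIV H'" "\<And>z. 0 \<le> H' z"
    unfolding H'_def[abs_def] by (auto intro!: continuous_on_compose2[OF H(1)] continuous_intros
        H(2))
  have V': "(\<lambda>x. - V n x) \<in> C1_compact_support \<Omega>" for n by (rule C1_compact_support_uminus[OF V])
  have FV2: "- F n x \<le> M" if "- V n x = 0" for n x using FV[of n x] that by simp
  have lam': "(\<Sum>i\<in>I. lam i *\<^sub>R (- \<xi> i)) = 0" using lam(2) by (simp add: sum_negf)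
  have Hi': "integrable ?M (\<lambda>x. H' (- u x, - \<xi> i))" if "i \<in> I" for i using Hi[OF that]
      by (simp add: H'_def)
  obtain t2 w2 dw2 E2 dE2 c2 where 2: "K \<le> t2" "\<forall>x. t2 \<le> w2 x" "\<forall>x\<in>\<Omega>. w2 x \<le> t2 + 1"
      "\<forall>x. dw2 x \<in> (\<lambda>i. - \<xi> i) ` I"
    "W_tendsto \<Omega> p E2 dE2 (\<lambda>x. max 0 (- u x - w2 x)) (\<lambda>x. (if - u x > w2 x then 1 else 0) *\<^sub>R (- g x
        - dw2 x))"
    "\<forall>n. E2 n \<in> C1_compact_support \<Omega>" "0 \<le> c2" "\<forall>x\<in>\<Omega>. H' (w2 x, dw2 x) \<le> c2"
    "c2 * measure ?M {x \<in> \<Omega>. t2 \<le> - u x} \<le> \<epsilon>"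
    using upper_excess[where V = "\<lambda>n x. - V n x", OF W_tendsto_uminus[OF u] V' FV2 H' I lam(1) lam'
        Hi' K \<epsilon>] by blast
  \<comment> \<open>This is \<open>w1\<close> where \<open>u\<close> exceeds \<open>w1\<close>,
    \<open>- w2\<close> where \<open>u\<close> is below \<open>- w2\<close>, and \<open>u\<close>
    elsewhere: both sawtooth functions are at least \<open>K > 0\<close>, so at most one correction
    is active. Written as a sum, \<open>w\<close> visibly stays in the affine class.\<close>
  define w where "w x = u x + - max 0 (u x - w1 x) + max 0 (- u x - w2 x)" for x
  define gw where "gw x = g x + - ((if u x > w1 x then 1 else 0) *\<^sub>R (g x - dw1 x))
      + (if - u x > w2 x then 1 else 0) *\<^sub>R (- g x - dw2 x)" for x
  have K0: "K > 0" using K M by simp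
  have ge: "K \<le> w1 x" "K \<le> w2 x" for x using 1(1,2) 2(1,2) order_trans by blast+
  have c_up: "w x = w1 x" "gw x = dw1 x" if "u x > w1 x" for x
    using that ge[of x] K0 unfolding w_def gw_def by simp_all
  have c_low: "w x = - w2 x" "gw x = - dw2 x" if "- u x > w2 x" for x
    using that ge[of x] K0 unfolding w_def gw_def by simp_all
  have c_mid: "w x = u x" "gw x = g x" if "\<not> u x > w1 x" "\<not> - u x > w2 x" for x
    using that unfolding w_def gw_def by simp_all
  have W: "W_tendsto \<Omega> p (\<lambda>n x. F n x + - E1 n x + E2 n x) (\<lambda>n x. dF n x + - dE1 n x
      + dE2 n x) w gw"
    unfolding w_def[abs_def] gw_def[abs_def]
    by (intro W_tendsto_add p_nonneg u W_tendsto_uminus 1(5) 2(5))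
  note WD = W_tendstoD[OF W]
  have wa: "w \<in> sobolev_affine \<Omega> p \<phi>"
    unfolding w_def[abs_def]
    by (rule sobolev_affine_add[OF sobolev_affine_add[OF ua W_tendsto_uminus[OF 1(5)]] 2(5)])
       (use 1(6) 2(6) C1_compact_support_uminus in blast)+
  have wb: "\<forall>x\<in>\<Omega>. \<bar>w x\<bar> \<le> \<bar>t1\<bar> + \<bar>t2\<bar> + 1"
  proof
    fix x assume x: "x \<in> \<Omega>"
    note b = 1(2)[rule_format, of x] 1(3)[rule_format, OF x] 2(2)[rule_format, of x]
        2(3)[rule_format, OF x]
    consider "u x > w1 x" | "- u x > w2 x" | "\<not> u x > w1 x" "\<not> - u x > w2 x" by blast
    then show "\<bar>w x\<bar> \<le> \<bar>t1\<bar> + \<bar>t2\<bar> + 1"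
      by cases (use b c_up c_low c_mid in \<open>auto simp: abs_le_iff\<close>)
  qed
  have small: "\<not> u x > w1 x" "\<not> - u x > w2 x" if "\<bar>u x\<bar> < K" for x
    using that ge[of x] by auto
  have near: "\<bar>w x - u x\<bar> \<le> \<bar>u x\<bar>" for x
  proof -
    consider "u x > w1 x" | "- u x > w2 x" | "\<not> u x > w1 x" "\<not> - u x > w2 x" by blast
    then show ?thesis
      by cases (use ge[of x] K0 c_up[of x] c_low[of x] c_mid[of x] in auto)
  qed
  have dB: "norm (dw1 x) \<le> B" "norm (dw2 x) \<le> B" for x
  proof -
    obtain i where "i \<in> I" "dw1 x = \<xi> i" using 1(4) by blast
    then show "norm (dw1 x) \<le> B" using B by simp
    obtain i where "i \<in> I" "dw2 x = - \<xi> i" using 2(4) by blast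
    then show "norm (dw2 x) \<le> B" using B by simp
  qed
  have B0: "0 \<le> B" using dB(1) norm_ge_zero order_trans by blast
  have gnear: "norm (gw x - g x) \<le> norm (g x) + B" for x
  proof -
    consider "u x > w1 x" | "- u x > w2 x" | "\<not> u x > w1 x" "\<not> - u x > w2 x" by blast
    then show ?thesis
    proof cases
      case 1
      then show ?thesis using c_up(2)[of x] norm_triangle_ineq4[of "dw1 x" "g x"] dB(1)[of x]
          by simp
    next
      case 2
      then show ?thesis using c_low(2)[of x] norm_triangle_ineq4[of "- dw2 x" "g x"] dB(2)[of x]
          by simp
    next
      case 3
      then show ?thesis using c_mid(2)[of x] B0 by simp
    qed
  qed
  define A1 where "A1 = {x \<in> \<Omega>. t1 \<le> u x}"
  define A2 where "A2 = {x \<in> \<Omega>. t2 \<le> - u x}"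
  have A: "A1 \<in> sets ?M" "A2 \<in> sets ?M"
  proof -
    have "{x \<in> space ?M. t1 \<le> u x} \<in> sets ?M" "{x \<in> space ?M. t2 \<le> - u x} \<in> sets ?M" using um
        by measurable
    then show "A1 \<in> sets ?M" "A2 \<in> sets ?M" by (simp_all add: A1_def A2_def)
  qed
  have Hw: "H (w x, gw x) \<le> H (u x, g x) + c1 * indicator A1 x
      + c2 * indicator A2 x" if x: "x \<in> \<Omega>" for x
  proof -
    consider "u x > w1 x" | "- u x > w2 x" | "\<not> u x > w1 x" "\<not> - u x > w2 x" by blast
    then show ?thesis
    proof cases
      case up: 1
      have "t1 \<le> u x" using 1(2)[rule_format, of x] up by linarith
      then have "x \<in> A1" using x by (simp add: A1_def)
      moreover have "0 \<le> c2 * indicator A2 x" using 2(7) by simp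
      moreover have "H (w x, gw x) \<le> c1" using c_up[OF up] 1(8)[rule_format, OF x] by simp
      ultimately show ?thesis using H(2)[of "(u x, g x)"] by simp
    next
      case low: 2
      have "t2 \<le> - u x" using 2(2)[rule_format, of x] low by linarith
      then have "x \<in> A2" using x by (simp add: A2_def)
      moreover have "0 \<le> c1 * indicator A1 x" using 1(7) by simp
      moreover have "H (w x, gw x) \<le> c2" using 2(8)[rule_format, OF x] c_low[OF low]
          by (simp add: H'_def)
      ultimately show ?thesis using H(2)[of "(u x, g x)"] by simp
    next
      case 3
      then show ?thesis using c_mid[OF 3] 1(7) 2(7) by simp
    qed
  qed
  have ci: "integrable ?M (\<lambda>x. c * indicat_real S x)" if "S \<in> sets ?M" for c S
    using that by (intro integrable_mult_right integrable_real_indicator) (simp_all add: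
        emeasure_eq_measure)
  have Hwm: "(\<lambda>x. H (w x, gw x)) \<in> borel_measurable ?M" by (rule measurable_integrand[OF H(1)
      WD(6,7)])
  have Hwi: "integrable ?M (\<lambda>x. H (w x, gw x))"
  proof (rule Bochner_Integration.integrable_bound[OF _ Hwm])
    show "integrable ?M (\<lambda>x. H (u x, g x) + c1 * indicator A1 x + c2 * indicator A2 x)"
      by (intro Bochner_Integration.integrable_add Hu ci A)
    show "AE x in ?M. norm (H (w x, gw x)) \<le> norm (H (u x, g x) + c1 * indicator A1 x
        + c2 * indicator A2 x)"
    proof (intro AE_I2)
      fix x assume "x \<in> space ?M"
      then show "norm (H (w x, gw x)) \<le> norm (H (u x, g x) + c1 * indicator A1 x
          + c2 * indicator A2 x)"
        using Hw[of x] H(2)[of "(w x, gw x)"] by simp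
    qed
  qed
  define Q where "Q = {x \<in> \<Omega>. K \<le> \<bar>u x\<bar>}"
  have Q: "Q \<in> sets ?M"
  proof -
    have "{x \<in> space ?M. K \<le> \<bar>u x\<bar>} \<in> sets ?M" using um by measurable
    then show ?thesis by (simp add: Q_def)
  qed
  have Qi: "integrable ?M (\<lambda>x. indicat_real Q x * H (u x, g x))"
    using integrable_mult_indicator[OF Q Hu] by simp
  have diff: "\<bar>H (w x, gw x) - H (u x, g x)\<bar> \<le> indicator Q x * H (u x, g x) + c1 * indicator A1 x
      + c2 * indicator A2 x" if x: "x \<in> \<Omega>" for x
  proof (cases "\<bar>u x\<bar> < K")
    case True
    have "w x = u x" "gw x = g x" using c_mid[OF small[OF True]] by simp_all
    then show ?thesis using 1(7) 2(7) H(2)[of "(u x, g x)"] by simp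
  next
    case False
    then have xQ: "x \<in> Q" using x by (simp add: Q_def)
    \<comment> \<open>For nonnegative energies the difference is at most their sum, so no
      cancellation has to be estimated.\<close>
    have bound: "\<bar>a - b\<bar> \<le> b + c" if "0 \<le> a" "a \<le> c" "0 \<le> b" for a b c :: real using that
        by linarith
    consider "u x > w1 x" | "- u x > w2 x" | "\<not> u x > w1 x" "\<not> - u x > w2 x" by blast
    then show ?thesis
    proof cases
      case up: 1
      have "t1 \<le> u x" using 1(2)[rule_format, of x] up by linarith
      then have "x \<in> A1" using x by (simp add: A1_def)
      moreover have "0 \<le> c2 * indicat_real A2 x" using 2(7) by simp
      moreover have "H (w x, gw x) \<le> c1" using c_up[OF up] 1(8)[rule_format, OF x] by simp
      ultimately show ?thesis using bound[OF H(2) _ H(2), of "(w x, gw x)" c1 "(u x, g x)"] xQ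
          by simp
    next
      case low: 2
      have "t2 \<le> - u x" using 2(2)[rule_format, of x] low by linarith
      then have "x \<in> A2" using x by (simp add: A2_def)
      moreover have "0 \<le> c1 * indicat_real A1 x" using 1(7) by simp
      moreover have "H (w x, gw x) \<le> c2" using 2(8)[rule_format, OF x] c_low[OF low]
          by (simp add: H'_def)
      ultimately show ?thesis using bound[OF H(2) _ H(2), of "(w x, gw x)" c2 "(u x, g x)"] xQ
          by simp
    next
      case 3
      then show ?thesis using c_mid[OF 3] 1(7) 2(7) H(2)[of "(u x, g x)"] by simp
    qed
  qed
  have "(LINT x|?M. \<bar>H (w x, gw x) - H (u x, g x)\<bar>)
    \<le> (LINT x|?M. indicator Q x * H (u x, g x) + c1 * indicator A1 x + c2 * indicator A2 x)"
  proof (rule integral_mono)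
    show "integrable ?M (\<lambda>x. \<bar>H (w x, gw x) - H (u x, g x)\<bar>)" using Hwi Hu by simp
    show "integrable ?M (\<lambda>x. indicator Q x * H (u x, g x) + c1 * indicator A1 x
        + c2 * indicator A2 x)"
      by (intro Bochner_Integration.integrable_add Qi ci A)
  qed (use diff in simp)
  also have "\<dots> = (LINT x|?M. indicator Q x * H (u x, g x)) + (LINT x|?M. c1 * indicator A1 x) +
      (LINT x|?M. c2 * indicator A2 x)"
    by (simp only: Bochner_Integration.integral_add Bochner_Integration.integrable_add Qi ci A)
  also have "(LINT x|?M. c1 * indicator A1 x) = c1 * measure ?M A1"
  proof -
    have "A1 \<inter> space ?M = A1" by (auto simp: A1_def)
    then show ?thesis using A(1) by simp
  qed
  also have "(LINT x|?M. c2 * indicator A2 x) = c2 * measure ?M A2"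
  proof -
    have "A2 \<inter> space ?M = A2" by (auto simp: A2_def)
    then show ?thesis using A(2) by simp
  qed
  also have "(LINT x|?M. indicator Q x * H (u x, g x)) = (LINT x|?M. indicator {x. K
      \<le> \<bar>u x\<bar>} x * H (u x, g x))"
    by (intro Bochner_Integration.integral_cong) (auto simp: Q_def indicator_def)
  finally have cost: "(LINT x|?M. \<bar>H (w x, gw x) - H (u x, g x)\<bar>)
      \<le> (LINT x|?M. indicator {x. K \<le> \<bar>u x\<bar>} x * H (u x, g x)) + 2 * \<epsilon>"
    using 1(9) 2(9) by (simp add: A1_def A2_def)
  have eqs: "\<forall>x\<in>\<Omega>. \<bar>u x\<bar> < K \<longrightarrow> w x = u x \<and> gw x = g x" using c_mid small by blast
  have nears: "\<forall>x\<in>\<Omega>. \<bar>w x - u x\<bar> \<le> \<bar>u x\<bar> \<and> norm (gw x - g x) \<le> norm (g x) + B" using near gnear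
      by blast
  show ?thesis
    by (intro exI[of _ w] exI[of _ gw] conjI exI[of _ "\<bar>t1\<bar> + \<bar>t2\<bar>
        + 1"] wa wb W_tendsto_imp_weak_gradient[OF W] WD(4,5) eqs nears Hwi cost)
qed

end

text \<open>Replaces the chosen \<open>weak_gradient\<close> by an explicit gradient
  \<open>g\<close>, in the energy as well as in admissibility; measurability of the original
  integrand follows from completeness of Lebesgue measure.\<close>

lemma (in bounded_domain) admissible_iff:
  assumes L: "\<forall>x\<in>\<Omega>. \<forall>t \<eta>. L x t \<eta> = H (t, \<eta>)" and H: "continuous_on UNIV H"
    and w: "is_weak_gradient \<Omega> w g" "w \<in> borel_measurable (lebesgue_on \<Omega>)" "g \<in> borel_measurable
        (lebesgue_on \<Omega>)"
  shows "AE x in lebesgue_on \<Omega>. L x (w x) (weak_gradient \<Omega> w x) = H (w x, g x)"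
    "(\<lambda>x. L x (w x) (weak_gradient \<Omega> w x)) \<in> borel_measurable (lebesgue_on \<Omega>)"
    "w \<in> admissible \<Omega> p \<phi> L \<longleftrightarrow> w \<in> sobolev_affine \<Omega> p \<phi> \<and> integrable (lebesgue_on \<Omega>) (\<lambda>x. H (w x, g
        x))"
proof -
  let ?M = "lebesgue_on \<Omega>"
  have Hm: "(\<lambda>x. H (w x, g x)) \<in> borel_measurable ?M" by (rule measurable_integrand[OF H w(2,3)])
  have in\<Omega>: "AE x in ?M. x \<in> \<Omega>" by (intro AE_I2) simp
  show ae: "AE x in ?M. L x (w x) (weak_gradient \<Omega> w x) = H (w x, g x)"
    using weak_gradient_AE_eq[OF open_domain w(1)] in\<Omega> by eventually_elim (simp add: L)
  then have ae': "AE x in ?M. H (w x, g x) = L x (w x) (weak_gradient \<Omega> w x)"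
      by eventually_elim simp
  show Lm: "(\<lambda>x. L x (w x) (weak_gradient \<Omega> w x)) \<in> borel_measurable ?M"
    by (rule borel_measurable_lebesgue_on_AE[OF domain_lebesgue Hm ae'])
  have "integrable ?M (\<lambda>x. L x (w x) (weak_gradient \<Omega> w x)) \<longleftrightarrow> integrable ?M (\<lambda>x. H (w x, g x))"
    by (rule integrable_cong_AE[OF Lm Hm ae])
  then show "w \<in> admissible \<Omega> p \<phi> L \<longleftrightarrow> w \<in> sobolev_affine \<Omega> p \<phi> \<and> integrable ?M (\<lambda>x. H (w x, g x))"
    by (simp add: admissible_def)
qed

text \<open>Truncates at levels tending to infinity with energy tolerance
  \<open>1 / real (Suc k)\<close>. At each point of \<Omega> the truncated functions and gradients
  eventually coincide with those of \<open>u\<close>, so the majorants supplied by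
  \<open>truncation_step\<close> give convergence.\<close>

lemma (in bounded_domain) Linf_regular_of_integrable:
  fixes H :: "real \<times> 'a \<Rightarrow> real" and \<xi> :: "'i \<Rightarrow> 'a"
  assumes u: "W_tendsto \<Omega> p F dF u g" and V: "\<And>n. V n \<in> C1_compact_support \<Omega>"
    and FV: "\<And>n x. V n x = 0 \<Longrightarrow> \<bar>F n x\<bar> \<le> M" and M: "0 \<le> M"
    and ua: "u \<in> sobolev_affine \<Omega> p \<phi>"
    and H: "continuous_on UNIV H" "\<And>z. 0 \<le> H z" and L: "\<forall>x\<in>\<Omega>. \<forall>t \<eta>. L x t \<eta> = H (t, \<eta>)"
    and I: "finite I" "I \<noteq> {}" and lam: "\<And>i. i \<in> I \<Longrightarrow> 0 < lam i" "(\<Sum>i\<in>I. lam i *\<^sub>R \<xi> i) = 0"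
    and Hi: "\<And>i. i \<in> I \<Longrightarrow> integrable (lebesgue_on \<Omega>) (\<lambda>x. H (u x, \<xi> i))"
    and Hu: "integrable (lebesgue_on \<Omega>) (\<lambda>x. H (u x, g x))"
  shows "Linf_regular \<Omega> p \<phi> L u"
proof -
  let ?M = "lebesgue_on \<Omega>"
  note D = W_tendstoD[OF u]
  note wu = W_tendsto_imp_weak_gradient[OF u]
  define B where "B = (\<Sum>i\<in>I. norm (\<xi> i))"
  have B: "norm (\<xi> i) \<le> B" if "i \<in> I" for i
    unfolding B_def using member_le_sum[of i I "\<lambda>i. norm (\<xi> i)"] I(1) that by simp
  have B0: "0 \<le> B" unfolding B_def by (simp add: sum_nonneg)
  \<comment> \<open>Starts above \<open>M\<close>, as truncation requires, and eventually exceeds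
    every value of \<open>\<bar>u x\<bar>\<close>.\<close>
  define K where "K k = M + 1 + real k" for k :: nat
  define h where "h k x = indicator {x. K k \<le> \<bar>u x\<bar>} x * H (u x, g x)" for k x
  have "\<forall>k. \<exists>w gw. w \<in> sobolev_affine \<Omega> p \<phi> \<and> (\<exists>C. \<forall>x\<in>\<Omega>. \<bar>w x\<bar> \<le> C) \<and>
     is_weak_gradient \<Omega> w gw \<and> Lp ?M p w \<and> Lp ?M p gw \<and>
     (\<forall>x\<in>\<Omega>. \<bar>u x\<bar> < K k \<longrightarrow> w x = u x \<and> gw x = g x) \<and>
     (\<forall>x\<in>\<Omega>. \<bar>w x - u x\<bar> \<le> \<bar>u x\<bar> \<and> norm (gw x - g x) \<le> norm (g x) + B) \<and>
     integrable ?M (\<lambda>x. H (w x, gw x)) \<and>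
     (LINT x|?M. \<bar>H (w x, gw x) - H (u x, g x)\<bar>) \<le> (LINT x|?M. h k x) + 2 * (1 / real (Suc k))"
    unfolding h_def
    by (intro allI truncation_step[where V = V, OF u V FV M ua H I lam Hi Hu _ _ B]) (simp_all add:
        K_def)
  from choice[OF this] obtain w where "\<forall>k. \<exists>gw. w k \<in> sobolev_affine \<Omega> p \<phi> \<and> (\<exists>C. \<forall>x\<in>\<Omega>. \<bar>w k x\<bar> \<le> C)
      \<and>
     is_weak_gradient \<Omega> (w k) gw \<and> Lp ?M p (w k) \<and> Lp ?M p gw \<and>
     (\<forall>x\<in>\<Omega>. \<bar>u x\<bar> < K k \<longrightarrow> w k x = u x \<and> gw x = g x) \<and>
     (\<forall>x\<in>\<Omega>. \<bar>w k x - u x\<bar> \<le> \<bar>u x\<bar> \<and> norm (gw x - g x) \<le> norm (g x) + B) \<and>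
     integrable ?M (\<lambda>x. H (w k x, gw x)) \<and>
     (LINT x|?M. \<bar>H (w k x, gw x) - H (u x, g x)\<bar>) \<le> (LINT x|?M. h k x) + 2 * (1 / real (Suc k))"
    by (rule exE)
  from choice[OF this] obtain gw where w: "\<forall>k. w k \<in> sobolev_affine \<Omega> p \<phi> \<and> (\<exists>C. \<forall>x\<in>\<Omega>. \<bar>w k x\<bar> \<le> C)
      \<and>
     is_weak_gradient \<Omega> (w k) (gw k) \<and> Lp ?M p (w k) \<and> Lp ?M p (gw k) \<and>
     (\<forall>x\<in>\<Omega>. \<bar>u x\<bar> < K k \<longrightarrow> w k x = u x \<and> gw k x = g x) \<and>
     (\<forall>x\<in>\<Omega>. \<bar>w k x - u x\<bar> \<le> \<bar>u x\<bar> \<and> norm (gw k x - g x) \<le> norm (g x) + B) \<and>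
     integrable ?M (\<lambda>x. H (w k x, gw k x)) \<and>
     (LINT x|?M. \<bar>H (w k x, gw k x) - H (u x, g x)\<bar>) \<le> (LINT x|?M. h k x) + 2 * (1 / real (Suc k))"
    by (rule exE)
  have w1: "w k \<in> sobolev_affine \<Omega> p \<phi>" and w2: "\<exists>C. \<forall>x\<in>\<Omega>. \<bar>w k x\<bar> \<le> C"
      and w3: "is_weak_gradient \<Omega> (w k) (gw k)"
    and w4: "Lp ?M p (w k)" and w5: "Lp ?M p (gw k)" for k
    using w[rule_format, of k] by blast+
  have w6: "w k x = u x" "gw k x = g x" if "x \<in> \<Omega>" "\<bar>u x\<bar> < K k" for k x
    using w[rule_format, of k] that by blast+
  have w7: "\<bar>w k x - u x\<bar> \<le> \<bar>u x\<bar>" "norm (gw k x - g x) \<le> norm (g x) + B" if "x \<in> \<Omega>" for k x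
    using w[rule_format, of k] that by blast+
  have w8: "integrable ?M (\<lambda>x. H (w k x, gw k x))"
    and w9: "(LINT x|?M. \<bar>H (w k x, gw k x) - H (u x, g x)\<bar>) \<le> (LINT x|?M. h k x)
        + 2 * (1 / real (Suc k))" for k
    using w[rule_format, of k] by blast+
  have wm: "w k \<in> borel_measurable ?M" "gw k \<in> borel_measurable ?M" for k
    by (rule LpD(1)[OF w4] LpD(1)[OF w5])+
  note aw = admissible_iff[OF L H(1) w3 wm]
  note au = admissible_iff[OF L H(1) wu D(6,7)]
  have big: "\<forall>\<^sub>F k in sequentially. \<bar>u x\<bar> < K k" for x
  proof -
    obtain N where N: "\<bar>u x\<bar> - M < real N" using reals_Archimedean2 by blast
    show ?thesis unfolding eventually_sequentially K_def by (intro exI[of _ N]) (use N in auto)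
  qed
  have "u \<in> admissible \<Omega> p \<phi> L" using au(3) ua Hu by blast
  moreover have "w k \<in> admissible \<Omega> p \<phi> L \<inter> Linf_space \<Omega>" for k
  proof
    show "w k \<in> admissible \<Omega> p \<phi> L" using aw(3) w1 w8 by blast
    obtain C where C: "\<forall>x\<in>\<Omega>. \<bar>w k x\<bar> \<le> C" using w2 by blast
    then have "AE x in ?M. \<bar>w k x\<bar> \<le> C" by (intro AE_I2) simp
    then show "w k \<in> Linf_space \<Omega>" unfolding Linf_space_def using wm by blast
  qed
  moreover have "(\<lambda>k. sobolev_norm \<Omega> p (\<lambda>x. w k x - u x)) \<longlonglongrightarrow> 0"
  proof (rule sobolev_norm_tendsto_0)
    show "is_weak_gradient \<Omega> (\<lambda>x. w k x - u x) (\<lambda>x. gw k x - g x)" for k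
      by (rule is_weak_gradient_diff[OF w3 wu w4 w5 D(4,5)])
    show "(\<lambda>x. gw k x - g x) \<in> borel_measurable ?M" for k
        by (rule borel_measurable_diff[OF wm(2) D(7)])
    have "Lp_tendsto ?M p (\<lambda>k x. w k x - u x) (\<lambda>x. 0)"
    proof (rule Lp_tendsto_dominated[OF p_pos D(4)])
      show "AE x in ?M. norm (w k x - u x) \<le> norm (u x)" for k using w7(1) by (intro AE_I2) simp
      show "AE x in ?M. (\<lambda>k. w k x - u x) \<longlonglongrightarrow> 0"
      proof (intro AE_I2 tendsto_eventually)
        fix x assume x: "x \<in> space ?M"
        show "\<forall>\<^sub>F k in sequentially. w k x - u x = 0"
          using big[of x] by eventually_elim (use x w6(1) in simp)
      qed
    qed (use wm D(6) in auto)
    from Lp_tendstoD(3)[OF this] show "(\<lambda>k. LINT x|?M. norm (w k x - u x) powr p) \<longlonglongrightarrow> 0" by simp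
    have Lg: "Lp ?M p (\<lambda>x. norm (g x) + B)"
    proof (rule Lp_add[OF p_nonneg])
      show "Lp ?M p (\<lambda>x. norm (g x))" using D(5) by (auto simp: Lp_def)
      show "Lp ?M p (\<lambda>x. B)" by (rule Lp_continuous) (rule continuous_on_const)
    qed
    have "Lp_tendsto ?M p (\<lambda>k x. gw k x - g x) (\<lambda>x. 0)"
    proof (rule Lp_tendsto_dominated[OF p_pos Lg])
      show "AE x in ?M. norm (gw k x - g x) \<le> norm (norm (g x) + B)" for k
      proof (intro AE_I2)
        fix x assume "x \<in> space ?M"
        then show "norm (gw k x - g x) \<le> norm (norm (g x) + B)" using w7(2)[of x k] B0 by simp
      qed
      show "AE x in ?M. (\<lambda>k. gw k x - g x) \<longlonglongrightarrow> 0"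
      proof (intro AE_I2 tendsto_eventually)
        fix x assume x: "x \<in> space ?M"
        show "\<forall>\<^sub>F k in sequentially. gw k x - g x = 0"
          using big[of x] by eventually_elim (use x w6(2) in simp)
      qed
    qed (use wm D(7) in auto)
    from Lp_tendstoD(3)[OF this] show "(\<lambda>k. LINT x|?M. norm (gw k x - g x) powr p) \<longlonglongrightarrow> 0" by simp
  qed
  moreover have "(\<lambda>k. LINT x|?M. \<bar>L x (w k x) (weak_gradient \<Omega> (w k) x) - L x (u x) (weak_gradient \<Omega>
      u x)\<bar>) \<longlonglongrightarrow> 0"
  proof -
    have eq: "(LINT x|?M. \<bar>L x (w k x) (weak_gradient \<Omega> (w k) x) - L x (u x) (weak_gradient \<Omega> u x)\<bar>)
      = (LINT x|?M. \<bar>H (w k x, gw k x) - H (u x, g x)\<bar>)" for k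
    proof (rule integral_cong_AE)
      show "AE x in ?M. \<bar>L x (w k x) (weak_gradient \<Omega> (w k) x) - L x (u x) (weak_gradient \<Omega> u x)\<bar>
          = \<bar>H (w k x, gw k x) - H (u x, g x)\<bar>"
        using aw(1)[of k] au(1) by eventually_elim simp
    qed (use aw(2)[of k] au(2) borel_measurable_integrable[OF w8] borel_measurable_integrable[OF Hu]
        in auto)
    \<comment> \<open>The energy of \<open>u\<close> on levels at least \<open>K k\<close>
      disappears in the limit, because \<open>H (u x, g x)\<close> is integrable.\<close>
    have "(\<lambda>k. LINT x|?M. h k x) \<longlonglongrightarrow> (LINT x|?M. 0)"
    proof (rule integral_dominated_convergence[where w = "\<lambda>x. H (u x, g x)"])
      have "(\<lambda>x. indicat_real {x. K k \<le> \<bar>u x\<bar>} x) \<in> borel_measurable ?M" for k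
        using D(6) by measurable
      then show "h k \<in> borel_measurable ?M" for k
        unfolding h_def[abs_def] using borel_measurable_integrable[OF Hu]
            by (intro borel_measurable_times) auto
      show "AE x in ?M. (\<lambda>k. h k x) \<longlonglongrightarrow> 0"
      proof (intro AE_I2 tendsto_eventually)
        fix x
        show "\<forall>\<^sub>F k in sequentially. h k x = 0" using big[of x] by eventually_elim (simp add: h_def)
      qed
      show "AE x in ?M. norm (h k x) \<le> H (u x, g x)" for k
        using H(2) by (intro AE_I2) (simp add: h_def indicator_def)
    qed (use Hu in auto)
    then have "(\<lambda>k. LINT x|?M. h k x) \<longlonglongrightarrow> 0" by simp
    moreover have "(\<lambda>k. 2 * (1 / real (Suc k))) \<longlonglongrightarrow> 0"
      by (intro tendsto_mult_right_zero LIMSEQ_Suc[OF lim_const_over_n])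
    ultimately have lim: "(\<lambda>k. (LINT x|?M. h k x) + 2 * (1 / real (Suc k))) \<longlonglongrightarrow> 0"
        by (rule tendsto_add_zero)
    show ?thesis
      unfolding eq by (rule tendsto_sandwich[OF _ _ tendsto_const lim]; intro always_eventually allI
          w9) simp
  qed
  ultimately show ?thesis unfolding Linf_regular_def by blast
qed

theorem theorem3p4:
  fixes \<Omega> :: "(real ^ 'n) set"
    and p :: real
    and \<phi> :: "real ^ 'n \<Rightarrow> real"
    and L :: "real ^ 'n \<Rightarrow> real \<Rightarrow> real ^ 'n \<Rightarrow> real"
    and H :: "real \<times> (real ^ 'n) \<Rightarrow> real"
    and m :: nat
    and \<xi> :: "nat \<Rightarrow> real ^ 'n"
    and lam :: "nat \<Rightarrow> real"
    and q :: "real \<Rightarrow> real"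
  assumes "open \<Omega>" and "bounded \<Omega>"
    and "1 \<le> p" and "p \<le> real CARD('n)"
    and "\<phi> \<in> sobolev UNIV p \<inter> Linf_space UNIV"
    and "continuous_on UNIV H" and "\<forall>z. 0 \<le> H z"
    and "\<forall>x\<in>\<Omega>. \<forall>t \<eta>. L x t \<eta> = H (t, \<eta>)"
    and "\<forall>i\<in>{1..m}. 0 < lam i"
    and "(\<Sum>i=1..m. lam i) = 1"
    and "(\<Sum>i=1..m. lam i *\<^sub>R \<xi> i) = 0"
    and "q \<in> borel_measurable borel" and "\<forall>t. 0 \<le> q t"
    and "\<forall>t. \<exists>\<zeta> :: nat \<Rightarrow> real ^ 'n.
           (\<forall>i\<in>{1..m}. \<forall>\<eta>. H (t, \<eta>) \<ge> H (t, \<xi> i) + \<zeta> i \<bullet> (\<eta> - \<xi> i)) \<and>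
           (\<Sum>i=1..m. lam i * (\<zeta> i \<bullet> \<xi> i)) \<le> q t"
  shows "\<forall>u \<in> admissible \<Omega> p \<phi> L. integrable (lebesgue_on \<Omega>) (\<lambda>x. q (u x)) \<longrightarrow>
           (\<forall>i\<in>{1..m}. integrable (lebesgue_on \<Omega>) (\<lambda>x. H (u x, \<xi> i))) \<and>
           Linf_regular \<Omega> p \<phi> L u"
proof (intro ballI impI)
  fix u assume u: "u \<in> admissible \<Omega> p \<phi> L" and qu: "integrable (lebesgue_on \<Omega>) (\<lambda>x. q (u x))"
  interpret bounded_domain \<Omega> p by unfold_locales (fact assms)+
  note H = assms(6) and H0 = assms(7)[rule_format] and L = assms(8)
  have ua: "u \<in> sobolev_affine \<Omega> p \<phi>" using u by (simp add: admissible_def)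
  obtain F dF g V M where W: "W_tendsto \<Omega> p F dF u g" and V: "\<And>n. V n \<in> C1_compact_support \<Omega>"
    and FV: "\<And>n x. V n x = 0 \<Longrightarrow> \<bar>F n x\<bar> \<le> M" and M: "0 \<le> M"
    by (rule sobolev_affine_approx[OF assms(5) ua]) blast
  note D = W_tendstoD[OF W]
  have Hu: "integrable (lebesgue_on \<Omega>) (\<lambda>x. H (u x, g x))"
    using admissible_iff(3)[OF L H W_tendsto_imp_weak_gradient[OF W] D(6,7)] u by blast
  have Hi: "integrable (lebesgue_on \<Omega>) (\<lambda>x. H (u x, \<xi> i))" if "i \<in> {1..m}" for i
    by (rule convex_combination_integrable[where V = V and I = "{1..m}" and lam = lam and
        q = q, OF W V FV H H0 assms(12) _ _ _ assms(10) _ Hu qu that])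
       (use assms(9,13,14) in auto)
  \<comment> \<open>Weights with sum 1 exclude an empty family; the maxima that define the sawtooth
    functions need this.\<close>
  have "{1..m} \<noteq> {}"
  proof
    assume "{1..m} = {}"
    then have "(\<Sum>i=1..m. lam i) = 0" by simp
    then show False using assms(10) by simp
  qed
  then have "Linf_regular \<Omega> p \<phi> L u"
    using assms(9)
    by (intro Linf_regular_of_integrable[where V = V and I = "{1..m}" and lam
        = lam, OF W V FV M ua H H0 L _ _ _ assms(11) Hi Hu]) auto
  with Hi show "(\<forall>i\<in>{1..m}. integrable (lebesgue_on \<Omega>) (\<lambda>x. H (u x, \<xi> i))) \<and> Linf_regular \<Omega> p \<phi> L u"
      by blast
qed

end
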